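(* Let $\Phi:\Sigma\to\mathbb{S}^2\times\mathbb{S}^2$ be a Lagrangian immersion of a compact surface $\Sigma$ whose mean curvature vector is parallel (with respect to the normal connection) and non null. Then there exist $a,b\in[0,1)$ with $a^2+b^2>0$ such that $\Phi$ is congruent to a finite covering of the embedded torus $$T_{a,b}=\{(x,y)\in\mathbb{S}^2\times\mathbb{S}^2 : x_1=a,\ y_1=b\},$$ where $x=(x_1,x_2,x_3)$, $y=(y_1,y_2,y_3)$.
   Context: $\mathbb{S}^2\subset\mathbb{R}^3$ is the unit sphere with its standard metric $\langle\,,\rangle$, complex structure $J_xv=x\times v$ and Kähler (area) form $\omega_0(v,w)=\langle J_xv,w\rangle$. $\mathbb{S}^2\times\mathbb{S}^2$ carries the product metric, the product complex structure $J(v_1,v_2)=(Jv_1,Jv_2)$ and Kähler form $\omega=\pi_1^*\omega_0+\pi_2^*\omega_0$, with $\pi_1,\pi_2$ the projections. An immersion $\Phi:\Sigma\to\mathbb{S}^2\times\mathbb{S}^2$ of a surface is Lagrangian if $\Phi^*\omega=0$; $\Sigma$ is given the induced metric. Surfaces are connected; compact means compact without boundary. "Congruent" means equal up to composition with an isometry of $\mathbb{S}^2\times\mathbb{S}^2$; "$\Phi$ is congruent to a finite covering of $T_{a,b}$" means that, after composing with an isometry of $\mathbb{S}^2\times\mathbb{S}^2$, $\Phi$ is a finite covering map $\Sigma\to T_{a,b}$ followed by the inclusion. *)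

theory Defs
  imports "HOL-Analysis.Analysis"
begin

section \<open>Smooth maps\<close>

primrec Ck_on :: "nat \<Rightarrow> 'a::euclidean_space set \<Rightarrow> ('a \<Rightarrow> 'b::real_normed_vector) \<Rightarrow> bool" where
  "Ck_on 0 W f \<longleftrightarrow> continuous_on W f"
| "Ck_on (Suc k) W f \<longleftrightarrow>
     (\<forall>x\<in>W. f differentiable (at x)) \<and>
     (\<forall>v. Ck_on k W (\<lambda>x. frechet_derivative f (at x) v))"

text \<open>For an arbitrary subset \<open>X\<close> of a Euclidean space, smooth means locally the
  restriction of a smooth map on an open set; for open \<open>X\<close> this is ordinary
  smoothness.\<close>

definition smooth_map_on :: "'a::euclidean_space set \<Rightarrow> ('a \<Rightarrow> 'b::real_normed_vector) \<Rightarrow> bool" where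
  "smooth_map_on X f \<longleftrightarrow>
     (\<forall>x\<in>X. \<exists>W g. open W \<and> x \<in> W \<and> (\<forall>k. Ck_on k W g) \<and> (\<forall>y\<in>W \<inter> X. g y = f y))"

section \<open>Abstract smooth surfaces\<close>

text \<open>A chart is a pair \<open>(U, \<phi>)\<close> of an open subset of the surface and a homeomorphism of
  \<open>U\<close> onto an open subset of the plane. The atlas is not required to be maximal; all
  notions below that are stated for every chart are invariant under smooth changes of
  coordinates. All charts have open image in the plane, so there is no boundary.\<close>

type_synonym 'a chart = "'a set \<times> ('a \<Rightarrow> real^2)"

definition chart_image :: "'a chart \<Rightarrow> (real^2) set" where
  "chart_image c = snd c ` fst c"

definition chart_inv :: "'a chart \<Rightarrow> real^2 \<Rightarrow> 'a" where
  "chart_inv c = inv_into (fst c) (snd c)"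

definition smooth_surface :: "'a::t2_space set \<Rightarrow> 'a chart set \<Rightarrow> bool" where
  "smooth_surface \<Sigma> A \<longleftrightarrow>
     (\<forall>c\<in>A. openin (top_of_set \<Sigma>) (fst c) \<and> open (chart_image c) \<and>
            homeomorphism (fst c) (chart_image c) (snd c) (chart_inv c)) \<and>
     (\<Union>c\<in>A. fst c) = \<Sigma> \<and>
     (\<forall>c\<in>A. \<forall>d\<in>A. smooth_map_on (snd c ` (fst c \<inter> fst d)) (snd d \<circ> chart_inv c))"

section \<open>The Riemannian and symplectic structure of the product of two spheres\<close>

text \<open>The product metric is the restriction of the inner product of
  \<open>(real^3) \<times> (real^3)\<close>.\<close>

type_synonym R33 = "(real^3) \<times> (real^3)"

definition S2xS2 :: "R33 set" where
  "S2xS2 = sphere 0 1 \<times> sphere 0 1"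

definition tangent_S2xS2 :: "R33 \<Rightarrow> R33 set" where
  "tangent_S2xS2 p = {v. fst p \<bullet> fst v = 0 \<and> snd p \<bullet> snd v = 0}"

definition \<omega>\<^sub>0 :: "real^3 \<Rightarrow> real^3 \<Rightarrow> real^3 \<Rightarrow> real" where
  "\<omega>\<^sub>0 x v w = cross3 x v \<bullet> w"

definition kaehler_form :: "R33 \<Rightarrow> R33 \<Rightarrow> R33 \<Rightarrow> real" where
  "kaehler_form p v w = \<omega>\<^sub>0 (fst p) (fst v) (fst w) + \<omega>\<^sub>0 (snd p) (snd v) (snd w)"

text \<open>Isometries are diffeomorphisms whose differential preserves the metric on tangent
  spaces. A derivative within \<open>S2xS2\<close> is determined only on tangent vectors, and
  only its values there are used.\<close>

definition isometry_S2xS2 :: "(R33 \<Rightarrow> R33) \<Rightarrow> bool" where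
  "isometry_S2xS2 \<psi> \<longleftrightarrow>
     bij_betw \<psi> S2xS2 S2xS2 \<and>
     smooth_map_on S2xS2 \<psi> \<and> smooth_map_on S2xS2 (inv_into S2xS2 \<psi>) \<and>
     (\<forall>p\<in>S2xS2. \<exists>D. (\<psi> has_derivative D) (at p within S2xS2) \<and>
        (\<forall>v\<in>tangent_S2xS2 p. \<forall>w\<in>tangent_S2xS2 p. D v \<bullet> D w = v \<bullet> w))"

section \<open>Geometry of a local parametrization\<close>

text \<open>In this section \<open>F\<close> is a local parametrization, with values in \<open>S2xS2\<close>,
  defined near the point \<open>u\<close> of the plane.\<close>

abbreviation dd :: "(real^2 \<Rightarrow> R33) \<Rightarrow> real^2 \<Rightarrow> real^2 \<Rightarrow> R33" where
  "dd F u v \<equiv> frechet_derivative F (at u) v"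

definition normal_space :: "(real^2 \<Rightarrow> R33) \<Rightarrow> real^2 \<Rightarrow> R33 set" where
  "normal_space F u = {\<nu> \<in> tangent_S2xS2 (F u). \<forall>v. \<nu> \<bullet> dd F u v = 0}"

text \<open>Meaningful for linear subspaces \<open>N\<close>.\<close>

definition orth_proj :: "'a::euclidean_space set \<Rightarrow> 'a \<Rightarrow> 'a" where
  "orth_proj N x = (THE y. y \<in> N \<and> (\<forall>z\<in>N. (x - y) \<bullet> z = 0))"

text \<open>The Levi-Civita connection of \<open>S2xS2\<close> is the tangential part of the flat
  derivative. Since the normal space is contained in the tangent space of \<open>S2xS2\<close>,
  projecting the flat derivative directly to the normal space gives the normal component
  of the Levi-Civita derivative. Applied to a normal field \<open>\<xi>\<close> this is the normal
  connection.\<close>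

definition normal_deriv :: "(real^2 \<Rightarrow> R33) \<Rightarrow> (real^2 \<Rightarrow> R33) \<Rightarrow> real^2 \<Rightarrow> real^2 \<Rightarrow> R33" where
  "normal_deriv F \<xi> u v = orth_proj (normal_space F u) (dd \<xi> u v)"

text \<open>The vectors \<open>v\<close> and \<open>w\<close> stand for constant coordinate fields.\<close>

definition second_fundamental_form :: "(real^2 \<Rightarrow> R33) \<Rightarrow> real^2 \<Rightarrow> real^2 \<Rightarrow> real^2 \<Rightarrow> R33" where
  "second_fundamental_form F u v w = normal_deriv F (\<lambda>x. dd F x w) u v"

definition induced_metric :: "(real^2 \<Rightarrow> R33) \<Rightarrow> real^2 \<Rightarrow> real^2^2" where
  "induced_metric F u = (\<chi> i j. dd F u (axis i 1) \<bullet> dd F u (axis j 1))"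

text \<open>Half the trace of the second fundamental form with respect to the induced metric.\<close>

definition mean_curvature_vector :: "(real^2 \<Rightarrow> R33) \<Rightarrow> real^2 \<Rightarrow> R33" where
  "mean_curvature_vector F u =
     (1/2) *\<^sub>R (\<Sum>i\<in>UNIV. \<Sum>j\<in>UNIV.
        (matrix_inv (induced_metric F u) $ i $ j) *\<^sub>R
          second_fundamental_form F u (axis i 1) (axis j 1))"

section \<open>Immersed surfaces\<close>

text \<open>The maps \<open>\<Phi> \<circ> chart_inv c\<close> below are the coordinate expressions of
  \<open>\<Phi>\<close>.\<close>

definition immersion_S2xS2 :: "'a::t2_space set \<Rightarrow> 'a chart set \<Rightarrow> ('a \<Rightarrow> R33) \<Rightarrow> bool" where
  "immersion_S2xS2 \<Sigma> A \<Phi> \<longleftrightarrow>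
     \<Phi> ` \<Sigma> \<subseteq> S2xS2 \<and>
     (\<forall>c\<in>A. smooth_map_on (chart_image c) (\<Phi> \<circ> chart_inv c) \<and>
       (\<forall>u\<in>chart_image c. inj (dd (\<Phi> \<circ> chart_inv c) u)))"

definition lagrangian :: "'a chart set \<Rightarrow> ('a \<Rightarrow> R33) \<Rightarrow> bool" where
  "lagrangian A \<Phi> \<longleftrightarrow>
     (\<forall>c\<in>A. \<forall>u\<in>chart_image c. \<forall>v w. let F = \<Phi> \<circ> chart_inv c in
        kaehler_form (F u) (dd F u v) (dd F u w) = 0)"

definition parallel_mean_curvature :: "'a chart set \<Rightarrow> ('a \<Rightarrow> R33) \<Rightarrow> bool" where
  "parallel_mean_curvature A \<Phi> \<longleftrightarrow>
     (\<forall>c\<in>A. \<forall>u\<in>chart_image c. \<forall>v. let F = \<Phi> \<circ> chart_inv c in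
        normal_deriv F (mean_curvature_vector F) u v = 0)"

text \<open>The mean curvature vector is not identically zero; a parallel field on a connected
  surface with this property vanishes nowhere.\<close>

definition mean_curvature_non_null :: "'a chart set \<Rightarrow> ('a \<Rightarrow> R33) \<Rightarrow> bool" where
  "mean_curvature_non_null A \<Phi> \<longleftrightarrow>
     (\<exists>c\<in>A. \<exists>u\<in>chart_image c. mean_curvature_vector (\<Phi> \<circ> chart_inv c) u \<noteq> 0)"

section \<open>The tori and congruence to a finite covering\<close>

definition T_torus :: "real \<Rightarrow> real \<Rightarrow> R33 set" where
  "T_torus a b = {(x, y). (x, y) \<in> S2xS2 \<and> x $ 1 = a \<and> y $ 1 = b}"

definition finite_covering :: "'a::topological_space set \<Rightarrow> ('a \<Rightarrow> 'b::topological_space) \<Rightarrow> 'b set \<Rightarrow> bool" where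
  "finite_covering X p Y \<longleftrightarrow> covering_space X p Y \<and> (\<forall>y\<in>Y. finite {x\<in>X. p x = y})"

definition congruent_to_finite_covering :: "'a::t2_space set \<Rightarrow> ('a \<Rightarrow> R33) \<Rightarrow> R33 set \<Rightarrow> bool" where
  "congruent_to_finite_covering \<Sigma> \<Phi> T \<longleftrightarrow>
     (\<exists>\<psi>. isometry_S2xS2 \<psi> \<and> finite_covering \<Sigma> (\<psi> \<circ> \<Phi>) T)"

end

theory Submission
  imports Defs
begin

text \<open>The frame \<open>e = -JH/\<bar>H\<bar>\<close>, \<open>e'\<close> of the surface is parallel, so its coordinate fields \<open>X\<close>, \<open>Y\<close> commute
  and the surface is flat. With \<open>D\<close> the Jacobian of the first projection, the Gauss equation reads
  \<open>\<bar>\<theta>\<bar>\<^sup>2 = m\<^sup>2/4 + D\<^sup>2\<close>, where \<open>m = \<bar>H\<bar>\<close> and \<open>\<theta> = (p - 3m/2) + iq\<close> is the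
  coefficient of the cubic form; hence \<open>\<theta>\<close> has no zeros. At a maximum of \<open>D\<^sup>2\<close> with \<open>D \<noteq> 0\<close> both
  projections are conformal, and there the Codazzi equations give \<open>\<Delta>\<bar>\<theta>\<bar>\<^sup>2 > 0\<close> while the structure
  equations for \<open>D\<close> give \<open>\<Delta>(D\<^sup>2) \<le> 0\<close>. So compactness forces \<open>D = 0\<close>: each projection has rank one
  and traces a curve of constant curvature, that is, a circle. The surface is therefore immersed in
  a product of two circles, and compactness makes this local diffeomorphism a finite covering.\<close>

section \<open>Calculus of smooth maps\<close>

text \<open>Let x, y be the images of \<open>X\<close>, \<open>Y\<close> under one projection, E =
  |x|^2 and B = <x, y>. The Lagrangian condition makes the Jacobians of the two projections
  opposite, which forces |y|^2 = 1 - E; so (2E - 1, 2B, 2D) is a unit vector, and a projection is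
  conformal where its first two entries vanish. The number 3m/2 comes from the cubic form: on three
  copies of e + ie' it equals 4(p - 3m/2) + 4iq. The obstacle is globalization. H determines e, but
  e' is fixed only up to sign and no orientation is given, so D has no global meaning; the
  compactness argument runs on D^2, assembled from charts. Likewise a circle is found only in a
  chart and its axis only up to sign, which is why every local plane is shown to be determined by
  each smaller open set before planes are glued. When D = 0 the two curves have geodesic curvatures
  2m sqrt(E) and 2m sqrt(1 - E) in absolute value. They are finite, whence a, b < 1, and they do not
  both vanish, whence a^2 + b^2 > 0.\<close>

lemma Ck_on_cong:
  assumes "open W" "\<And>x. x \<in> W \<Longrightarrow> f x = g x" "Ck_on k W f"
  shows "Ck_on k W g"
  using assms(2,3)
proof (induction k arbitrary: f g)
  case 0
  then show ?case using continuous_on_cong by fastforce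
next
  case (Suc k)
  have D: "(g has_derivative frechet_derivative f (at x)) (at x)" if "x \<in> W" for x
    using Suc.prems that assms(1)
    by (metis Ck_on.simps(2) frechet_derivative_works has_derivative_transform_within_open)
  have "frechet_derivative f (at x) v = frechet_derivative g (at x) v" if "x \<in> W" for x v
    using D[OF that] frechet_derivative_at by metis
  then have "Ck_on k W (\<lambda>x. frechet_derivative g (at x) v)" for v
    using Suc.IH[of "\<lambda>x. frechet_derivative f (at x) v"] Suc.prems by simp
  with D show ?case by (auto simp: differentiable_def)
qed

text \<open>\<open>frechet_derivative\<close> is a choice operator. Computations produce an explicit
  derivative instead, and uniqueness of derivatives at points of an open set lets it replace the
  chosen one. The rules for sums, products, inverses and square roots rest on this.\<close>

lemma Ck_on_SucI:
  assumes "open W" "\<And>x. x \<in> W \<Longrightarrow> (f has_derivative f' x) (at x)"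
    "\<And>v. Ck_on k W (\<lambda>x. f' x v)"
  shows "Ck_on (Suc k) W f"
proof -
  have "f' x v = frechet_derivative f (at x) v" if "x \<in> W" for x v
    using assms(2)[OF that] frechet_derivative_at by metis
  then have "Ck_on k W (\<lambda>x. frechet_derivative f (at x) v)" for v
    by (rule Ck_on_cong[OF assms(1) _ assms(3)[of v]])
  then show ?thesis using assms(2) by (auto simp: differentiable_def)
qed

lemma Ck_on_SucD:
  assumes "Ck_on (Suc k) W f" "x \<in> W"
  shows "(f has_derivative frechet_derivative f (at x)) (at x)"
  using assms frechet_derivative_works by auto

lemma Ck_on_Suc_imp: "Ck_on (Suc k) W f \<Longrightarrow> Ck_on k W f"
proof (induction k arbitrary: f)
  case 0
  then show ?case
    by (auto intro!: differentiable_imp_continuous_on differentiable_at_imp_differentiable_on)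
qed auto

lemma Ck_on_subset: "Ck_on k W f \<Longrightarrow> V \<subseteq> W \<Longrightarrow> Ck_on k V f"
  by (induction k arbitrary: f) (auto intro: continuous_on_subset)

lemma Ck_on_local:
  assumes "\<And>x. x \<in> W \<Longrightarrow> \<exists>V. open V \<and> x \<in> V \<and> Ck_on k V f"
  shows "Ck_on k W f"
  using assms
proof (induction k arbitrary: f)
  case 0
  have "continuous (at x within W) f" if "x \<in> W" for x
  proof -
    obtain V where "open V" "x \<in> V" "continuous_on V f" using 0 \<open>x \<in> W\<close> by auto
    then show ?thesis
      using continuous_at_imp_continuous_at_within continuous_on_eq_continuous_at by blast
  qed
  then show ?case by (simp add: continuous_on_eq_continuous_within)
next
  case (Suc k)
  then show ?case by simp metis
qed

lemma Ck_on_const: "Ck_on k W (\<lambda>x. c)"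
  by (induction k arbitrary: c) auto

lemma Ck_on_bounded_linear:
  assumes "open W" "bounded_linear L" "Ck_on k W f"
  shows "Ck_on k W (\<lambda>x. L (f x))"
  using assms(3)
proof (induction k arbitrary: f)
  case 0
  then show ?case using assms(2) by (auto intro: bounded_linear.continuous_on)
next
  case (Suc k)
  show ?case
    by (rule Ck_on_SucI[OF assms(1), where f' = "\<lambda>x v. L (frechet_derivative f (at x) v)"])
      (use Suc Ck_on_SucD[OF Suc.prems] assms(2) in \<open>auto intro: bounded_linear.has_derivative\<close>)
qed

lemma Ck_on_add:
  assumes "open W" "Ck_on k W f" "Ck_on k W g"
  shows "Ck_on k W (\<lambda>x. f x + g x)"
  using assms(2,3)
proof (induction k arbitrary: f g)
  case 0
  then show ?case by (auto intro: continuous_on_add)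
next
  case (Suc k)
  show ?case
    by (rule Ck_on_SucI[OF assms(1), where
          f' = "\<lambda>x v. frechet_derivative f (at x) v + frechet_derivative g (at x) v"])
      (use Suc Ck_on_SucD[OF Suc.prems(1)] Ck_on_SucD[OF Suc.prems(2)] in
        \<open>auto intro: has_derivative_add\<close>)
qed

lemma Ck_on_bilinear:
  assumes "open W" "bounded_bilinear B" "Ck_on k W f" "Ck_on k W g"
  shows "Ck_on k W (\<lambda>x. B (f x) (g x))"
  using assms(3,4)
proof (induction k arbitrary: f g)
  case 0
  then show ?case using assms(2) by (auto intro: bounded_bilinear.continuous_on)
next
  case (Suc k)
  have 1: "Ck_on k W f" "Ck_on k W g" using Suc.prems Ck_on_Suc_imp by auto
  show ?case
    by (rule Ck_on_SucI[OF assms(1), where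
          f' = "\<lambda>x v. B (f x) (frechet_derivative g (at x) v) + B (frechet_derivative f (at x) v) (g x)"])
      (use Suc 1 Ck_on_SucD[OF Suc.prems(1)] Ck_on_SucD[OF Suc.prems(2)] in
        \<open>auto intro: bounded_bilinear.FDERIV[OF assms(2)] intro!: Ck_on_add assms\<close>)
qed

text \<open>The derivative of 1/f contains 1/f again, so the induction keeps \<open>f\<close> fixed:
  the factor 1/f is covered by the induction hypothesis and the derivative of \<open>f\<close> by
  the assumption. The square root works in the same way.\<close>

lemma Ck_on_inverse:
  fixes f :: "'a::euclidean_space \<Rightarrow> real"
  assumes "open W" "Ck_on k W f" "\<And>x. x \<in> W \<Longrightarrow> f x \<noteq> 0"
  shows "Ck_on k W (\<lambda>x. inverse (f x))"
  using assms(2,3)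
proof (induction k)
  case 0
  then show ?case by (auto intro: continuous_on_inverse)
next
  case (Suc k)
  have 1: "Ck_on k W f" "Ck_on k W (\<lambda>x. inverse (f x))" using Suc Ck_on_Suc_imp by auto
  have "Ck_on k W (\<lambda>x. - (inverse (f x) * frechet_derivative f (at x) v * inverse (f x)))" for v
    by (intro Ck_on_bounded_linear[OF assms(1) bounded_linear_minus[OF bounded_linear_ident]]
        Ck_on_bilinear[OF assms(1) bounded_bilinear_mult]) (use 1 Suc.prems in auto)
  then show ?case
    using Ck_on_SucI[OF assms(1) Deriv.has_derivative_inverse[OF Suc.prems(2) Ck_on_SucD[OF Suc.prems(1)]]]
    by blast
qed

lemma Ck_on_sqrt:
  fixes f :: "'a::euclidean_space \<Rightarrow> real"
  assumes "open W" "Ck_on k W f" "\<And>x. x \<in> W \<Longrightarrow> f x > 0"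
  shows "Ck_on k W (\<lambda>x. sqrt (f x))"
  using assms(2,3)
proof (induction k)
  case 0
  then show ?case by (auto intro: continuous_on_real_sqrt)
next
  case (Suc k)
  have 1: "Ck_on k W f" "Ck_on k W (\<lambda>x. sqrt (f x))" using Suc Ck_on_Suc_imp by auto
  have 2: "sqrt (f x) \<noteq> 0" if "x \<in> W" for x using Suc.prems(2)[OF that] by simp
  have "Ck_on k W (\<lambda>x. frechet_derivative f (at x) v * (inverse (sqrt (f x)) / 2))" for v
    by (intro Ck_on_bounded_linear[OF assms(1) bounded_linear_divide]
        Ck_on_inverse assms(1) Ck_on_bilinear[OF assms(1) bounded_bilinear_mult])
      (use 1 2 Suc.prems in auto)
  moreover have "((\<lambda>x. sqrt (f x)) has_derivative
      (\<lambda>v. frechet_derivative f (at x) v * (inverse (sqrt (f x)) / 2))) (at x)" if "x \<in> W" for x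
    using has_derivative_real_sqrt[OF Suc.prems(2)[OF that] Ck_on_SucD[OF Suc.prems(1) that]]
    by (simp add: field_simps)
  ultimately show ?case by (intro Ck_on_SucI[OF assms(1)]) auto
qed

section \<open>Smooth maps on open sets and their closure properties\<close>

definition smooth_on :: "'a::euclidean_space set \<Rightarrow> ('a \<Rightarrow> 'b::real_normed_vector) \<Rightarrow> bool" where
  "smooth_on W f \<longleftrightarrow> open W \<and> (\<forall>k. Ck_on k W f)"

lemma smooth_onD:
  assumes "smooth_on W f"
  shows "open W" "Ck_on k W f" "continuous_on W f"
    "x \<in> W \<Longrightarrow> f differentiable (at x)"
    "x \<in> W \<Longrightarrow> (f has_derivative frechet_derivative f (at x)) (at x)"
proof -
  show "open W" and k: "Ck_on k W f" for k using assms by (auto simp: smooth_on_def)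
  show "continuous_on W f" using k[of 0] by simp
  show "x \<in> W \<Longrightarrow> f differentiable (at x)" using k[of "Suc 0"] by simp
  then show "x \<in> W \<Longrightarrow> (f has_derivative frechet_derivative f (at x)) (at x)"
    using frechet_derivative_works by blast
qed

lemma smooth_map_on_open:
  assumes "open W" "smooth_map_on W f"
  shows "smooth_on W f"
  unfolding smooth_on_def
proof (intro conjI allI assms(1) Ck_on_local)
  fix k x assume "x \<in> W"
  then obtain V g where V: "open V" "x \<in> V" "Ck_on k V g" "\<forall>y\<in>V \<inter> W. g y = f y"
    using assms(2) by (force simp: smooth_map_on_def)
  have "Ck_on k (V \<inter> W) f"
    by (rule Ck_on_cong[of _ g]) (use V assms in \<open>auto intro: Ck_on_subset\<close>)
  then show "\<exists>V. open V \<and> x \<in> V \<and> Ck_on k V f"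
    using V assms(1) \<open>x \<in> W\<close> by (intro exI[of _ "V \<inter> W"]) auto
qed

lemma smooth_on_subset: "smooth_on W f \<Longrightarrow> open V \<Longrightarrow> V \<subseteq> W \<Longrightarrow> smooth_on V f"
  unfolding smooth_on_def using Ck_on_subset by blast

lemma smooth_on_cong:
  "smooth_on W f \<Longrightarrow> (\<And>x. x \<in> W \<Longrightarrow> f x = g x) \<Longrightarrow> smooth_on W g"
  unfolding smooth_on_def using Ck_on_cong by metis

lemma smooth_on_const: "open W \<Longrightarrow> smooth_on W (\<lambda>x. c)"
  by (simp add: smooth_on_def Ck_on_const)

lemma smooth_on_bounded_linear:
  "bounded_linear L \<Longrightarrow> smooth_on W f \<Longrightarrow> smooth_on W (\<lambda>x. L (f x))"
  by (simp add: smooth_on_def Ck_on_bounded_linear)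

lemma smooth_on_bilinear:
  "bounded_bilinear B \<Longrightarrow> smooth_on W f \<Longrightarrow> smooth_on W g \<Longrightarrow> smooth_on W (\<lambda>x. B (f x) (g x))"
  by (simp add: smooth_on_def Ck_on_bilinear)

lemma smooth_on_ident: "open W \<Longrightarrow> smooth_on W (\<lambda>x. x)"
proof -
  assume W: "open W"
  have "Ck_on k W (\<lambda>x. x)" for k
    by (cases k) (auto simp: continuous_on_id Ck_on_const frechet_derivative_ident)
  then show ?thesis using W by (simp add: smooth_on_def)
qed

lemma bounded_bilinear_cross3: "bounded_bilinear cross3"
  using bilinear_conv_bounded_bilinear bilinear_cross by blast

lemma smooth_on_add: "smooth_on W f \<Longrightarrow> smooth_on W g \<Longrightarrow> smooth_on W (\<lambda>x. f x + g x)"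
  by (simp add: smooth_on_def Ck_on_add)

lemmas smooth_on_minus = smooth_on_bounded_linear[OF bounded_linear_minus[OF bounded_linear_ident]]

lemma smooth_on_diff: "smooth_on W f \<Longrightarrow> smooth_on W g \<Longrightarrow> smooth_on W (\<lambda>x. f x - g x)"
  using smooth_on_add[OF _ smooth_on_minus, of W f g] by simp

lemma smooth_on_inverse:
  fixes f :: "'a::euclidean_space \<Rightarrow> real"
  shows "smooth_on W f \<Longrightarrow> (\<And>x. x \<in> W \<Longrightarrow> f x \<noteq> 0) \<Longrightarrow> smooth_on W (\<lambda>x. inverse (f x))"
  by (simp add: smooth_on_def Ck_on_inverse)

lemma smooth_on_sqrt:
  "smooth_on W f \<Longrightarrow> (\<And>x. x \<in> W \<Longrightarrow> f x > 0) \<Longrightarrow> smooth_on W (\<lambda>x. sqrt (f x))"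
  by (simp add: smooth_on_def Ck_on_sqrt)

lemma smooth_on_mult:
  fixes f g :: "'a::euclidean_space \<Rightarrow> real"
  shows "smooth_on W f \<Longrightarrow> smooth_on W g \<Longrightarrow> smooth_on W (\<lambda>x. f x * g x)"
  by (rule smooth_on_bilinear[OF bounded_bilinear_mult])

lemma smooth_on_power2:
  fixes f :: "'a::euclidean_space \<Rightarrow> real"
  shows "smooth_on W f \<Longrightarrow> smooth_on W (\<lambda>x. (f x)\<^sup>2)"
  by (simp add: power2_eq_square smooth_on_mult)

lemma smooth_on_divide:
  fixes f g :: "'a::euclidean_space \<Rightarrow> real"
  shows "smooth_on W f \<Longrightarrow> smooth_on W g \<Longrightarrow> (\<And>x. x \<in> W \<Longrightarrow> g x \<noteq> 0) \<Longrightarrow>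
    smooth_on W (\<lambda>x. f x / g x)"
  by (simp add: divide_inverse smooth_on_mult smooth_on_inverse)

lemmas smooth_on_inner = smooth_on_bilinear[OF bounded_bilinear_inner]
lemmas smooth_on_scaleR = smooth_on_bilinear[OF bounded_bilinear_scaleR]
lemmas smooth_on_cross3 = smooth_on_bilinear[OF bounded_bilinear_cross3]
lemmas smooth_on_fst = smooth_on_bounded_linear[OF bounded_linear_fst]
lemmas smooth_on_snd = smooth_on_bounded_linear[OF bounded_linear_snd]

lemma smooth_on_Pair: "smooth_on W f \<Longrightarrow> smooth_on W g \<Longrightarrow> smooth_on W (\<lambda>x. (f x, g x))"
  using smooth_on_add[OF smooth_on_bounded_linear[OF bounded_linear_Pair[OF bounded_linear_ident bounded_linear_zero]]
    smooth_on_bounded_linear[OF bounded_linear_Pair[OF bounded_linear_zero bounded_linear_ident]], of W f g] by simp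

lemma smooth_on_sum:
  "open W \<Longrightarrow> (\<And>i. i \<in> I \<Longrightarrow> smooth_on W (f i)) \<Longrightarrow> smooth_on W (\<lambda>x. \<Sum>i\<in>I. f i x)"
  by (induction I rule: infinite_finite_induct) (auto intro: smooth_on_const smooth_on_add)

lemma smooth_on_frechet_const:
  "smooth_on W f \<Longrightarrow> smooth_on W (\<lambda>x. frechet_derivative f (at x) v)"
  unfolding smooth_on_def by (metis Ck_on.simps(2))

section \<open>Differentiation along vector fields\<close>

definition dir_deriv ::
    "('a::euclidean_space \<Rightarrow> 'a) \<Rightarrow> ('a \<Rightarrow> 'b::real_normed_vector) \<Rightarrow> 'a \<Rightarrow> 'b" where
  "dir_deriv X f u = frechet_derivative f (at u) (X u)"

lemma frechet_derivative_expand: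
  assumes "f differentiable (at u)"
  shows "frechet_derivative f (at u) v = (\<Sum>i\<in>Basis. (v \<bullet> i) *\<^sub>R frechet_derivative f (at u) i)"
  using linear_frechet_derivative[OF assms]
  by (subst (1) euclidean_representation[of v, symmetric]) (simp add: linear_sum linear_scale)

lemma smooth_on_dir_deriv:
  assumes "smooth_on W f" "smooth_on W X"
  shows "smooth_on W (dir_deriv X f)"
proof -
  note W = smooth_onD(1)[OF assms(1)]
  have "smooth_on W (\<lambda>u. \<Sum>i\<in>Basis. (X u \<bullet> i) *\<^sub>R frechet_derivative f (at u) i)"
    by (intro smooth_on_sum smooth_on_scaleR smooth_on_inner smooth_on_frechet_const
        smooth_on_const assms W)
  then show ?thesis
    by (rule smooth_on_cong)
      (use frechet_derivative_expand[OF smooth_onD(4)[OF assms(1)]] in \<open>auto simp: dir_deriv_def\<close>)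
qed

lemma dir_deriv_unique:
  "(f has_derivative f') (at u) \<Longrightarrow> dir_deriv X f u = f' (X u)"
  using frechet_derivative_at by (metis dir_deriv_def)

lemma dir_deriv_const [simp]: "dir_deriv X (\<lambda>x. c) = (\<lambda>x. 0)"
  by (auto simp: dir_deriv_def)

lemma dir_deriv_cong:
  assumes "open W" "u \<in> W" "\<And>x. x \<in> W \<Longrightarrow> f x = g x"
  shows "dir_deriv X f u = dir_deriv X g u"
proof (cases "f differentiable (at u)")
  case True
  then show ?thesis
    using frechet_derivative_transform_within_open[OF _ assms(1,2,3)] by (auto simp: dir_deriv_def)
next
  case False
  \<comment> \<open>\<open>frechet_derivative\<close> chooses among all derivatives of the map. The
    predicate chosen from is the same for \<open>f\<close> and \<open>g\<close>, so the choices
    agree even where no derivative exists.\<close>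
  have iff: "(f has_derivative F) (at u) \<longleftrightarrow> (g has_derivative F) (at u)" for F
    by (auto intro: has_derivative_transform_within_open[OF _ assms(1,2)] simp: assms(3))
  then show ?thesis by (simp add: dir_deriv_def frechet_derivative_def)
qed

lemma dir_deriv_bounded_linear:
  assumes "smooth_on W f" "u \<in> W" "bounded_linear L"
  shows "dir_deriv X (\<lambda>x. L (f x)) u = L (dir_deriv X f u)"
  using dir_deriv_unique[OF bounded_linear.has_derivative[OF assms(3) smooth_onD(5)[OF assms(1,2)]]]
  by (simp add: dir_deriv_def)

lemma dir_deriv_bilinear:
  assumes "smooth_on W f" "smooth_on W g" "u \<in> W" "bounded_bilinear B"
  shows "dir_deriv X (\<lambda>x. B (f x) (g x)) u = B (dir_deriv X f u) (g u) + B (f u) (dir_deriv X g u)"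
  using dir_deriv_unique[OF bounded_bilinear.FDERIV[OF assms(4) smooth_onD(5)[OF assms(1,3)]
    smooth_onD(5)[OF assms(2,3)]]] by (simp add: dir_deriv_def)

lemma dir_deriv_add:
  assumes "smooth_on W f" "smooth_on W g" "u \<in> W"
  shows "dir_deriv X (\<lambda>x. f x + g x) u = dir_deriv X f u + dir_deriv X g u"
  using dir_deriv_unique[OF has_derivative_add[OF smooth_onD(5)[OF assms(1,3)] smooth_onD(5)[OF assms(2,3)]]]
  by (simp add: dir_deriv_def)

lemma dir_deriv_diff:
  assumes "smooth_on W f" "smooth_on W g" "u \<in> W"
  shows "dir_deriv X (\<lambda>x. f x - g x) u = dir_deriv X f u - dir_deriv X g u"
  using dir_deriv_unique[OF has_derivative_diff[OF smooth_onD(5)[OF assms(1,3)] smooth_onD(5)[OF assms(2,3)]]]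
  by (simp add: dir_deriv_def)

lemmas dir_deriv_inner = dir_deriv_bilinear[OF _ _ _ bounded_bilinear_inner]
lemmas dir_deriv_scaleR = dir_deriv_bilinear[OF _ _ _ bounded_bilinear_scaleR]
lemmas dir_deriv_cross3 = dir_deriv_bilinear[OF _ _ _ bounded_bilinear_cross3]
lemmas dir_deriv_mult = dir_deriv_bilinear[OF _ _ _ bounded_bilinear_mult]
lemmas dir_deriv_fst = dir_deriv_bounded_linear[OF _ _ bounded_linear_fst]
lemmas dir_deriv_snd = dir_deriv_bounded_linear[OF _ _ bounded_linear_snd]

lemma dir_deriv_Pair:
  assumes "smooth_on W f" "smooth_on W g" "u \<in> W"
  shows "dir_deriv X (\<lambda>x. (f x, g x)) u = (dir_deriv X f u, dir_deriv X g u)"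
  using dir_deriv_unique[OF has_derivative_Pair[OF smooth_onD(5)[OF assms(1,3)] smooth_onD(5)[OF assms(2,3)]]]
  by (simp add: dir_deriv_def)

lemma dir_deriv_zero_imp_constant:
  assumes "smooth_on W f" "convex W"
    and "\<And>u v. u \<in> W \<Longrightarrow> frechet_derivative f (at u) v = 0" "a \<in> W" "b \<in> W"
  shows "f a = f b"
proof -
  have "(f has_derivative (\<lambda>v. 0)) (at x within W)" if "x \<in> W" for x
  proof -
    have "frechet_derivative f (at x) = (\<lambda>v. 0)" using assms(3)[OF that] by auto
    then show ?thesis using smooth_onD(5)[OF assms(1) that] has_derivative_at_withinI by metis
  qed
  then show ?thesis using has_derivative_zero_constant[OF assms(2)] assms(4,5) by metis
qed

subsection \<open>Symmetry of the second derivative\<close>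

text \<open>The mean value theorem is applied to the second difference twice, along \<open>w\<close>
  and then along \<open>v\<close>. The left side is symmetric in \<open>v\<close> and
  \<open>w\<close>, the right side is a second derivative in a definite order; playing the two
  against each other yields the symmetry of the Hessian.\<close>

lemma second_difference_mvt:
  fixes f :: "'a::euclidean_space \<Rightarrow> real"
  assumes f: "\<And>x. x \<in> ball u r \<Longrightarrow> (f has_derivative f' x) (at x)"
    and f': "\<And>x. x \<in> ball u r \<Longrightarrow> ((\<lambda>x. f' x w) has_derivative f'' x) (at x)"
    and h: "h > 0" "h * (norm v + norm w) < r"
  obtains x where "dist u x \<le> h * (norm v + norm w)"
    "f (u + h *\<^sub>R v + h *\<^sub>R w) - f (u + h *\<^sub>R v) - f (u + h *\<^sub>R w) + f u = h * h * f'' x v"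
proof -
  have inb: "u + s *\<^sub>R v + t *\<^sub>R w \<in> ball u r \<and>
      dist u (u + s *\<^sub>R v + t *\<^sub>R w) \<le> h * (norm v + norm w)"
    if "0 \<le> s" "s \<le> h" "0 \<le> t" "t \<le> h" for s t
  proof -
    have "norm (s *\<^sub>R v + t *\<^sub>R w) \<le> s * norm v + t * norm w"
      using norm_triangle_ineq[of "s *\<^sub>R v" "t *\<^sub>R w"] that by simp
    also have "\<dots> \<le> h * norm v + h * norm w"
      using that by (intro add_mono mult_right_mono) auto
    finally have "norm (s *\<^sub>R v + t *\<^sub>R w) \<le> h * (norm v + norm w)" by (simp add: distrib_left)
    moreover have "dist u (u + s *\<^sub>R v + t *\<^sub>R w) = norm (s *\<^sub>R v + t *\<^sub>R w)"
      by (simp add: dist_norm add.assoc flip: norm_minus_cancel[of "s *\<^sub>R v + t *\<^sub>R w"])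
    ultimately show ?thesis using h(2) by simp
  qed
  \<comment> \<open>The summand \<open>0 *\<^sub>R v\<close> gives both terms the shape with
    parameters s and t that \<open>d1\<close> differentiates.\<close>
  define g where "g t = f (u + h *\<^sub>R v + t *\<^sub>R w) - f (u + 0 *\<^sub>R v + t *\<^sub>R w)" for t
  have d1: "((\<lambda>t. f (u + s *\<^sub>R v + t *\<^sub>R w)) has_real_derivative f' (u + s *\<^sub>R v + t *\<^sub>R w) w) (at t)"
    if "0 \<le> s" "s \<le> h" "0 \<le> t" "t \<le> h" for s t
  proof -
    have "((\<lambda>t. u + s *\<^sub>R v + t *\<^sub>R w) has_derivative (\<lambda>t. t *\<^sub>R w)) (at t)"
      by (auto intro!: derivative_eq_intros)
    from has_derivative_compose[OF this f[OF conjunct1[OF inb[OF that]]]]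
    have "((\<lambda>t. f (u + s *\<^sub>R v + t *\<^sub>R w)) has_derivative (\<lambda>k. f' (u + s *\<^sub>R v + t *\<^sub>R w) (k *\<^sub>R w))) (at t)" .
    moreover have "f' (u + s *\<^sub>R v + t *\<^sub>R w) (k *\<^sub>R w) = f' (u + s *\<^sub>R v + t *\<^sub>R w) w * k" for k
      using has_derivative_linear[OF f[OF conjunct1[OF inb[OF that]]]] by (simp add: linear_scale)
    ultimately show ?thesis by (simp add: has_field_derivative_def)
  qed
  have "\<exists>t>0. t < h \<and> g h - g 0 = (h - 0) * (f' (u + h *\<^sub>R v + t *\<^sub>R w) w - f' (u + 0 *\<^sub>R v + t *\<^sub>R w) w)"
    unfolding g_def using h(1) by (intro MVT2 DERIV_diff d1) auto
  then obtain t where t: "0 < t" "t < h"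
    "g h - g 0 = h * (f' (u + h *\<^sub>R v + t *\<^sub>R w) w - f' (u + 0 *\<^sub>R v + t *\<^sub>R w) w)" by auto
  have d2: "((\<lambda>s. f' (u + s *\<^sub>R v + t *\<^sub>R w) w) has_real_derivative f'' (u + s *\<^sub>R v + t *\<^sub>R w) v) (at s)"
    if "0 \<le> s" "s \<le> h" for s
  proof -
    have b: "u + s *\<^sub>R v + t *\<^sub>R w \<in> ball u r" using inb that t by auto
    have "((\<lambda>s. u + s *\<^sub>R v + t *\<^sub>R w) has_derivative (\<lambda>s. s *\<^sub>R v)) (at s)"
      by (auto intro!: derivative_eq_intros)
    from has_derivative_compose[OF this f'[OF b]]
    have "((\<lambda>s. f' (u + s *\<^sub>R v + t *\<^sub>R w) w) has_derivative (\<lambda>k. f'' (u + s *\<^sub>R v + t *\<^sub>R w) (k *\<^sub>R v))) (at s)" .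
    moreover have "f'' (u + s *\<^sub>R v + t *\<^sub>R w) (k *\<^sub>R v) = f'' (u + s *\<^sub>R v + t *\<^sub>R w) v * k" for k
      using has_derivative_linear[OF f'[OF b]] by (simp add: linear_scale)
    ultimately show ?thesis by (simp add: has_field_derivative_def)
  qed
  have "\<exists>s>0. s < h \<and> f' (u + h *\<^sub>R v + t *\<^sub>R w) w - f' (u + 0 *\<^sub>R v + t *\<^sub>R w) w
      = (h - 0) * f'' (u + s *\<^sub>R v + t *\<^sub>R w) v"
    using h(1) by (intro MVT2 d2) auto
  then obtain s where s: "0 < s" "s < h" "f' (u + h *\<^sub>R v + t *\<^sub>R w) w - f' (u + 0 *\<^sub>R v + t *\<^sub>R w) w
      = h * f'' (u + s *\<^sub>R v + t *\<^sub>R w) v" by auto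
  show thesis
    by (rule that[of "u + s *\<^sub>R v + t *\<^sub>R w"]) (use inb[of s t] s t in \<open>auto simp: g_def\<close>)
qed

lemma isCont_real_dist:
  fixes g :: "'a::metric_space \<Rightarrow> real"
  assumes "isCont g u" "e > 0"
  shows "\<exists>d>0. \<forall>x. dist x u < d \<longrightarrow> dist (g x) (g u) < e"
  using assms unfolding continuous_at Lim_at by (metis dist_self zero_less_dist_iff)

text \<open>One second difference equals h^2 times either mixed derivative, each taken at some point
  near \<open>u\<close>. Continuity of both mixed derivatives at \<open>u\<close> lets h
  shrink.\<close>

lemma second_derivative_symmetric_real:
  fixes f :: "'a::euclidean_space \<Rightarrow> real"
  assumes sm: "smooth_on W f" "u \<in> W"
  shows "frechet_derivative (\<lambda>x. frechet_derivative f (at x) w) (at u) v =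
    frechet_derivative (\<lambda>x. frechet_derivative f (at x) v) (at u) w"
proof -
  define H where "H v w x = frechet_derivative (\<lambda>x. frechet_derivative f (at x) w) (at x) v" for v w x
  have cont: "continuous (at u) (H v w)" for v w
    unfolding H_def using smooth_onD(3)[OF smooth_on_frechet_const[OF smooth_on_frechet_const[OF sm(1)]]]
      smooth_onD(1)[OF sm(1)] sm(2) continuous_on_eq_continuous_at by blast
  obtain r where r: "r > 0" "ball u r \<subseteq> W"
    using smooth_onD(1)[OF sm(1)] sm(2) open_contains_ball by blast
  \<comment> \<open>The added 1 keeps \<open>M\<close> positive when \<open>v\<close> and
    \<open>w\<close> vanish and makes the bound on the step length strict.\<close>
  define M where "M = norm v + norm w + 1"
  have M: "M > 0" by (simp add: M_def add_nonneg_pos)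
  have "\<bar>H v w u - H w v u\<bar> \<le> 2 * e" if e: "e > 0" for e
  proof -
    obtain d1 where d1: "d1 > 0" "\<And>x. dist x u < d1 \<Longrightarrow> dist (H v w x) (H v w u) < e"
      using isCont_real_dist[OF cont[of v w] e] by blast
    obtain d2 where d2: "d2 > 0" "\<And>x. dist x u < d2 \<Longrightarrow> dist (H w v x) (H w v u) < e"
      using isCont_real_dist[OF cont[of w v] e] by blast
    define h where "h = min r (min d1 d2) / M"
    have h: "h > 0" "h * M = min r (min d1 d2)" using r(1) d1(1) d2(1) M by (auto simp: h_def)
    have "h * (norm v + norm w) < h * M" using h(1) by (simp add: M_def)
    then have hl: "h * (norm v + norm w) < min r (min d1 d2)" unfolding h(2) .
    have hl': "h * (norm w + norm v) < min r (min d1 d2)" using hl by (simp add: add.commute)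
    have D: "\<And>x. x \<in> ball u r \<Longrightarrow> (f has_derivative frechet_derivative f (at x)) (at x)"
      "\<And>x w. x \<in> ball u r \<Longrightarrow> ((\<lambda>x. frechet_derivative f (at x) w) has_derivative
        (\<lambda>v. H v w x)) (at x)"
      unfolding H_def using smooth_onD(5)[OF sm(1)] smooth_onD(5)[OF smooth_on_frechet_const[OF sm(1)]] r(2) by blast+
    obtain x where x: "dist u x \<le> h * (norm v + norm w)"
      "f (u + h *\<^sub>R v + h *\<^sub>R w) - f (u + h *\<^sub>R v) - f (u + h *\<^sub>R w) + f u = h * h * H v w x"
      using second_difference_mvt[OF D(1) D(2)[of _ w] h(1), where v=v] hl by auto
    obtain y where y: "dist u y \<le> h * (norm w + norm v)"
      "f (u + h *\<^sub>R w + h *\<^sub>R v) - f (u + h *\<^sub>R w) - f (u + h *\<^sub>R v) + f u = h * h * H w v y"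
      using second_difference_mvt[OF D(1) D(2)[of _ v] h(1), where v=w] hl' by auto
    have c: "u + h *\<^sub>R w + h *\<^sub>R v = u + h *\<^sub>R v + h *\<^sub>R w" by simp
    have "h * h * H v w x = h * h * H w v y" using x(2) y(2)[unfolded c] by linarith
    then have "H v w x = H w v y" using h(1) by simp
    moreover have "dist (H v w x) (H v w u) < e" using d1(2)[of x] x(1) hl by (simp add: dist_commute)
    moreover have "dist (H w v y) (H w v u) < e" using d2(2)[of y] y(1) hl' by (simp add: dist_commute)
    ultimately show ?thesis by (simp add: dist_real_def)
  qed
  note bound = this
  show ?thesis
  proof (rule ccontr)
    assume "\<not> ?thesis"
    then have "\<bar>H v w u - H w v u\<bar> > 0" by (simp add: H_def)
    then show False using bound[of "\<bar>H v w u - H w v u\<bar> / 4"] by simp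
  qed
qed

lemma second_derivative_symmetric:
  fixes f :: "'a::euclidean_space \<Rightarrow> 'b::euclidean_space"
  assumes sm: "smooth_on W f" "u \<in> W"
  shows "frechet_derivative (\<lambda>x. frechet_derivative f (at x) w) (at u) v =
    frechet_derivative (\<lambda>x. frechet_derivative f (at x) v) (at u) w"
proof (rule euclidean_eqI)
  fix b :: 'b
  assume "b \<in> Basis"
  have 1: "frechet_derivative (\<lambda>x. f x \<bullet> b) (at x) z = frechet_derivative f (at x) z \<bullet> b"
    if "x \<in> W" for x z
    using dir_deriv_bounded_linear[OF sm(1) that bounded_linear_inner_left[of b], where X = "\<lambda>x. z"]
    by (simp add: dir_deriv_def)
  have 2: "frechet_derivative (\<lambda>x. frechet_derivative (\<lambda>x. f x \<bullet> b) (at x) z) (at u) y =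
      frechet_derivative (\<lambda>x. frechet_derivative f (at x) z) (at u) y \<bullet> b" for y z
    using dir_deriv_bounded_linear[OF smooth_on_frechet_const[OF sm(1)] sm(2) bounded_linear_inner_left[of b], where X = "\<lambda>x. y" and v1 = z]
      dir_deriv_cong[OF smooth_onD(1)[OF sm(1)] sm(2) 1, where X = "\<lambda>x. y"]
    by (simp add: dir_deriv_def)
  have "smooth_on W (\<lambda>x. f x \<bullet> b)"
    by (rule smooth_on_bounded_linear[OF bounded_linear_inner_left sm(1)])
  from second_derivative_symmetric_real[OF this sm(2), of w v]
  show "frechet_derivative (\<lambda>x. frechet_derivative f (at x) w) (at u) v \<bullet> b =
    frechet_derivative (\<lambda>x. frechet_derivative f (at x) v) (at u) w \<bullet> b"
    by (simp add: 2)
qed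

abbreviation hess :: "('a::euclidean_space \<Rightarrow> 'b::euclidean_space) \<Rightarrow> 'a \<Rightarrow> 'a \<Rightarrow> 'a \<Rightarrow> 'b" where
  "hess f u v w \<equiv> frechet_derivative (\<lambda>x. frechet_derivative f (at x) w) (at u) v"

lemma linear_hess_left: "smooth_on W f \<Longrightarrow> u \<in> W \<Longrightarrow> linear (\<lambda>v. hess f u v w)"
  using linear_frechet_derivative smooth_onD(4)[OF smooth_on_frechet_const] by blast

text \<open>Linearity in the outer direction is linearity of a derivative; symmetry carries it over
  to the inner direction.\<close>

lemma linear_hess_right:
  assumes "smooth_on W f" "u \<in> W"
  shows "linear (hess f u v)"
proof -
  interpret L: linear "\<lambda>w. hess f u w v" by (rule linear_hess_left[OF assms])
  show ?thesis
    by (rule linearI)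
      (simp_all only: second_derivative_symmetric[OF assms, where v = v] L.add L.scale)
qed

text \<open>Expanding \<open>Y\<close> in the constant basis fields and applying the product rule
  splits X(Yf) into a tensorial Hessian term and the derivative of \<open>f\<close> along the
  derivative of \<open>Y\<close>.\<close>

lemma dir_deriv_dir_deriv:
  fixes f :: "'a::euclidean_space \<Rightarrow> 'b::euclidean_space"
  assumes "smooth_on W f" "smooth_on W Y" "u \<in> W"
  shows "dir_deriv X (dir_deriv Y f) u =
    hess f u (X u) (Y u) + frechet_derivative f (at u) (dir_deriv X Y u)"
proof -
  note W = smooth_onD(1)[OF assms(1)]
  let ?g = "\<lambda>u. \<Sum>i\<in>Basis. (Y u \<bullet> i) *\<^sub>R frechet_derivative f (at u) i"
  have sY: "smooth_on W (\<lambda>u. Y u \<bullet> i)" for i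
    by (rule smooth_on_bounded_linear[OF bounded_linear_inner_left assms(2)])
  have "((\<lambda>u. (Y u \<bullet> i) *\<^sub>R frechet_derivative f (at u) i) has_derivative
      (\<lambda>v. (Y u \<bullet> i) *\<^sub>R hess f u v i + (frechet_derivative Y (at u) v \<bullet> i) *\<^sub>R frechet_derivative f (at u) i)) (at u)"
    for i
    by (rule bounded_bilinear.FDERIV[OF bounded_bilinear_scaleR
          bounded_linear.has_derivative[OF bounded_linear_inner_left smooth_onD(5)[OF assms(2,3)]]
          smooth_onD(5)[OF smooth_on_frechet_const[OF assms(1)] assms(3)]])
  then have "(?g has_derivative (\<lambda>v. \<Sum>i\<in>Basis. (Y u \<bullet> i) *\<^sub>R hess f u v i +
      (frechet_derivative Y (at u) v \<bullet> i) *\<^sub>R frechet_derivative f (at u) i)) (at u)"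
    by (rule has_derivative_sum)
  from dir_deriv_unique[OF this] have "dir_deriv X ?g u =
     (\<Sum>i\<in>Basis. (Y u \<bullet> i) *\<^sub>R hess f u (X u) i) +
     (\<Sum>i\<in>Basis. (dir_deriv X Y u \<bullet> i) *\<^sub>R frechet_derivative f (at u) i)"
    by (simp add: sum.distrib dir_deriv_def)
  also have "(\<Sum>i\<in>Basis. (Y u \<bullet> i) *\<^sub>R hess f u (X u) i) = hess f u (X u) (Y u)"
  proof -
    interpret linear "hess f u (X u)" using linear_hess_right[OF assms(1,3)] .
    have "hess f u (X u) (\<Sum>i\<in>Basis. (Y u \<bullet> i) *\<^sub>R i) = (\<Sum>i\<in>Basis. (Y u \<bullet> i) *\<^sub>R hess f u (X u) i)"
      by (simp only: sum scale)
    then show ?thesis by (simp only: euclidean_representation)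
  qed
  also have "(\<Sum>i\<in>Basis. (dir_deriv X Y u \<bullet> i) *\<^sub>R frechet_derivative f (at u) i) =
      frechet_derivative f (at u) (dir_deriv X Y u)"
    by (rule frechet_derivative_expand[OF smooth_onD(4)[OF assms(1,3)], symmetric])
  also have "dir_deriv X ?g u = dir_deriv X (dir_deriv Y f) u"
    by (rule dir_deriv_cong[OF W assms(3)])
      (use frechet_derivative_expand[OF smooth_onD(4)[OF assms(1)]] in \<open>auto simp: dir_deriv_def\<close>)
  finally show ?thesis .
qed

text \<open>For commuting fields the two expansions differ only in the order of the Hessian's
  arguments.\<close>

lemma dir_deriv_commute:
  fixes f :: "'a::euclidean_space \<Rightarrow> 'b::euclidean_space"
  assumes "smooth_on W f" "smooth_on W X" "smooth_on W Y" "u \<in> W"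
    "dir_deriv X Y u = dir_deriv Y X u"
  shows "dir_deriv X (dir_deriv Y f) u = dir_deriv Y (dir_deriv X f) u"
  using dir_deriv_dir_deriv assms second_derivative_symmetric by metis

section \<open>Lagrangian surfaces in the product of two spheres\<close>

notation cross3 (infixr "\<times>\<^sub>3" 80)

lemma cross_cross_unit: "p \<bullet> p = 1 \<Longrightarrow> p \<bullet> v = 0 \<Longrightarrow> p \<times>\<^sub>3 (p \<times>\<^sub>3 v) = - v"
  by (simp add: Lagrange)

lemma inner_cross_unit: "p \<bullet> p = 1 \<Longrightarrow> p \<bullet> v = 0 \<Longrightarrow> (p \<times>\<^sub>3 v) \<bullet> (p \<times>\<^sub>3 w) = v \<bullet> w"
  by (simp add: dot_cross inner_commute)

lemma inner_cross_skew: "(p \<times>\<^sub>3 v) \<bullet> w = - (v \<bullet> (p \<times>\<^sub>3 w))"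
  by (metis cross_skew cross_triple inner_commute inner_minus_left)

text \<open>The complex structure J at \<open>p\<close>, written on all of the ambient space: for
  \<open>p\<close> in the product of spheres it kills the two radial directions.\<close>

definition JJ :: "R33 \<Rightarrow> R33 \<Rightarrow> R33" where
  "JJ p v = (fst p \<times>\<^sub>3 fst v, snd p \<times>\<^sub>3 snd v)"

lemma kaehler_form_JJ: "kaehler_form p v w = JJ p v \<bullet> w"
  by (simp add: kaehler_form_def \<omega>\<^sub>0_def JJ_def inner_prod_def)

lemma mem_S2xS2: "p \<in> S2xS2 \<longleftrightarrow> fst p \<bullet> fst p = 1 \<and> snd p \<bullet> snd p = 1"
  by (cases p) (simp add: S2xS2_def dist_norm norm_eq_1)

lemma JJ_skew: "JJ p v \<bullet> w = - (v \<bullet> JJ p w)"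
  using inner_cross_skew[of "fst p"] inner_cross_skew[of "snd p"] by (simp add: JJ_def inner_prod_def)

lemma JJ_inner:
  assumes "p \<in> S2xS2" "v \<in> tangent_S2xS2 p"
  shows "JJ p v \<bullet> JJ p w = v \<bullet> w"
  using assms by (simp add: JJ_def inner_prod_def mem_S2xS2 tangent_S2xS2_def inner_cross_unit)

lemma JJ_JJ:
  assumes "p \<in> S2xS2" "v \<in> tangent_S2xS2 p"
  shows "JJ p (JJ p v) = - v"
  using assms by (cases v) (simp add: JJ_def mem_S2xS2 tangent_S2xS2_def cross_cross_unit)

lemma JJ_tangent: "JJ p v \<in> tangent_S2xS2 p"
  by (simp add: JJ_def tangent_S2xS2_def dot_cross_self)

lemma bounded_linear_JJ: "bounded_linear (JJ p)"
proof (rule linear_conv_bounded_linear[THEN iffD1])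
  show "linear (JJ p)"
    by (rule linearI) (simp_all add: JJ_def cross_add_right cross_mult_right)
qed

lemma subspace_tangent: "subspace (tangent_S2xS2 p)"
  by (auto simp: subspace_def tangent_S2xS2_def inner_right_distrib)

lemma orthonormal_family_expand:
  fixes b :: "'i \<Rightarrow> 'a::euclidean_space"
  assumes I: "finite I" "card I = DIM('a)"
    and on: "\<And>i j. i \<in> I \<Longrightarrow> j \<in> I \<Longrightarrow> b i \<bullet> b j = (if i = j then 1 else 0)"
  shows "z = (\<Sum>i\<in>I. (z \<bullet> b i) *\<^sub>R b i)"
proof -
  have inj: "inj_on b I"
    by (rule inj_onI) (metis on zero_neq_one)
  have orth: "pairwise orthogonal (b ` I)"
    by (auto simp: pairwise_def orthogonal_def on)
  have n0: "0 \<notin> b ` I" using on by force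
  have ind: "independent (b ` I)" by (rule pairwise_orthogonal_independent[OF orth n0])
  have "UNIV \<subseteq> span (b ` I)"
    by (rule card_ge_dim_independent) (use ind I card_image[OF inj] in \<open>auto simp: dim_UNIV\<close>)
  then have "(\<Sum>i\<in>b ` I. (z \<bullet> i) *\<^sub>R i) = z"
    using orthonormal_basis_expand[OF orth, of z] on I by (force simp: norm_eq_1)
  then show ?thesis by (simp add: sum.reindex[OF inj])
qed

text \<open>For a Lagrangian plane with orthonormal basis e, f the vectors e, f, Je, Jf are
  orthonormal and tangent to the product of spheres. The two radial vectors complete them to an
  orthonormal basis of the six-dimensional ambient space.\<close>

lemma lagrangian_frame_expand:
  assumes p: "p \<in> S2xS2" and e: "e \<in> tangent_S2xS2 p" "f \<in> tangent_S2xS2 p"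
    and on: "e \<bullet> e = 1" "f \<bullet> f = 1" "e \<bullet> f = 0" and lag: "JJ p e \<bullet> f = 0"
  shows "z = (z \<bullet> e) *\<^sub>R e + (z \<bullet> f) *\<^sub>R f + (z \<bullet> JJ p e) *\<^sub>R JJ p e + (z \<bullet> JJ p f) *\<^sub>R JJ p f
    + (z \<bullet> (fst p, 0)) *\<^sub>R (fst p, 0) + (z \<bullet> (0, snd p)) *\<^sub>R (0, snd p)"
proof -
  have t: "v \<bullet> (fst p, 0) = 0" "v \<bullet> (0, snd p) = 0" "(fst p, 0) \<bullet> v = 0" "(0, snd p) \<bullet> v = 0"
    if "v \<in> tangent_S2xS2 p" for v
    using that by (auto simp: tangent_S2xS2_def inner_prod_def inner_commute)
  have s: "JJ p v \<bullet> v = 0" for v using JJ_skew[of p v v] by (simp add: inner_commute)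
  have l2: "JJ p f \<bullet> e = 0" using JJ_skew[of p f e] lag by (simp add: inner_commute)
  let ?b = "\<lambda>i::nat. [e, f, JJ p e, JJ p f, (fst p, 0), (0, snd p)] ! i"
  have I: "{0..<6::nat} = {0,1,2,3,4,5}" by auto
  have "z = (\<Sum>i\<in>{0..<6::nat}. (z \<bullet> ?b i) *\<^sub>R ?b i)"
  proof (rule orthonormal_family_expand)
    show "card {0..<6::nat} = DIM(R33)" by simp
    fix i j :: nat
    assume "i \<in> {0..<6}" "j \<in> {0..<6}"
    then show "?b i \<bullet> ?b j = (if i = j then 1 else 0)"
      unfolding I
      by (elim insertE emptyE; simp add: on t[OF e(1)] t[OF e(2)] t[OF JJ_tangent] lag l2 s
          JJ_inner[OF p e(1)] JJ_inner[OF p e(2)] inner_commute[of e "JJ p _"]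
          inner_commute[of f "JJ p _"] inner_commute[of f e] p[unfolded mem_S2xS2])
  qed simp
  then show ?thesis by (simp add: I add.assoc)
qed

lemma orth_proj_eqI:
  assumes "subspace N" "y \<in> N" "\<And>z. z \<in> N \<Longrightarrow> (x - y) \<bullet> z = 0"
  shows "orth_proj N x = y"
  unfolding orth_proj_def
proof (rule the_equality)
  fix y' assume y': "y' \<in> N \<and> (\<forall>z\<in>N. (x - y') \<bullet> z = 0)"
  have n: "y' - y \<in> N" using y' assms by (simp add: subspace_diff)
  then have "(x - y) \<bullet> (y' - y) = 0" "(x - y') \<bullet> (y' - y) = 0" using y' assms(3) by auto
  then have "(y' - y) \<bullet> (y' - y) = 0" by (simp add: inner_diff_left inner_diff_right)
  then show "y' = y" by simp
qed (use assms in auto)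

section \<open>Orthonormal pairs and the mean curvature vector of a Lagrangian patch\<close>

definition on_pair :: "(real^2 \<Rightarrow> R33) \<Rightarrow> real^2 \<Rightarrow> real^2 \<Rightarrow> real^2 \<Rightarrow> bool" where
  "on_pair F u v w \<longleftrightarrow>
     dd F u v \<bullet> dd F u v = 1 \<and> dd F u w \<bullet> dd F u w = 1 \<and> dd F u v \<bullet> dd F u w = 0"

locale lagrangian_patch =
  fixes W :: "(real^2) set" and F :: "real^2 \<Rightarrow> R33"
  assumes smooth_F: "smooth_on W F"
    and F_S2xS2: "\<And>u. u \<in> W \<Longrightarrow> F u \<in> S2xS2"
    and immersed: "\<And>u. u \<in> W \<Longrightarrow> inj (dd F u)"
    and lagrange: "\<And>u v w. u \<in> W \<Longrightarrow> kaehler_form (F u) (dd F u v) (dd F u w) = 0"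
begin

lemmas open_W = smooth_onD(1)[OF smooth_F]

lemma linear_dd: "u \<in> W \<Longrightarrow> linear (dd F u)"
  using smooth_onD(4)[OF smooth_F] linear_frechet_derivative by blast

lemma dd_tangent:
  assumes "u \<in> W"
  shows "dd F u v \<in> tangent_S2xS2 (F u)"
proof -
  have 1: "dir_deriv (\<lambda>x. v) (\<lambda>x. fst (F x) \<bullet> fst (F x)) u = 0"
    using dir_deriv_cong[OF open_W assms, of "\<lambda>x. fst (F x) \<bullet> fst (F x)" "\<lambda>x. 1"] F_S2xS2
    by (simp add: mem_S2xS2)
  have 2: "dir_deriv (\<lambda>x. v) (\<lambda>x. snd (F x) \<bullet> snd (F x)) u = 0"
    using dir_deriv_cong[OF open_W assms, of "\<lambda>x. snd (F x) \<bullet> snd (F x)" "\<lambda>x. 1"] F_S2xS2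
    by (simp add: mem_S2xS2)
  have 3: "dir_deriv (\<lambda>x. v) (\<lambda>x. fst (F x)) u = fst (dd F u v)"
    "dir_deriv (\<lambda>x. v) (\<lambda>x. snd (F x)) u = snd (dd F u v)"
    using dir_deriv_fst[OF smooth_F assms] dir_deriv_snd[OF smooth_F assms]
    by (simp_all add: dir_deriv_def[of _ F])
  show ?thesis
    using 1 2 dir_deriv_inner[OF smooth_on_fst[OF smooth_F] smooth_on_fst[OF smooth_F] assms, of "\<lambda>x. v"]
      dir_deriv_inner[OF smooth_on_snd[OF smooth_F] smooth_on_snd[OF smooth_F] assms, of "\<lambda>x. v"]
    by (simp add: 3 tangent_S2xS2_def inner_commute)
qed

lemma JJ_dd_dd: "u \<in> W \<Longrightarrow> JJ (F u) (dd F u v) \<bullet> dd F u w = 0"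
  using lagrange by (simp add: kaehler_form_JJ)

lemma dd_expand:
  assumes "u \<in> W" "on_pair F u v w"
  shows "dd F u z = (dd F u z \<bullet> dd F u v) *\<^sub>R dd F u v + (dd F u z \<bullet> dd F u w) *\<^sub>R dd F u w"
proof -
  have "dd F u z \<bullet> (fst (F u), 0) = 0" "dd F u z \<bullet> (0, snd (F u)) = 0"
    using dd_tangent[OF assms(1), of z] by (simp_all add: tangent_S2xS2_def inner_prod_def inner_commute)
  moreover have "dd F u z \<bullet> JJ (F u) (dd F u v) = 0" "dd F u z \<bullet> JJ (F u) (dd F u w) = 0"
    using JJ_dd_dd[OF assms(1)] by (simp_all add: inner_commute)
  ultimately show ?thesis
    using lagrangian_frame_expand[OF F_S2xS2[OF assms(1)] dd_tangent[OF assms(1)] dd_tangent[OF assms(1)]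
        _ _ _ JJ_dd_dd[OF assms(1)], of v w "dd F u z"] assms(2)
    by (simp add: on_pair_def flip: zero_prod_def)
qed

lemma subspace_normal_space: "subspace (normal_space F u)"
  using subspace_tangent[of "F u"]
  by (auto simp: subspace_def normal_space_def inner_left_distrib)

text \<open>J maps the tangent plane of a Lagrangian surface isometrically onto its normal plane, so
  J of an orthonormal tangent pair is an orthonormal basis of the normal space.\<close>

lemma orth_proj_normal:
  assumes "u \<in> W" "on_pair F u v w"
  shows "orth_proj (normal_space F u) z =
    (z \<bullet> JJ (F u) (dd F u v)) *\<^sub>R JJ (F u) (dd F u v) + (z \<bullet> JJ (F u) (dd F u w)) *\<^sub>R JJ (F u) (dd F u w)"
    (is "_ = ?y")
proof (rule orth_proj_eqI[OF subspace_normal_space])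
  have JN: "JJ (F u) (dd F u z) \<in> normal_space F u" for z
    using JJ_dd_dd[OF assms(1)] JJ_tangent by (simp add: normal_space_def)
  then show "?y \<in> normal_space F u"
    by (intro subspace_add[OF subspace_normal_space] subspace_scale[OF subspace_normal_space])
  fix n assume n: "n \<in> normal_space F u"
  then have "n \<bullet> dd F u z = 0" "dd F u z \<bullet> n = 0" "(c *\<^sub>R fst (F u), 0) \<bullet> n = 0"
    "(0, c *\<^sub>R snd (F u)) \<bullet> n = 0" for z c
    by (simp_all add: normal_space_def inner_commute tangent_S2xS2_def inner_prod_def)
  then show "(z - ?y) \<bullet> n = 0"
    by (subst (1) lagrangian_frame_expand[OF F_S2xS2[OF assms(1)] dd_tangent[OF assms(1)] dd_tangent[OF assms(1)]
        _ _ _ JJ_dd_dd[OF assms(1)], of v w z])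
      (use assms(2) in \<open>auto simp: on_pair_def inner_left_distrib\<close>)
qed

text \<open>If \<open>M\<close> has the columns \<open>v\<close> and \<open>w\<close>,
  orthonormality says that M^T G M is the identity for the metric matrix G. Hence M M^T is the
  inverse of G, and the contraction with the inverse metric becomes the sum over the orthonormal
  pair.\<close>

lemma mean_curvature_on_pair:
  assumes u: "u \<in> W" and vw: "on_pair F u v w"
  shows "mean_curvature_vector F u =
    (1/2) *\<^sub>R orth_proj (normal_space F u) (hess F u v v + hess F u w w)"
proof -
  interpret dF: linear "dd F u" by (rule linear_dd[OF u])
  let ?P = "orth_proj (normal_space F u)"
  have linP: "linear ?P"
    by (rule linearI) (simp_all add: orth_proj_normal[OF u vw] algebra_simps)
  define M :: "real^2^2" where "M = (\<chi> i k. if k = 1 then v $ i else w $ i)"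
  let ?G = "induced_metric F u"
  have exp2: "z = z $ 1 *\<^sub>R axis 1 1 + z $ 2 *\<^sub>R axis 2 1" for z :: "real^2"
    by (simp add: vec_eq_iff axis_def forall_2)
  have G: "z \<bullet> (?G *v y) = dd F u z \<bullet> dd F u y" for z y
    by (subst (2) exp2[of z], subst (2) exp2[of y])
      (simp add: dF.add dF.scale induced_metric_def matrix_vector_mult_def inner_vec_def sum_2
        inner_left_distrib inner_right_distrib inner_commute algebra_simps)
  have colM: "(M *v axis k 1) = (if k = 1 then v else w)" for k :: 2
    using exhaust_2[of k] by (auto simp: M_def matrix_vector_mult_def vec_eq_iff axis_def sum_2)
  have "(transpose M ** ?G ** M) $ i $ k = (mat 1 :: real^2^2) $ i $ k" for i k
  proof -
    have "(transpose M ** ?G ** M) $ i $ k = axis i 1 \<bullet> ((transpose M ** ?G ** M) *v axis k 1)"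
      by (simp add: inner_axis' matrix_vector_mul_component inner_axis)
    also have "\<dots> = (M *v axis i 1) \<bullet> (?G *v (M *v axis k 1))"
      unfolding matrix_vector_mul_assoc[symmetric]
      by (metis dot_lmul_matrix inner_commute transpose_matrix_vector)
    also have "\<dots> = (mat 1 :: real^2^2) $ i $ k"
      using vw exhaust_2[of i] exhaust_2[of k]
      by (auto simp: colM G on_pair_def mat_def inner_commute)
    finally show ?thesis .
  qed
  then have "(transpose M ** ?G) ** M = mat 1" by (simp add: vec_eq_iff)
  then have "M ** (transpose M ** ?G) = mat 1" using matrix_left_right_inverse by blast
  then have MG: "(M ** transpose M) ** ?G = mat 1" by (simp add: matrix_mul_assoc)
  then have GM: "?G ** (M ** transpose M) = mat 1" using matrix_left_right_inverse by blast
  have inv: "matrix_inv ?G = M ** transpose M"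
  proof -
    have "?G ** matrix_inv ?G = mat 1 \<and> matrix_inv ?G ** ?G = mat 1"
      unfolding matrix_inv_def by (rule someI[of _ "M ** transpose M"]) (use MG GM in simp)
    then show ?thesis using MG by (metis matrix_mul_assoc matrix_mul_lid matrix_mul_rid)
  qed
  interpret HL: linear "\<lambda>z. hess F u z y" for y by (rule linear_hess_left[OF smooth_F u])
  interpret HR: linear "hess F u y" for y by (rule linear_hess_right[OF smooth_F u])
  interpret P: linear ?P by (rule linP)
  have hess2: "hess F u z z = (\<Sum>i\<in>UNIV. \<Sum>j\<in>UNIV. (z $ i * z $ j) *\<^sub>R hess F u (axis i 1) (axis j 1))" for z
    by (subst (1) exp2[of z], subst (2) exp2[of z])
      (simp only: HL.add HL.scale HR.add HR.scale sum_2 scaleR_add_right scaleR_scaleR mult.commute ac_simps)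
  have entry: "(M ** transpose M) $ i $ j = v $ i * v $ j + w $ i * w $ j" for i j :: 2
    by (simp add: M_def matrix_matrix_mult_def transpose_def sum_2)
  have "(\<Sum>i\<in>UNIV. \<Sum>j\<in>UNIV. (matrix_inv ?G $ i $ j) *\<^sub>R second_fundamental_form F u (axis i 1) (axis j 1))
    = ?P (\<Sum>i\<in>UNIV. \<Sum>j\<in>UNIV. (matrix_inv ?G $ i $ j) *\<^sub>R hess F u (axis i 1) (axis j 1))"
    by (simp add: second_fundamental_form_def normal_deriv_def P.sum P.scale)
  also have "(\<Sum>i\<in>UNIV. \<Sum>j\<in>UNIV. (matrix_inv ?G $ i $ j) *\<^sub>R hess F u (axis i 1) (axis j 1))
    = hess F u v v + hess F u w w"
    unfolding inv entry hess2 by (simp add: sum.distrib scaleR_left_distrib)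
  finally show ?thesis by (simp add: mean_curvature_vector_def)
qed

text \<open>Gram-Schmidt on the two coordinate fields. Injectivity of the differential keeps both
  squared lengths \<open>l\<close> and \<open>k\<close> positive, so their square roots and
  reciprocals are smooth.\<close>

lemma exists_smooth_on_pair:
  obtains X Y where "smooth_on W X" "smooth_on W Y" "\<And>u. u \<in> W \<Longrightarrow> on_pair F u (X u) (Y u)"
proof -
  let ?a1 = "axis 1 1 :: real^2" and ?a2 = "axis 2 1 :: real^2"
  define l where "l u = dd F u ?a1 \<bullet> dd F u ?a1" for u
  define Z where "Z u = ?a2 - ((dd F u ?a2 \<bullet> dd F u ?a1) / l u) *\<^sub>R ?a1" for u
  define k where "k u = dd F u (Z u) \<bullet> dd F u (Z u)" for u
  have nz: "dd F u z \<noteq> 0" if "u \<in> W" "z \<noteq> 0" for u z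
    using immersed[OF that(1)] that(2) linear_dd[OF that(1)] by (metis linear_0 injD)
  have lpos: "l u > 0" if "u \<in> W" for u
    using nz[OF that, of ?a1] by (simp add: l_def axis_eq_0_iff)
  have "Z u $ 2 = 1" for u by (simp add: Z_def axis_def)
  then have "Z u \<noteq> 0" for u by (metis zero_index zero_neq_one)
  then have kpos: "k u > 0" if "u \<in> W" for u
    using nz[OF that, of "Z u"] by (simp add: k_def)
  have sd: "smooth_on W (\<lambda>u. dd F u v)" for v by (rule smooth_on_frechet_const[OF smooth_F])
  have sl: "smooth_on W l" unfolding l_def by (intro smooth_on_inner sd)
  have sZ: "smooth_on W Z" unfolding Z_def
    using lpos by (intro smooth_on_diff smooth_on_scaleR smooth_on_divide smooth_on_inner sd sl smooth_on_const open_W) force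
  have sdZ: "smooth_on W (\<lambda>u. dd F u (Z u))"
    using smooth_on_dir_deriv[OF smooth_F sZ] by (rule smooth_on_cong) (simp add: dir_deriv_def)
  have sk: "smooth_on W k" unfolding k_def by (intro smooth_on_inner sdZ)
  define X where "X u = inverse (sqrt (l u)) *\<^sub>R ?a1" for u
  define Y where "Y u = inverse (sqrt (k u)) *\<^sub>R Z u" for u
  show thesis
  proof (rule that)
    show "smooth_on W X" unfolding X_def
      using lpos by (intro smooth_on_scaleR smooth_on_inverse smooth_on_sqrt sl smooth_on_const open_W) force+
    show "smooth_on W Y" unfolding Y_def
      using kpos by (intro smooth_on_scaleR smooth_on_inverse smooth_on_sqrt sk sZ) force+
    fix u assume u: "u \<in> W"
    interpret dF: linear "dd F u" by (rule linear_dd[OF u])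
    have "dd F u (X u) \<bullet> dd F u (X u) = l u / (sqrt (l u) * sqrt (l u))"
      by (simp add: X_def dF.scale l_def field_simps)
    then have 1: "dd F u (X u) \<bullet> dd F u (X u) = 1" using lpos[OF u] by simp
    have "dd F u (Y u) \<bullet> dd F u (Y u) = k u / (sqrt (k u) * sqrt (k u))"
      by (simp add: Y_def dF.scale k_def field_simps)
    then have 2: "dd F u (Y u) \<bullet> dd F u (Y u) = 1" using kpos[OF u] by simp
    have "dd F u ?a1 \<bullet> dd F u (Z u) = 0"
      using lpos[OF u] by (simp add: Z_def dF.diff dF.scale inner_diff_right l_def inner_commute)
    then have 3: "dd F u (X u) \<bullet> dd F u (Y u) = 0" by (simp add: X_def Y_def dF.scale)
    show "on_pair F u (X u) (Y u)" using 1 2 3 by (simp add: on_pair_def)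
  qed
qed

lemma smooth_mean_curvature: "smooth_on W (mean_curvature_vector F)"
proof -
  obtain X Y where X: "smooth_on W X" "smooth_on W Y" and on: "\<And>u. u \<in> W \<Longrightarrow> on_pair F u (X u) (Y u)"
    using exists_smooth_on_pair by blast
  have sd: "smooth_on W (\<lambda>u. dd F u (Z u))" if "smooth_on W Z" for Z
    using smooth_on_dir_deriv[OF smooth_F that] by (rule smooth_on_cong) (simp add: dir_deriv_def)
  have sJ: "smooth_on W (\<lambda>u. JJ (F u) (dd F u (Z u)))" if "smooth_on W Z" for Z
    unfolding JJ_def by (intro smooth_on_Pair smooth_on_cross3 smooth_on_fst smooth_on_snd sd that smooth_F)
  have sh: "smooth_on W (\<lambda>u. hess F u (Z u) (Z u))" if "smooth_on W Z" for Z
  proof -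
    \<comment> \<open>The Hessian on (Z, Z) is Z(ZF) minus the derivative of \<open>F\<close> along
      the derivative of \<open>Z\<close> in its own direction; both terms are iterated derivatives
      along smooth fields.\<close>
    have "smooth_on W (\<lambda>u. dir_deriv Z (dir_deriv Z F) u - dir_deriv (dir_deriv Z Z) F u)"
      by (intro smooth_on_diff smooth_on_dir_deriv smooth_F that)
    then show ?thesis
      by (rule smooth_on_cong) (simp add: dir_deriv_dir_deriv[OF smooth_F that] dir_deriv_def[of "dir_deriv Z Z"])
  qed
  have "smooth_on W (\<lambda>u. (1/2) *\<^sub>R
     (((hess F u (X u) (X u) + hess F u (Y u) (Y u)) \<bullet> JJ (F u) (dd F u (X u))) *\<^sub>R JJ (F u) (dd F u (X u)) +
      ((hess F u (X u) (X u) + hess F u (Y u) (Y u)) \<bullet> JJ (F u) (dd F u (Y u))) *\<^sub>R JJ (F u) (dd F u (Y u))))"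
    by (intro smooth_on_scaleR smooth_on_add smooth_on_inner sJ sh X smooth_on_const open_W)
  then show ?thesis
    by (rule smooth_on_cong) (simp add: mean_curvature_on_pair[OF _ on] orth_proj_normal[OF _ on])
qed

end

subsection \<open>Invariance under reparametrization\<close>

lemma has_derivative_reparam:
  assumes G: "smooth_on V G" and t: "smooth_on U t" and im: "\<And>x. x \<in> U \<Longrightarrow> t x \<in> V"
    and FG: "\<And>x. x \<in> U \<Longrightarrow> F x = G (t x)" and u: "u \<in> U"
  shows "frechet_derivative F (at u) v = frechet_derivative G (at (t u)) (frechet_derivative t (at u) v)"
proof -
  have "((\<lambda>x. G (t x)) has_derivative
      (\<lambda>v. frechet_derivative G (at (t u)) (frechet_derivative t (at u) v))) (at u)"
    by (rule has_derivative_compose[OF smooth_onD(5)[OF t u] smooth_onD(5)[OF G im[OF u]]])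
  then have "(F has_derivative
      (\<lambda>v. frechet_derivative G (at (t u)) (frechet_derivative t (at u) v))) (at u)"
    by (rule has_derivative_transform_within_open[OF _ smooth_onD(1)[OF t] u]) (simp add: FG)
  from frechet_derivative_at[OF this] show ?thesis by metis
qed

lemma hess_reparam:
  fixes G :: "'b::euclidean_space \<Rightarrow> 'c::euclidean_space"
  assumes G: "smooth_on V G" and t: "smooth_on U t" and im: "\<And>x. x \<in> U \<Longrightarrow> t x \<in> V"
    and FG: "\<And>x. x \<in> U \<Longrightarrow> F x = G (t x)" and u: "u \<in> U"
  shows "hess F u v w = hess G (t u) (frechet_derivative t (at u) v) (frechet_derivative t (at u) w)
    + frechet_derivative G (at (t u)) (hess t u v w)"
proof -
  note W = smooth_onD(1)[OF t]
  let ?t' = "\<lambda>x v. frechet_derivative t (at x) v"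
  let ?G' = "\<lambda>x v. frechet_derivative G (at x) v"
  have eq: "frechet_derivative F (at x) w = (\<Sum>i\<in>Basis. (?t' x w \<bullet> i) *\<^sub>R ?G' (t x) i)" if "x \<in> U" for x
    by (simp only: has_derivative_reparam[OF G t im FG that]
        flip: frechet_derivative_expand[OF smooth_onD(4)[OF G im[OF that]]])
  have "((\<lambda>x. (?t' x w \<bullet> i) *\<^sub>R ?G' (t x) i) has_derivative
      (\<lambda>v. (?t' u w \<bullet> i) *\<^sub>R hess G (t u) (?t' u v) i + (hess t u v w \<bullet> i) *\<^sub>R ?G' (t u) i)) (at u)" for i
    by (rule bounded_bilinear.FDERIV[OF bounded_bilinear_scaleR
          bounded_linear.has_derivative[OF bounded_linear_inner_left
            smooth_onD(5)[OF smooth_on_frechet_const[OF t] u]]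
          has_derivative_compose[OF smooth_onD(5)[OF t u]
            smooth_onD(5)[OF smooth_on_frechet_const[OF G] im[OF u]]]])
  then have "((\<lambda>x. \<Sum>i\<in>Basis. (?t' x w \<bullet> i) *\<^sub>R ?G' (t x) i) has_derivative
      (\<lambda>v. \<Sum>i\<in>Basis. (?t' u w \<bullet> i) *\<^sub>R hess G (t u) (?t' u v) i + (hess t u v w \<bullet> i) *\<^sub>R ?G' (t u) i)) (at u)"
    by (rule has_derivative_sum)
  then have "((\<lambda>x. frechet_derivative F (at x) w) has_derivative
      (\<lambda>v. \<Sum>i\<in>Basis. (?t' u w \<bullet> i) *\<^sub>R hess G (t u) (?t' u v) i + (hess t u v w \<bullet> i) *\<^sub>R ?G' (t u) i)) (at u)"
    by (rule has_derivative_transform_within_open[OF _ W u]) (simp only: eq)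
  from fun_cong[OF frechet_derivative_at[OF this], of v]
  have "hess F u v w = (\<Sum>i\<in>Basis. (?t' u w \<bullet> i) *\<^sub>R hess G (t u) (?t' u v) i)
     + (\<Sum>i\<in>Basis. (hess t u v w \<bullet> i) *\<^sub>R ?G' (t u) i)"
    by (simp add: sum.distrib)
  also have "(\<Sum>i\<in>Basis. (?t' u w \<bullet> i) *\<^sub>R hess G (t u) (?t' u v) i) = hess G (t u) (?t' u v) (?t' u w)"
  proof -
    interpret linear "hess G (t u) (?t' u v)" by (rule linear_hess_right[OF G im[OF u]])
    have "hess G (t u) (?t' u v) (\<Sum>i\<in>Basis. (?t' u w \<bullet> i) *\<^sub>R i)
        = (\<Sum>i\<in>Basis. (?t' u w \<bullet> i) *\<^sub>R hess G (t u) (?t' u v) i)"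
      by (simp only: sum scale)
    then show ?thesis by (simp only: euclidean_representation)
  qed
  also have "(\<Sum>i\<in>Basis. (hess t u v w \<bullet> i) *\<^sub>R ?G' (t u) i) = ?G' (t u) (hess t u v w)"
    by (rule frechet_derivative_expand[OF smooth_onD(4)[OF G im[OF u]], symmetric])
  finally show ?thesis .
qed

lemma on_pair_reparam:
  assumes "smooth_on V G" "smooth_on U t" "\<And>x. x \<in> U \<Longrightarrow> t x \<in> V"
    "\<And>x. x \<in> U \<Longrightarrow> F x = G (t x)" "u \<in> U"
  shows "on_pair F u v w \<longleftrightarrow>
    on_pair G (t u) (frechet_derivative t (at u) v) (frechet_derivative t (at u) w)"
  by (simp add: on_pair_def has_derivative_reparam[OF assms])

text \<open>The second-order chain rule adds to the Hessian a term in the image of the differential.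
  The projection to the normal space removes it, and the orthonormal pair can be transported along
  the change of coordinates.\<close>

lemma mean_curvature_reparam:
  assumes "lagrangian_patch W F" "lagrangian_patch V G"
    and t: "smooth_on U t" and UW: "U \<subseteq> W" and im: "\<And>x. x \<in> U \<Longrightarrow> t x \<in> V"
    and FG: "\<And>x. x \<in> U \<Longrightarrow> F x = G (t x)" and u: "u \<in> U"
  shows "mean_curvature_vector F u = mean_curvature_vector G (t u)"
proof -
  interpret F: lagrangian_patch W F by fact
  interpret G: lagrangian_patch V G by fact
  have uW: "u \<in> W" using u UW by auto
  note tu = im[OF u] and G = G.smooth_F
  let ?t' = "\<lambda>v. frechet_derivative t (at u) v"
  obtain v w where vw: "on_pair F u v w" using F.exists_smooth_on_pair uW by metis
  have vw': "on_pair G (t u) (?t' v) (?t' w)" using vw on_pair_reparam[OF G t im FG u] by simp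
  have F': "dd F u z = dd G (t u) (?t' z)" for z by (rule has_derivative_reparam[OF G t im FG u])
  \<comment> \<open>The images of the transported vectors form an orthonormal basis of the tangent
    plane, so orthogonality to the image under the change of coordinates is orthogonality to the
    whole plane.\<close>
  have N: "normal_space F u = normal_space G (t u)"
  proof -
    have "(\<forall>z. n \<bullet> dd F u z = 0) \<longleftrightarrow> (\<forall>z. n \<bullet> dd G (t u) z = 0)" for n
    proof
      assume "\<forall>z. n \<bullet> dd F u z = 0"
      then have "n \<bullet> dd G (t u) (?t' v) = 0" "n \<bullet> dd G (t u) (?t' w) = 0" by (auto simp: F')
      then show "\<forall>z. n \<bullet> dd G (t u) z = 0"
        by (subst G.dd_expand[OF tu vw']) (simp add: inner_right_distrib)
    qed (simp add: F')
    then show ?thesis using FG[OF u] by (simp add: normal_space_def)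
  qed
  have "dd G (t u) z \<bullet> JJ (G (t u)) (dd G (t u) y) = 0" for y z
    using G.JJ_dd_dd[OF tu] by (simp add: inner_commute)
  then have "orth_proj (normal_space G (t u)) (z + dd G (t u) y) = orth_proj (normal_space G (t u)) z" for y z
    by (simp add: G.orth_proj_normal[OF tu vw'] inner_left_distrib)
  note this[where y = "y + y'" for y y'] 
  moreover have "a + dd G (t u) y + (b + dd G (t u) y') = (a + b) + dd G (t u) (y + y')" for a b y y'
    using linear_add[OF G.linear_dd[OF tu]] by simp
  ultimately show ?thesis
    by (simp only: F.mean_curvature_on_pair[OF uW vw] G.mean_curvature_on_pair[OF tu vw'] N
        hess_reparam[OF G t im FG u])
qed

subsection \<open>The parallel frame\<close>

text \<open>The cross product of two vectors tangent to the sphere at \<open>p\<close> is radial.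
  This is what makes J parallel: the derivative of \<open>p\<close> inside p \<times> v contributes
  nothing tangential.\<close>

lemma triple_product_tangent:
  fixes p a b c :: "real^3"
  assumes "p \<bullet> p = 1" "p \<bullet> a = 0" "p \<bullet> b = 0" "p \<bullet> c = 0"
  shows "(a \<times>\<^sub>3 b) \<bullet> c = 0"
proof -
  have "p \<times>\<^sub>3 (a \<times>\<^sub>3 b) = 0" using assms by (simp add: Lagrange)
  then have "0 = p \<times>\<^sub>3 (p \<times>\<^sub>3 (a \<times>\<^sub>3 b))" by simp
  also have "\<dots> = (p \<bullet> (a \<times>\<^sub>3 b)) *\<^sub>R p - a \<times>\<^sub>3 b" using assms(1) by (subst Lagrange) simp
  finally have "a \<times>\<^sub>3 b = (p \<bullet> (a \<times>\<^sub>3 b)) *\<^sub>R p" by simp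
  then have "(a \<times>\<^sub>3 b) \<bullet> c = (p \<bullet> (a \<times>\<^sub>3 b)) * (p \<bullet> c)" by (metis inner_scaleR_left)
  then show ?thesis using assms(4) by simp
qed

text \<open>The equation H = m J dF(X) pins \<open>X\<close> down as the field representing -JH/m.
  The field \<open>Y\<close> is then determined up to sign.\<close>

locale parallel_frame = lagrangian_patch +
  fixes X Y :: "real^2 \<Rightarrow> real^2" and m :: real
  assumes smooth_X: "smooth_on W X" and smooth_Y: "smooth_on W Y"
    and on: "\<And>u. u \<in> W \<Longrightarrow> on_pair F u (X u) (Y u)"
    and m_pos: "m > 0"
    and mean_curvature: "\<And>u. u \<in> W \<Longrightarrow> mean_curvature_vector F u = m *\<^sub>R JJ (F u) (dd F u (X u))"
    and parallel: "\<And>u v. u \<in> W \<Longrightarrow> normal_deriv F (mean_curvature_vector F) u v = 0"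

text \<open>Any smooth orthonormal pair is rotated until J of its first vector points along H. The
  coefficients \<open>h\<close> and \<open>k\<close> are the cosine and sine of that rotation, with
  h^2 + k^2 = 1 because |H| = m.\<close>

lemma (in lagrangian_patch) exists_parallel_frame:
  assumes m: "m > 0" "\<And>u. u \<in> W \<Longrightarrow> norm (mean_curvature_vector F u) = m"
    and par: "\<And>u v. u \<in> W \<Longrightarrow> normal_deriv F (mean_curvature_vector F) u v = 0"
  obtains X Y where "parallel_frame W F X Y m"
proof -
  let ?H = "mean_curvature_vector F"
  obtain A B where A: "smooth_on W A" and B: "smooth_on W B" and on: "\<And>u. u \<in> W \<Longrightarrow> on_pair F u (A u) (B u)"
    using exists_smooth_on_pair by blast
  have sd: "smooth_on W (\<lambda>u. dd F u (Z u))" if "smooth_on W Z" for Z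
    using smooth_on_dir_deriv[OF smooth_F that] by (rule smooth_on_cong) (simp add: dir_deriv_def)
  have sJ: "smooth_on W (\<lambda>u. JJ (F u) (dd F u (Z u)))" if "smooth_on W Z" for Z
    unfolding JJ_def by (intro smooth_on_Pair smooth_on_cross3 smooth_on_fst smooth_on_snd sd that smooth_F)
  define h k where "h u = ?H u \<bullet> JJ (F u) (dd F u (A u)) / m"
    and "k u = ?H u \<bullet> JJ (F u) (dd F u (B u)) / m" for u
  have sh: "smooth_on W h" "smooth_on W k" unfolding h_def k_def
    by (rule smooth_on_bounded_linear[OF bounded_linear_divide],
        intro smooth_on_inner sJ smooth_mean_curvature A B)+
  define X Y where "X u = h u *\<^sub>R A u + k u *\<^sub>R B u" and "Y u = (- k u) *\<^sub>R A u + h u *\<^sub>R B u" for u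
  have H: "?H u = m *\<^sub>R JJ (F u) (dd F u (X u)) \<and> on_pair F u (X u) (Y u)" if u: "u \<in> W" for u
  proof -
    interpret dF: linear "dd F u" by (rule linear_dd[OF u])
    let ?a = "dd F u (A u)" and ?b = "dd F u (B u)"
    have lJ: "linear (JJ (F u))" using bounded_linear_JJ bounded_linear.linear by blast
    have JJ: "JJ (F u) ?a \<bullet> JJ (F u) ?a = 1" "JJ (F u) ?a \<bullet> JJ (F u) ?b = 0" "JJ (F u) ?b \<bullet> JJ (F u) ?b = 1"
      "JJ (F u) ?b \<bullet> JJ (F u) ?a = 0"
      using on[OF u] JJ_inner[OF F_S2xS2[OF u] dd_tangent[OF u]] by (simp_all add: on_pair_def inner_commute)
    define Q where "Q = hess F u (A u) (A u) + hess F u (B u) (B u)"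
    have "?H u = (1/2 * (Q \<bullet> JJ (F u) ?a)) *\<^sub>R JJ (F u) ?a + (1/2 * (Q \<bullet> JJ (F u) ?b)) *\<^sub>R JJ (F u) ?b"
      by (simp add: mean_curvature_on_pair[OF u on[OF u]] orth_proj_normal[OF u on[OF u]] scaleR_add_right Q_def)
    then have H: "?H u = (m * h u) *\<^sub>R JJ (F u) ?a + (m * k u) *\<^sub>R JJ (F u) ?b"
      using JJ m(1) by (simp add: h_def k_def inner_left_distrib)
    then have 1: "?H u = m *\<^sub>R JJ (F u) (dd F u (X u))"
      by (simp add: X_def dF.add dF.scale linear_add[OF lJ] linear_scale[OF lJ] scaleR_add_right)
    have "m\<^sup>2 = ?H u \<bullet> ?H u" using m(2)[OF u] by (simp add: power2_norm_eq_inner[symmetric])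
    also have "\<dots> = m\<^sup>2 * ((h u)\<^sup>2 + (k u)\<^sup>2)"
      unfolding H by (simp add: inner_left_distrib inner_right_distrib JJ power2_eq_square algebra_simps)
    finally have "h u * h u + k u * k u = 1" using m(1) by (simp add: power2_eq_square)
    then have 2: "on_pair F u (X u) (Y u)"
      using on[OF u] unfolding on_pair_def X_def Y_def
      by (simp add: dF.add dF.diff dF.scale inner_left_distrib inner_right_distrib inner_diff_left
          inner_diff_right inner_commute)
    show ?thesis using 1 2 by simp
  qed
  show thesis
  proof (rule that, unfold_locales)
    show "smooth_on W X" "smooth_on W Y"
      unfolding X_def Y_def by (intro smooth_on_add smooth_on_scaleR smooth_on_minus A B sh)+
  qed (use H m par in auto)
qed

section \<open>Parallelism of the frame and the coefficients of the cubic form\<close>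

context parallel_frame
begin

definition e where "e = dir_deriv X F"
definition e' where "e' = dir_deriv Y F"

lemma e_eq: "e u = dd F u (X u)" and e'_eq: "e' u = dd F u (Y u)"
  by (simp_all add: e_def e'_def dir_deriv_def)

lemma smooth_e: "smooth_on W e" and smooth_e': "smooth_on W e'"
  unfolding e_def e'_def by (intro smooth_on_dir_deriv smooth_F smooth_X smooth_Y)+

lemma e_inner: "u \<in> W \<Longrightarrow> e u \<bullet> e u = 1" "u \<in> W \<Longrightarrow> e' u \<bullet> e' u = 1" "u \<in> W \<Longrightarrow> e u \<bullet> e' u = 0"
  "u \<in> W \<Longrightarrow> e' u \<bullet> e u = 0"
  using on by (auto simp: on_pair_def e_eq e'_eq inner_commute)

lemma smooth_JJ: "smooth_on W a \<Longrightarrow> smooth_on W (\<lambda>u. JJ (F u) (a u))"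
  unfolding JJ_def by (intro smooth_on_Pair smooth_on_cross3 smooth_on_fst smooth_on_snd smooth_F)

lemma dir_deriv_JJ:
  assumes a: "smooth_on W a" and u: "u \<in> W"
  shows "dir_deriv Z (\<lambda>u. JJ (F u) (a u)) u =
    (fst (dir_deriv Z F u) \<times>\<^sub>3 fst (a u), snd (dir_deriv Z F u) \<times>\<^sub>3 snd (a u)) + JJ (F u) (dir_deriv Z a u)"
  unfolding JJ_def
  by (subst dir_deriv_Pair[OF _ _ u])
    (simp_all add: smooth_on_cross3 smooth_on_fst smooth_on_snd smooth_F a
      dir_deriv_cross3[OF smooth_on_fst[OF smooth_F] smooth_on_fst[OF a] u]
      dir_deriv_cross3[OF smooth_on_snd[OF smooth_F] smooth_on_snd[OF a] u]
      dir_deriv_fst[OF smooth_F u] dir_deriv_snd[OF smooth_F u]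
      dir_deriv_fst[OF a u] dir_deriv_snd[OF a u])

text \<open>The derivative passes through J because the term in which the base point is
  differentiated consists of triple products of tangent vectors in each factor.\<close>

lemma dir_deriv_JJ_inner:
  assumes a: "smooth_on W a" and u: "u \<in> W" and t: "a u \<in> tangent_S2xS2 (F u)" "b \<in> tangent_S2xS2 (F u)"
  shows "dir_deriv Z (\<lambda>u. JJ (F u) (a u)) u \<bullet> b = JJ (F u) (dir_deriv Z a u) \<bullet> b"
proof -
  have "dir_deriv Z F u \<in> tangent_S2xS2 (F u)" using dd_tangent[OF u] by (simp add: dir_deriv_def)
  then show ?thesis
    using t F_S2xS2[OF u]
      triple_product_tangent[of "fst (F u)" "fst (dir_deriv Z F u)" "fst (a u)" "fst b"]
      triple_product_tangent[of "snd (F u)" "snd (dir_deriv Z F u)" "snd (a u)" "snd b"]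
    by (simp add: dir_deriv_JJ[OF a u] inner_left_distrib)
      (simp add: inner_prod_def tangent_S2xS2_def mem_S2xS2)
qed

lemma e_tangent: "u \<in> W \<Longrightarrow> e u \<in> tangent_S2xS2 (F u)" "u \<in> W \<Longrightarrow> e' u \<in> tangent_S2xS2 (F u)"
  using dd_tangent by (auto simp: e_eq e'_eq)

lemma e_lagrange: "u \<in> W \<Longrightarrow> JJ (F u) (a u) \<bullet> b u = 0" "u \<in> W \<Longrightarrow> a u \<bullet> JJ (F u) (b u) = 0"
  if "a \<in> {e, e'}" "b \<in> {e, e'}" for a b
  using that JJ_dd_dd by (auto simp: e_eq e'_eq inner_commute[of _ "JJ _ _"])

text \<open>Differentiating the Lagrangian identity <a, Jb> = 0 and moving J across with its
  skewness exchanges \<open>a\<close> and \<open>b\<close>. With the commutation of the fields this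
  makes the cubic form totally symmetric.\<close>

lemma shape_symmetric:
  assumes u: "u \<in> W" and ab: "a \<in> {e, e'}" "b \<in> {e, e'}"
  shows "dir_deriv Z a u \<bullet> JJ (F u) (b u) = dir_deriv Z b u \<bullet> JJ (F u) (a u)"
proof -
  have s: "smooth_on W a" "smooth_on W b" and t: "a u \<in> tangent_S2xS2 (F u)" "b u \<in> tangent_S2xS2 (F u)"
    using ab smooth_e smooth_e' e_tangent[OF u] by auto
  have "dir_deriv Z (\<lambda>u. a u \<bullet> JJ (F u) (b u)) u = 0"
    using dir_deriv_cong[OF open_W u, of "\<lambda>u. a u \<bullet> JJ (F u) (b u)" "\<lambda>u. 0" Z] e_lagrange[OF ab] by simp
  then have "dir_deriv Z a u \<bullet> JJ (F u) (b u) + a u \<bullet> dir_deriv Z (\<lambda>u. JJ (F u) (b u)) u = 0"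
    using dir_deriv_inner[OF s(1) smooth_JJ[OF s(2)] u] by simp
  then have "dir_deriv Z a u \<bullet> JJ (F u) (b u) + JJ (F u) (dir_deriv Z b u) \<bullet> a u = 0"
    using dir_deriv_JJ_inner[OF s(2) u t(2) t(1)] by (simp add: inner_commute)
  then show ?thesis using JJ_skew by simp
qed

text \<open>Parallelism of H in the normal bundle removes the component of its derivative along
  \<open>J e'\<close>. Since JH = -me and J is parallel, the derivative of \<open>e\<close> has no
  component along \<open>e'\<close>; the remaining products follow from orthonormality.\<close>

lemma frame_parallel: "u \<in> W \<Longrightarrow> dir_deriv Z a u \<bullet> b u = 0" if "a \<in> {e, e'}" "b \<in> {e, e'}" for a b
proof -
  assume u: "u \<in> W"
  have diff: "dir_deriv Z a u \<bullet> b u + a u \<bullet> dir_deriv Z b u = 0" if "a \<in> {e, e'}" "b \<in> {e, e'}" for a b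
  proof -
    have s: "smooth_on W a" "smooth_on W b" using that smooth_e smooth_e' by auto
    have "dir_deriv Z (\<lambda>u. a u \<bullet> b u) u = 0"
      using dir_deriv_cong[OF open_W u, of "\<lambda>u. a u \<bullet> b u" "\<lambda>_. a u \<bullet> b u" Z] that e_inner[OF u] e_inner
      by auto
    then show ?thesis using dir_deriv_inner[OF s u] by simp
  qed
  let ?H = "mean_curvature_vector F"
  have H_e: "dir_deriv Z ?H u \<bullet> JJ (F u) (e' u) = 0"
  proof -
    have "(dir_deriv Z ?H u \<bullet> JJ (F u) (e u)) *\<^sub>R JJ (F u) (e u) + (dir_deriv Z ?H u \<bullet> JJ (F u) (e' u)) *\<^sub>R JJ (F u) (e' u) = 0"
      using parallel[OF u, of "Z u"] orth_proj_normal[OF u on[OF u]]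
      by (simp add: normal_deriv_def e_eq e'_eq dir_deriv_def)
    from arg_cong[OF this, of "\<lambda>z. z \<bullet> JJ (F u) (e' u)"] show ?thesis
      using JJ_inner[OF F_S2xS2[OF u] e_tangent(1)[OF u]] JJ_inner[OF F_S2xS2[OF u] e_tangent(2)[OF u]]
      by (simp add: inner_left_distrib e_inner[OF u])
  qed
  have He: "JJ (F x) (?H x) = (- m) *\<^sub>R e x" if "x \<in> W" for x
    using mean_curvature[OF that] JJ_JJ[OF F_S2xS2[OF that] e_tangent(1)[OF that]]
      linear_scale[OF bounded_linear.linear[OF bounded_linear_JJ]] by (simp add: e_eq)
  have Ht: "?H u \<in> tangent_S2xS2 (F u)"
    using mean_curvature[OF u] subspace_scale[OF subspace_tangent JJ_tangent] by simp
  have "(- m) * (dir_deriv Z e u \<bullet> e' u) = dir_deriv Z (\<lambda>x. (- m) *\<^sub>R e x) u \<bullet> e' u"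
    using dir_deriv_bounded_linear[OF smooth_e u bounded_linear_scaleR_right, of Z "- m"] by simp
  also have "\<dots> = dir_deriv Z (\<lambda>x. JJ (F x) (?H x)) u \<bullet> e' u"
    using dir_deriv_cong[OF open_W u He] by simp
  also have "\<dots> = 0"
    using dir_deriv_JJ_inner[OF smooth_mean_curvature u Ht e_tangent(2)[OF u]] JJ_skew H_e by simp
  finally have "dir_deriv Z e u \<bullet> e' u = 0" using m_pos by simp
  then show "dir_deriv Z a u \<bullet> b u = 0"
    using diff[of e e] diff[of e' e'] diff[of e e'] that by (auto simp: inner_commute)
qed

text \<open>The differential of \<open>F\<close> sends the bracket of \<open>X\<close> and
  \<open>Y\<close> to a difference of derivatives of frame vectors. That difference is tangent to
  the surface, while frame derivatives have no tangential component.\<close>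

lemma frame_commute:
  assumes u: "u \<in> W"
  shows "dir_deriv X Y u = dir_deriv Y X u" "dir_deriv X e' u = dir_deriv Y e u"
proof -
  let ?Z = "dir_deriv X Y u - dir_deriv Y X u"
  interpret dF: linear "dd F u" by (rule linear_dd[OF u])
  have 1: "dd F u ?Z = dir_deriv X e' u - dir_deriv Y e u"
    using dir_deriv_dir_deriv[OF smooth_F smooth_Y u, of X] dir_deriv_dir_deriv[OF smooth_F smooth_X u, of Y]
      second_derivative_symmetric[OF smooth_F u, of "X u" "Y u"]
    by (simp add: e_def e'_def dF.diff)
  have "dd F u ?Z \<bullet> e u = 0" "dd F u ?Z \<bullet> e' u = 0"
    unfolding 1 using frame_parallel[OF _ _ u] by (simp_all add: inner_diff_left)
  then have 0: "dd F u ?Z = 0" using dd_expand[OF u on[OF u], of ?Z] by (simp add: e_eq e'_eq)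
  then have "?Z = 0" using immersed[OF u] dF.zero by (metis injD)
  then show "dir_deriv X Y u = dir_deriv Y X u" by simp
  show "dir_deriv X e' u = dir_deriv Y e u" using 0 1 by simp
qed

definition p where "p u = dir_deriv X e u \<bullet> JJ (F u) (e u)"
definition q where "q u = dir_deriv X e u \<bullet> JJ (F u) (e' u)"

lemma smooth_p: "smooth_on W p" and smooth_q: "smooth_on W q"
  unfolding p_def q_def
  by (intro smooth_on_inner smooth_on_dir_deriv smooth_JJ smooth_e smooth_e' smooth_X)+

text \<open>Total symmetry leaves four components. The trace of the second fundamental form is 2H =
  2m Je, which reads S111 + S122 = 2m along \<open>J e\<close> and S112 + S222 = 0 along
  \<open>J e'\<close>.\<close>

lemma shape_coefficients:
  assumes u: "u \<in> W"
  shows "dir_deriv Y e u \<bullet> JJ (F u) (e u) = q u"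
    "dir_deriv Y e u \<bullet> JJ (F u) (e' u) = 2 * m - p u"
    "dir_deriv Y e' u \<bullet> JJ (F u) (e u) = 2 * m - p u"
    "dir_deriv Y e' u \<bullet> JJ (F u) (e' u) = - q u"
proof -
  let ?J = "JJ (F u)"
  show 1: "dir_deriv Y e u \<bullet> ?J (e u) = q u"
    using shape_symmetric[OF u, of e e' X] frame_commute(2)[OF u] by (simp add: q_def)
  have 2: "dir_deriv Y e u \<bullet> ?J (e' u) = dir_deriv Y e' u \<bullet> ?J (e u)"
    using shape_symmetric[OF u, of e e' Y] by simp
  \<comment> \<open>The Hessian of \<open>F\<close> and the iterated derivative along a field differ
    by a tangent vector, and such vectors are orthogonal to \<open>J e\<close> and
    \<open>J e'\<close>.\<close>
  have z: "dd F u z \<bullet> ?J (e u) = 0" "dd F u z \<bullet> ?J (e' u) = 0" for z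
    using JJ_dd_dd[OF u] by (simp_all add: e_eq e'_eq inner_commute)
  have h: "hess F u (X u) (X u) \<bullet> ?J c = dir_deriv X e u \<bullet> ?J c"
    "hess F u (Y u) (Y u) \<bullet> ?J c = dir_deriv Y e' u \<bullet> ?J c" if "c \<in> {e u, e' u}" for c
    using that z unfolding e_def e'_def
    by (auto simp: dir_deriv_dir_deriv[OF smooth_F smooth_X u] dir_deriv_dir_deriv[OF smooth_F smooth_Y u]
        inner_left_distrib dir_deriv_def[of _ F])
  have JJ: "?J (e u) \<bullet> ?J (e u) = 1" "?J (e' u) \<bullet> ?J (e u) = 0" "?J (e u) \<bullet> ?J (e' u) = 0" "?J (e' u) \<bullet> ?J (e' u) = 1"
    using JJ_inner[OF F_S2xS2[OF u] e_tangent(1)[OF u]] JJ_inner[OF F_S2xS2[OF u] e_tangent(2)[OF u]] e_inner[OF u]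
    by auto
  have H: "(2 * m) *\<^sub>R ?J (e u) = ((hess F u (X u) (X u) + hess F u (Y u) (Y u)) \<bullet> ?J (e u)) *\<^sub>R ?J (e u)
    + ((hess F u (X u) (X u) + hess F u (Y u) (Y u)) \<bullet> ?J (e' u)) *\<^sub>R ?J (e' u)" (is "_ = ?R")
  proof -
    have "m *\<^sub>R ?J (e u) = (1/2) *\<^sub>R ?R"
      using mean_curvature[OF u] mean_curvature_on_pair[OF u on[OF u]] orth_proj_normal[OF u on[OF u]]
      by (simp only: e_eq e'_eq)
    from arg_cong[OF this, of "\<lambda>z. 2 *\<^sub>R z"] show ?thesis by (simp only: scaleR_scaleR) simp
  qed
  from arg_cong[OF H, of "\<lambda>z. z \<bullet> ?J (e u)"] show "dir_deriv Y e' u \<bullet> ?J (e u) = 2 * m - p u"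
    using h[of "e u"] JJ by (simp add: inner_left_distrib p_def)
  then show "dir_deriv Y e u \<bullet> ?J (e' u) = 2 * m - p u" using 2 by simp
  from arg_cong[OF H, of "\<lambda>z. z \<bullet> ?J (e' u)"] show "dir_deriv Y e' u \<bullet> ?J (e' u) = - q u"
    using h[of "e' u"] JJ by (simp add: inner_left_distrib q_def)
qed

text \<open>The components along \<open>e\<close> and \<open>e'\<close> vanish by parallelism; the
  radial ones come from differentiating the tangency conditions in the two factors.\<close>

lemma frame_derivative_expand:
  assumes u: "u \<in> W" and a: "a \<in> {e, e'}"
  shows "dir_deriv Z a u = (dir_deriv Z a u \<bullet> JJ (F u) (e u)) *\<^sub>R JJ (F u) (e u)
    + (dir_deriv Z a u \<bullet> JJ (F u) (e' u)) *\<^sub>R JJ (F u) (e' u)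
    - (fst (a u) \<bullet> fst (dir_deriv Z F u)) *\<^sub>R (fst (F u), 0) - (snd (a u) \<bullet> snd (dir_deriv Z F u)) *\<^sub>R (0, snd (F u))"
proof -
  have s: "smooth_on W a" using a smooth_e smooth_e' by auto
  have t: "fst (F x) \<bullet> fst (a x) = 0" "snd (F x) \<bullet> snd (a x) = 0" if "x \<in> W" for x
    using a e_tangent[OF that] by (auto simp: tangent_S2xS2_def)
  have "dir_deriv Z (\<lambda>x. fst (F x) \<bullet> fst (a x)) u = 0" "dir_deriv Z (\<lambda>x. snd (F x) \<bullet> snd (a x)) u = 0"
    using dir_deriv_cong[OF open_W u t(1), where X = Z] dir_deriv_cong[OF open_W u t(2), where X = Z] by simp_all
  then have "dir_deriv Z a u \<bullet> (fst (F u), 0) = - (fst (a u) \<bullet> fst (dir_deriv Z F u))"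
    "dir_deriv Z a u \<bullet> (0, snd (F u)) = - (snd (a u) \<bullet> snd (dir_deriv Z F u))"
    using dir_deriv_inner[OF smooth_on_fst[OF smooth_F] smooth_on_fst[OF s] u, of Z]
      dir_deriv_inner[OF smooth_on_snd[OF smooth_F] smooth_on_snd[OF s] u, of Z]
      dir_deriv_fst[OF smooth_F u, of Z] dir_deriv_snd[OF smooth_F u, of Z]
      dir_deriv_fst[OF s u, of Z] dir_deriv_snd[OF s u, of Z]
    by (simp_all add: inner_prod_def inner_commute)
  then show ?thesis
    using lagrangian_frame_expand[OF F_S2xS2[OF u] e_tangent[OF u] e_inner(1-3)[OF u], of "dir_deriv Z a u"]
      e_lagrange[of e e', OF _ _ u] frame_parallel[where a = a and b = e and Z = Z, OF a _ u]
      frame_parallel[where a = a and b = e' and Z = Z, OF a _ u]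
    by (simp del: scaleR_Pair)
qed

end

subsection \<open>Structure equations of a factor\<close>

text \<open>The second fundamental form of the frame has the components
  \<open>S\<^sub>1\<^sub>1\<^sub>1 = p\<close>, \<open>S\<^sub>1\<^sub>1\<^sub>2 = q\<close>, \<open>S\<^sub>1\<^sub>2\<^sub>2 = 2m - p\<close> and \<open>S\<^sub>2\<^sub>2\<^sub>2 = -q\<close>.\<close>

locale sphere_factor =
  fixes W :: "(real^2) set" and X Y :: "real^2 \<Rightarrow> real^2" and p q :: "real^2 \<Rightarrow> real" and m :: real
    and f :: "real^2 \<Rightarrow> real^3"
  assumes sX: "smooth_on W X" and sY: "smooth_on W Y" and sp: "smooth_on W p" and sq: "smooth_on W q"
    and sf: "smooth_on W f"
    and commute: "\<And>u. u \<in> W \<Longrightarrow> dir_deriv X Y u = dir_deriv Y X u"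
    and unit: "\<And>u. u \<in> W \<Longrightarrow> f u \<bullet> f u = 1"
    and XX: "\<And>u. u \<in> W \<Longrightarrow> dir_deriv X (dir_deriv X f) u = p u *\<^sub>R (f u \<times>\<^sub>3 dir_deriv X f u)
      + q u *\<^sub>R (f u \<times>\<^sub>3 dir_deriv Y f u) - (dir_deriv X f u \<bullet> dir_deriv X f u) *\<^sub>R f u"
    and YX: "\<And>u. u \<in> W \<Longrightarrow> dir_deriv Y (dir_deriv X f) u = q u *\<^sub>R (f u \<times>\<^sub>3 dir_deriv X f u)
      + (2 * m - p u) *\<^sub>R (f u \<times>\<^sub>3 dir_deriv Y f u) - (dir_deriv X f u \<bullet> dir_deriv Y f u) *\<^sub>R f u"
    and YY: "\<And>u. u \<in> W \<Longrightarrow> dir_deriv Y (dir_deriv Y f) u = (2 * m - p u) *\<^sub>R (f u \<times>\<^sub>3 dir_deriv X f u)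
      + (- q u) *\<^sub>R (f u \<times>\<^sub>3 dir_deriv Y f u) - (dir_deriv Y f u \<bullet> dir_deriv Y f u) *\<^sub>R f u"
begin

abbreviation x where "x \<equiv> dir_deriv X f"
abbreviation y where "y \<equiv> dir_deriv Y f"

text \<open>\<open>E\<close>, \<open>B\<close>, \<open>G\<close> are the coefficients of the metric
  pulled back by \<open>f\<close>, in the frame \<open>X\<close>, \<open>Y\<close>; \<open>D\<close>
  is the signed Jacobian, the pullback of the area form.\<close>

definition E where "E u = x u \<bullet> x u"
definition B where "B u = x u \<bullet> y u"
definition G where "G u = y u \<bullet> y u"
definition D where "D u = f u \<bullet> (x u \<times>\<^sub>3 y u)"

lemmas open_W = smooth_onD(1)[OF sX]

lemma sx: "smooth_on W x" and sy: "smooth_on W y"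
  by (intro smooth_on_dir_deriv sf sX sY)+

lemma sE: "smooth_on W E" and sB: "smooth_on W B" and sG: "smooth_on W G" and sD: "smooth_on W D"
proof -
  show "smooth_on W E" using smooth_on_inner[OF sx sx] by (simp add: E_def[abs_def])
  show "smooth_on W B" using smooth_on_inner[OF sx sy] by (simp add: B_def[abs_def])
  show "smooth_on W G" using smooth_on_inner[OF sy sy] by (simp add: G_def[abs_def])
  show "smooth_on W D" using smooth_on_inner[OF sf smooth_on_cross3[OF sx sy]] by (simp add: D_def[abs_def])
qed

lemma XY: "u \<in> W \<Longrightarrow> dir_deriv X y u = q u *\<^sub>R (f u \<times>\<^sub>3 x u) + (2 * m - p u) *\<^sub>R (f u \<times>\<^sub>3 y u) - B u *\<^sub>R f u"
  using dir_deriv_commute[OF sf sX sY _ commute] YX by (simp add: B_def)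

lemma perp:
  assumes u: "u \<in> W"
  shows "f u \<bullet> x u = 0" "f u \<bullet> y u = 0" "x u \<bullet> f u = 0" "y u \<bullet> f u = 0"
proof -
  have "dir_deriv Z (\<lambda>u. f u \<bullet> f u) u = 0" for Z
    using dir_deriv_cong[OF open_W u, of "\<lambda>u. f u \<bullet> f u" "\<lambda>u. 1" Z] unit by simp
  then have "f u \<bullet> dir_deriv Z f u = 0" for Z
    using dir_deriv_inner[OF sf sf u, of Z] by (simp add: inner_commute)
  then show "f u \<bullet> x u = 0" "f u \<bullet> y u = 0" "x u \<bullet> f u = 0" "y u \<bullet> f u = 0"
    by (simp_all add: inner_commute)
qed

lemma products:
  assumes u: "u \<in> W"
  shows "x u \<bullet> (f u \<times>\<^sub>3 y u) = - D u" "y u \<bullet> (f u \<times>\<^sub>3 x u) = D u"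
    "(f u \<times>\<^sub>3 y u) \<bullet> x u = - D u" "(f u \<times>\<^sub>3 x u) \<bullet> y u = D u"
    "x u \<bullet> (f u \<times>\<^sub>3 x u) = 0" "y u \<bullet> (f u \<times>\<^sub>3 y u) = 0"
    "(f u \<times>\<^sub>3 x u) \<bullet> x u = 0" "(f u \<times>\<^sub>3 y u) \<bullet> y u = 0"
    "(f u \<times>\<^sub>3 x u) \<bullet> (f u \<times>\<^sub>3 x u) = E u" "(f u \<times>\<^sub>3 y u) \<bullet> (f u \<times>\<^sub>3 y u) = G u"
    "(f u \<times>\<^sub>3 x u) \<bullet> (f u \<times>\<^sub>3 y u) = B u" "(f u \<times>\<^sub>3 y u) \<bullet> (f u \<times>\<^sub>3 x u) = B u"
    "f u \<bullet> (f u \<times>\<^sub>3 v) = 0" "(f u \<times>\<^sub>3 v) \<bullet> f u = 0"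
    "f u \<times>\<^sub>3 (f u \<times>\<^sub>3 x u) = - x u" "f u \<times>\<^sub>3 (f u \<times>\<^sub>3 y u) = - y u"
proof -
  show *: "x u \<bullet> (f u \<times>\<^sub>3 y u) = - D u" "y u \<bullet> (f u \<times>\<^sub>3 x u) = D u"
    unfolding D_def by (simp_all add: cross3_simps)
  show "(f u \<times>\<^sub>3 y u) \<bullet> x u = - D u" "(f u \<times>\<^sub>3 x u) \<bullet> y u = D u"
    using * by (simp_all add: inner_commute)
  show "(f u \<times>\<^sub>3 x u) \<bullet> (f u \<times>\<^sub>3 x u) = E u" "(f u \<times>\<^sub>3 y u) \<bullet> (f u \<times>\<^sub>3 y u) = G u"
    "(f u \<times>\<^sub>3 x u) \<bullet> (f u \<times>\<^sub>3 y u) = B u" "(f u \<times>\<^sub>3 y u) \<bullet> (f u \<times>\<^sub>3 x u) = B u"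
    by (simp_all add: inner_cross_unit unit[OF u] perp[OF u] E_def B_def G_def inner_commute)
  show "f u \<times>\<^sub>3 (f u \<times>\<^sub>3 x u) = - x u" "f u \<times>\<^sub>3 (f u \<times>\<^sub>3 y u) = - y u"
    by (simp_all add: cross_cross_unit unit[OF u] perp[OF u])
qed (simp_all add: dot_cross_self)

lemma cross_tangent:
  assumes u: "u \<in> W"
  shows "x u \<times>\<^sub>3 y u = D u *\<^sub>R f u"
proof -
  have "f u \<times>\<^sub>3 (x u \<times>\<^sub>3 y u) = 0" using perp[OF u] by (simp add: Lagrange)
  then have "0 = f u \<times>\<^sub>3 (f u \<times>\<^sub>3 (x u \<times>\<^sub>3 y u))" by simp
  also have "\<dots> = D u *\<^sub>R f u - x u \<times>\<^sub>3 y u" by (subst Lagrange) (simp add: D_def unit[OF u])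
  finally show "x u \<times>\<^sub>3 y u = D u *\<^sub>R f u" by simp
qed

lemma D_sq:
  assumes u: "u \<in> W"
  shows "(D u)\<^sup>2 = E u * G u - (B u)\<^sup>2"
proof -
  have "(x u \<times>\<^sub>3 y u) \<bullet> (x u \<times>\<^sub>3 y u) = (D u)\<^sup>2"
    by (simp add: cross_tangent[OF u] unit[OF u] power2_eq_square)
  then show ?thesis by (simp add: dot_cross E_def G_def B_def power2_eq_square inner_commute)
qed

text \<open>Products of x with f and with f \<times> x vanish, while <x, f \<times> y> = -D. So
  every derivative of \<open>E\<close>, and likewise of \<open>B\<close>, carries the factor
  \<open>D\<close>, and both are constant once \<open>D\<close> vanishes.\<close>

lemma deriv_E: "u \<in> W \<Longrightarrow> dir_deriv X E u = - 2 * q u * D u"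
  "u \<in> W \<Longrightarrow> dir_deriv Y E u = - 2 * (2 * m - p u) * D u"
  unfolding E_def[abs_def]
  by (simp_all add: dir_deriv_inner[OF sx sx] XX YX inner_left_distrib inner_right_distrib
      inner_diff_left inner_diff_right products perp) (simp add: algebra_simps)

lemma deriv_B: "u \<in> W \<Longrightarrow> dir_deriv X B u = (2 * p u - 2 * m) * D u"
  "u \<in> W \<Longrightarrow> dir_deriv Y B u = 2 * q u * D u"
  unfolding B_def[abs_def]
  by (simp_all add: dir_deriv_inner[OF sx sy] XX YX XY YY inner_left_distrib inner_right_distrib
      inner_diff_left inner_diff_right products perp) (simp_all add: algebra_simps)

text \<open>Rotation by f turns the area form into the metric, as \<open>t\<close> records; hence
  the derivatives of the Jacobian are linear in \<open>E\<close>, \<open>B\<close> and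
  \<open>G\<close>. Differentiating the factor f contributes x \<bullet> (x \<times> y) = 0 or its
  analogue for y.\<close>

lemma deriv_D:
  assumes u: "u \<in> W"
  shows "dir_deriv X D u = q u * (E u - G u) + (2 * m - 2 * p u) * B u"
    "dir_deriv Y D u = (2 * m - p u) * (E u - G u) - 2 * q u * B u"
proof -
  have t: "f u \<bullet> ((f u \<times>\<^sub>3 a) \<times>\<^sub>3 b) = - (a \<bullet> b)" "f u \<bullet> (b \<times>\<^sub>3 (f u \<times>\<^sub>3 a)) = a \<bullet> b"
    if "f u \<bullet> b = 0" for a b
  proof -
    show *: "f u \<bullet> (b \<times>\<^sub>3 (f u \<times>\<^sub>3 a)) = a \<bullet> b"
      using that unit[OF u] by (simp add: Lagrange inner_diff_right inner_commute)
    then show "f u \<bullet> ((f u \<times>\<^sub>3 a) \<times>\<^sub>3 b) = - (a \<bullet> b)"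
      by (subst cross_skew) simp
  qed
  have dd: "dir_deriv Z D u = dir_deriv Z f u \<bullet> (x u \<times>\<^sub>3 y u)
      + f u \<bullet> (dir_deriv Z x u \<times>\<^sub>3 y u) + f u \<bullet> (x u \<times>\<^sub>3 dir_deriv Z y u)" for Z
    unfolding D_def[abs_def]
    by (simp add: dir_deriv_inner[OF sf smooth_on_cross3[OF sx sy] u] dir_deriv_cross3[OF sx sy u]
        inner_right_distrib)
  show "dir_deriv X D u = q u * (E u - G u) + (2 * m - 2 * p u) * B u"
    by (simp add: dd XX[OF u] XY[OF u] cross_add_left cross_add_right cross_mult_left cross_mult_right
        inner_right_distrib inner_diff_right Cross3.left_diff_distrib Cross3.right_diff_distrib
        t perp[OF u] dot_cross_self E_def[symmetric] B_def[symmetric] G_def[symmetric]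
        inner_commute[of "y u" "x u"] algebra_simps)
  show "dir_deriv Y D u = (2 * m - p u) * (E u - G u) - 2 * q u * B u"
    by (simp add: dd YX[OF u] YY[OF u] cross_add_left cross_add_right cross_mult_left cross_mult_right
        inner_right_distrib inner_diff_right Cross3.left_diff_distrib Cross3.right_diff_distrib
        t perp[OF u] dot_cross_self E_def[symmetric] B_def[symmetric] G_def[symmetric]
        inner_commute[of "y u" "x u"] algebra_simps)
qed

lemma deriv_combination:
  assumes u: "u \<in> W" and s: "smooth_on W a" "smooth_on W b" "smooth_on W c"
  shows "dir_deriv Z (\<lambda>u. a u *\<^sub>R (f u \<times>\<^sub>3 x u) + b u *\<^sub>R (f u \<times>\<^sub>3 y u) - c u *\<^sub>R f u) u =
    dir_deriv Z a u *\<^sub>R (f u \<times>\<^sub>3 x u) + a u *\<^sub>R (dir_deriv Z f u \<times>\<^sub>3 x u + f u \<times>\<^sub>3 dir_deriv Z x u)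
    + (dir_deriv Z b u *\<^sub>R (f u \<times>\<^sub>3 y u) + b u *\<^sub>R (dir_deriv Z f u \<times>\<^sub>3 y u + f u \<times>\<^sub>3 dir_deriv Z y u))
    - (dir_deriv Z c u *\<^sub>R f u + c u *\<^sub>R dir_deriv Z f u)"
  by (simp add: dir_deriv_diff[OF _ _ u] dir_deriv_add[OF _ _ u] dir_deriv_scaleR[OF _ _ u]
      dir_deriv_cross3[OF _ _ u] smooth_on_add smooth_on_scaleR smooth_on_cross3 s sf sx sy add.commute)

text \<open>The fields commute, so x has equal mixed second derivatives along them. Both sides are
  written out by the structure equations and paired with y, f \<times> x and f \<times> y. Since x
  and y may be dependent, no single pairing captures the whole identity.\<close>

lemma integrability:
  assumes u: "u \<in> W"
  shows "(dir_deriv Y p u - dir_deriv X q u) * D u + (B u)\<^sup>2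
      + ((2 * m - p u) * (2 * m - 2 * p u) + 2 * (q u)\<^sup>2 - E u) * G u = 0"
    "(dir_deriv Y p u - dir_deriv X q u) * E u + (dir_deriv Y q u + dir_deriv X p u) * B u
      + ((2 * m - p u) * (2 * m - 2 * p u) + 2 * (q u)\<^sup>2 - E u) * D u = 0"
    "(dir_deriv Y p u - dir_deriv X q u) * B u + (dir_deriv Y q u + dir_deriv X p u) * G u - B u * D u = 0"
proof -
  have sr: "smooth_on W (\<lambda>u. 2 * m - p u)" by (intro smooth_on_diff smooth_on_const open_W sp)
  have dr: "dir_deriv X (\<lambda>u. 2 * m - p u) u = - dir_deriv X p u"
    using dir_deriv_diff[OF smooth_on_const[OF open_W] sp u, of X "2 * m"] by simp
  have "dir_deriv Y (dir_deriv X x) u = dir_deriv X (dir_deriv Y x) u"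
    using dir_deriv_commute[OF sx sX sY u commute[OF u]] by simp
  moreover have "dir_deriv Y (dir_deriv X x) u =
      dir_deriv Y (\<lambda>u. p u *\<^sub>R (f u \<times>\<^sub>3 x u) + q u *\<^sub>R (f u \<times>\<^sub>3 y u) - E u *\<^sub>R f u) u"
    by (rule dir_deriv_cong[OF open_W u]) (simp add: XX E_def)
  moreover have "dir_deriv X (dir_deriv Y x) u =
      dir_deriv X (\<lambda>u. q u *\<^sub>R (f u \<times>\<^sub>3 x u) + (2 * m - p u) *\<^sub>R (f u \<times>\<^sub>3 y u) - B u *\<^sub>R f u) u"
    by (rule dir_deriv_cong[OF open_W u]) (simp add: YX B_def)
  ultimately have eq: "dir_deriv Y p u *\<^sub>R (f u \<times>\<^sub>3 x u) + p u *\<^sub>R (y u \<times>\<^sub>3 x u + f u \<times>\<^sub>3 dir_deriv Y x u)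
      + (dir_deriv Y q u *\<^sub>R (f u \<times>\<^sub>3 y u) + q u *\<^sub>R (f u \<times>\<^sub>3 dir_deriv Y y u))
      - (dir_deriv Y E u *\<^sub>R f u + E u *\<^sub>R y u)
    = dir_deriv X q u *\<^sub>R (f u \<times>\<^sub>3 x u) + q u *\<^sub>R (f u \<times>\<^sub>3 dir_deriv X x u)
      + (- dir_deriv X p u *\<^sub>R (f u \<times>\<^sub>3 y u) + (2 * m - p u) *\<^sub>R (x u \<times>\<^sub>3 y u + f u \<times>\<^sub>3 dir_deriv X y u))
      - (dir_deriv X B u *\<^sub>R f u + B u *\<^sub>R x u)" (is "?L = ?R")
    by (simp add: deriv_combination[OF u sp sq sE] deriv_combination[OF u sq sr sB] dr)
  have z: "(y u \<times>\<^sub>3 x u) \<bullet> v = 0" "(x u \<times>\<^sub>3 y u) \<bullet> v = 0" if "f u \<bullet> v = 0" for v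
    using triple_product_tangent[OF unit[OF u]] perp[OF u] that by auto
  have eqv: "?L \<bullet> v = ?R \<bullet> v" for v using eq by simp
  note simps = XX[OF u] YX[OF u] XY[OF u] YY[OF u] cross_add_right cross_mult_right
    Cross3.right_diff_distrib inner_left_distrib inner_diff_left products[OF u] perp[OF u] z
    E_def[of u, symmetric] B_def[of u, symmetric] G_def[of u, symmetric] inner_commute[of "y u" "x u"]
  show "(dir_deriv Y p u - dir_deriv X q u) * D u + (B u)\<^sup>2
      + ((2 * m - p u) * (2 * m - 2 * p u) + 2 * (q u)\<^sup>2 - E u) * G u = 0"
    using eqv[of "y u"] by (simp add: simps) (simp add: power2_eq_square algebra_simps)
  show "(dir_deriv Y p u - dir_deriv X q u) * E u + (dir_deriv Y q u + dir_deriv X p u) * B u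
      + ((2 * m - p u) * (2 * m - 2 * p u) + 2 * (q u)\<^sup>2 - E u) * D u = 0"
    using eqv[of "f u \<times>\<^sub>3 x u"] by (simp add: simps) (simp add: power2_eq_square algebra_simps)
  show "(dir_deriv Y p u - dir_deriv X q u) * B u + (dir_deriv Y q u + dir_deriv X p u) * G u - B u * D u = 0"
    using eqv[of "f u \<times>\<^sub>3 y u"] by (simp add: simps) (simp add: power2_eq_square algebra_simps)
qed

end

section \<open>The two projections and the relations between them\<close>

context parallel_frame
begin

text \<open>J acts factor by factor, so the frame equations project to each sphere with the same
  coefficients \<open>p\<close> and \<open>q\<close>.\<close>

lemma fst_factor: "sphere_factor W X Y p q m (\<lambda>u. fst (F u))"
  and snd_factor: "sphere_factor W X Y p q m (\<lambda>u. snd (F u))"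
proof -
  have d: "dir_deriv Z (\<lambda>u. fst (F u)) u = fst (dir_deriv Z F u)"
    "dir_deriv Z (\<lambda>u. snd (F u)) u = snd (dir_deriv Z F u)" if "u \<in> W" for Z u
    using dir_deriv_fst[OF smooth_F that] dir_deriv_snd[OF smooth_F that] by auto
  have dd: "dir_deriv Z (dir_deriv V (\<lambda>u. fst (F u))) u = fst (dir_deriv Z (dir_deriv V F) u)"
    "dir_deriv Z (dir_deriv V (\<lambda>u. snd (F u))) u = snd (dir_deriv Z (dir_deriv V F) u)"
    if "u \<in> W" "smooth_on W V" for Z V u
  proof -
    have s: "smooth_on W (dir_deriv V F)" by (rule smooth_on_dir_deriv[OF smooth_F that(2)])
    show "dir_deriv Z (dir_deriv V (\<lambda>u. fst (F u))) u = fst (dir_deriv Z (dir_deriv V F) u)"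
      "dir_deriv Z (dir_deriv V (\<lambda>u. snd (F u))) u = snd (dir_deriv Z (dir_deriv V F) u)"
      using dir_deriv_cong[OF open_W that(1) d(1), where X = Z] dir_deriv_cong[OF open_W that(1) d(2), where X = Z]
        dir_deriv_fst[OF s that(1)] dir_deriv_snd[OF s that(1)] by auto
  qed
  have exp: "dir_deriv X e u = p u *\<^sub>R JJ (F u) (e u) + q u *\<^sub>R JJ (F u) (e' u)
      - (fst (e u) \<bullet> fst (e u)) *\<^sub>R (fst (F u), 0) - (snd (e u) \<bullet> snd (e u)) *\<^sub>R (0, snd (F u))"
    "dir_deriv Y e u = q u *\<^sub>R JJ (F u) (e u) + (2 * m - p u) *\<^sub>R JJ (F u) (e' u)
      - (fst (e u) \<bullet> fst (e' u)) *\<^sub>R (fst (F u), 0) - (snd (e u) \<bullet> snd (e' u)) *\<^sub>R (0, snd (F u))"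
    "dir_deriv Y e' u = (2 * m - p u) *\<^sub>R JJ (F u) (e u) + (- q u) *\<^sub>R JJ (F u) (e' u)
      - (fst (e' u) \<bullet> fst (e' u)) *\<^sub>R (fst (F u), 0) - (snd (e' u) \<bullet> snd (e' u)) *\<^sub>R (0, snd (F u))"
    if u: "u \<in> W" for u
    using frame_derivative_expand[OF u, of e X] frame_derivative_expand[OF u, of e Y]
      frame_derivative_expand[OF u, of e' Y] shape_coefficients[OF u] p_def[of u] q_def[of u]
    by (simp_all del: scaleR_Pair add: e_def[symmetric] e'_def[symmetric])
  show "sphere_factor W X Y p q m (\<lambda>u. fst (F u))"
    by unfold_locales
      (use F_S2xS2 in \<open>simp_all add: smooth_X smooth_Y smooth_p smooth_q smooth_on_fst smooth_F frame_commute
        mem_S2xS2 dd d exp e_def[symmetric] e'_def[symmetric] JJ_def\<close>)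
  show "sphere_factor W X Y p q m (\<lambda>u. snd (F u))"
    by unfold_locales
      (use F_S2xS2 in \<open>simp_all add: smooth_X smooth_Y smooth_p smooth_q smooth_on_snd smooth_F frame_commute
        mem_S2xS2 dd d exp e_def[symmetric] e'_def[symmetric] JJ_def\<close>)
qed

sublocale P: sphere_factor W X Y p q m "\<lambda>u. fst (F u)" by (rule fst_factor)
sublocale Q: sphere_factor W X Y p q m "\<lambda>u. snd (F u)" by (rule snd_factor)

text \<open>Orthonormality of the frame makes the two pulled-back metrics add up to the identity,
  and the Lagrangian condition makes the Jacobians cancel. Equal squared Jacobians then give EG = (1
  - E)(1 - G), that is E + G = 1.\<close>

lemma factor_relations:
  assumes u: "u \<in> W"
  shows "Q.E u = 1 - P.E u" "P.G u = 1 - P.E u" "Q.G u = P.E u" "Q.B u = - P.B u" "Q.D u = - P.D u"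
proof -
  have d: "dir_deriv Z (\<lambda>u. fst (F u)) u = fst (dir_deriv Z F u)"
    "dir_deriv Z (\<lambda>u. snd (F u)) u = snd (dir_deriv Z F u)" for Z
    using dir_deriv_fst[OF smooth_F u] dir_deriv_snd[OF smooth_F u] by auto
  show 1: "Q.E u = 1 - P.E u" and 3: "Q.B u = - P.B u"
    using e_inner[OF u] by (auto simp: P.E_def Q.E_def P.B_def Q.B_def d e_def e'_def inner_prod_def)
  have 2: "Q.G u = 1 - P.G u"
    using e_inner[OF u] by (auto simp: P.G_def Q.G_def d e_def e'_def inner_prod_def)
  show 4: "Q.D u = - P.D u"
    using e_lagrange[of e e', OF _ _ u] P.products(4)[OF u] Q.products(4)[OF u]
    by (simp add: d e_def e'_def inner_prod_def JJ_def)
  have "P.E u * P.G u = (1 - P.E u) * (1 - P.G u)"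
    using P.D_sq[OF u] Q.D_sq[OF u] by (simp add: 1 2 3 4)
  then show 5: "P.G u = 1 - P.E u" by (simp add: algebra_simps)
  then show "Q.G u = P.E u" using 2 by simp
qed

text \<open>The integrability equations of the two factors are added. In the first the derivative
  terms cancel and leave the Gauss equation; in the other two the coefficients of the derivatives
  sum to 1 or to 0, which isolates the Codazzi equations without any division.\<close>

lemma gauss_codazzi:
  assumes u: "u \<in> W"
  shows "(p u - 3 / 2 * m)\<^sup>2 + (q u)\<^sup>2 = m\<^sup>2 / 4 + (P.D u)\<^sup>2"
    "dir_deriv Y p u = dir_deriv X q u + (2 * P.E u - 1) * P.D u"
    "dir_deriv X p u = - dir_deriv Y q u + 2 * P.B u * P.D u"
proof -
  note r = factor_relations[OF u] and DD = P.D_sq[OF u]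
  have "2 * (P.B u)\<^sup>2 + ((2 * m - p u) * (2 * m - 2 * p u) + 2 * (q u)\<^sup>2)
      - 2 * P.E u * (1 - P.E u) = 0"
    using P.integrability(1)[OF u] Q.integrability(1)[OF u] unfolding r
    by (simp add: algebra_simps power2_eq_square)
  then show "(p u - 3 / 2 * m)\<^sup>2 + (q u)\<^sup>2 = m\<^sup>2 / 4 + (P.D u)\<^sup>2"
    unfolding DD r by (simp add: field_simps power2_eq_square)
  show "dir_deriv Y p u = dir_deriv X q u + (2 * P.E u - 1) * P.D u"
    using P.integrability(2)[OF u] Q.integrability(2)[OF u] unfolding r
    by (simp add: algebra_simps power2_eq_square)
  show "dir_deriv X p u = - dir_deriv Y q u + 2 * P.B u * P.D u"
    using P.integrability(3)[OF u] Q.integrability(3)[OF u] unfolding r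
    by (simp add: algebra_simps power2_eq_square)
qed

end

subsection \<open>The Jacobian of the projections\<close>

context parallel_frame
begin

text \<open>Criticality alone suffices: at such a point with D \<noteq> 0 the second derivatives of
  \<open>D\<close> are explicit, and they contradict the Gauss equation differentiated
  twice.\<close>

lemma jacobian_critical_point:
  assumes u: "u \<in> W" and crit: "dir_deriv X P.D u = 0" "dir_deriv Y P.D u = 0"
  shows "P.D u = 0"
proof (rule ccontr)
  assume D0: "P.D u \<noteq> 0"
  let ?S = "(p u - 3 / 2 * m)\<^sup>2 + (q u)\<^sup>2"
  note GE = factor_relations(2)
  have dDX: "dir_deriv X P.D x = q x * (2 * P.E x - 1) + (2 * m - 2 * p x) * P.B x" if "x \<in> W" for x
    using P.deriv_D(1)[OF that] GE[OF that] by (simp add: algebra_simps)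
  have dDY: "dir_deriv Y P.D x = (2 * m - p x) * (2 * P.E x - 1) - 2 * (q x * P.B x)" if "x \<in> W" for x
    using P.deriv_D(2)[OF that] GE[OF that] by (simp add: algebra_simps)
  note cX = dDX[OF u, unfolded crit] and cY = dDY[OF u, unfolded crit]
  have gauss: "(q u)\<^sup>2 + (m - p u) * (2 * m - p u) = (P.D u)\<^sup>2"
    using gauss_codazzi(1)[OF u] by (simp add: power2_eq_square field_simps)
  \<comment> \<open>The two criticality equations are linear in 2E - 1 and 2B, and by the Gauss
    equation the determinant of the system is -D^2. This combination and the next one are Cramer's
    rule.\<close>
  have "(P.D u)\<^sup>2 * (2 * P.E u - 1) = q u * (q u * (2 * P.E u - 1) + (2 * m - 2 * p u) * P.B u)
      + (m - p u) * ((2 * m - p u) * (2 * P.E u - 1) - 2 * (q u * P.B u))"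
    unfolding gauss[symmetric] by (simp add: power2_eq_square algebra_simps)
  then have "(P.D u)\<^sup>2 * (2 * P.E u - 1) = 0" using cX cY by simp
  then have c0: "2 * P.E u - 1 = 0" using D0 by simp
  have "(P.D u)\<^sup>2 * (2 * P.B u) = (2 * m - p u) * (q u * (2 * P.E u - 1) + (2 * m - 2 * p u) * P.B u)
      - q u * ((2 * m - p u) * (2 * P.E u - 1) - 2 * (q u * P.B u))"
    unfolding gauss[symmetric] by (simp add: power2_eq_square algebra_simps)
  then have "(P.D u)\<^sup>2 * (2 * P.B u) = 0" using cX cY by simp
  then have B0: "P.B u = 0" using D0 by simp
  have sm: "smooth_on W P.E" "smooth_on W P.B" "smooth_on W P.D" "smooth_on W p" "smooth_on W q"
    "smooth_on W (\<lambda>x. c)" for c :: real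
    using P.sE P.sB P.sD smooth_p smooth_q smooth_on_const[OF open_W] by auto
  note sm' = sm smooth_on_dir_deriv[OF _ smooth_X] smooth_on_dir_deriv[OF _ smooth_Y]
    smooth_on_mult smooth_on_add smooth_on_diff smooth_on_minus
  note dr = dir_deriv_mult[where W = W, OF _ _ u] dir_deriv_add[where W = W, OF _ _ u]
    dir_deriv_diff[where W = W, OF _ _ u]
    dir_deriv_bounded_linear[where W = W, OF _ u bounded_linear_minus[OF bounded_linear_ident]]
  \<comment> \<open>Derivatives of \<open>p\<close> and \<open>q\<close> enter only with the factors
    2E - 1 and B, which vanish at \<open>u\<close>.\<close>
  have DXX: "dir_deriv X (dir_deriv X P.D) u = - 4 * (q u)\<^sup>2 * P.D u - 4 * (m - p u)\<^sup>2 * P.D u"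
    using dir_deriv_cong[OF open_W u dDX, where X = X] c0 B0
    by (simp add: sm' dr P.deriv_E[OF u] P.deriv_B[OF u] power2_eq_square algebra_simps)
  have DYY: "dir_deriv Y (dir_deriv Y P.D) u = - 4 * (2 * m - p u)\<^sup>2 * P.D u - 4 * (q u)\<^sup>2 * P.D u"
    using dir_deriv_cong[OF open_W u dDY, where X = Y] c0 B0
    by (simp add: sm' dr P.deriv_E[OF u] P.deriv_B[OF u] power2_eq_square algebra_simps)
  \<comment> \<open>The Codazzi equations are differentiated once more. In the sum the mixed
    derivatives of \<open>q\<close> cancel because the fields commute, and the remaining terms 4(p -
    m) - 4(2m - p) produce the constant 3m/2.\<close>
  have "dir_deriv X (dir_deriv X p) u = - dir_deriv X (dir_deriv Y q) u + 4 * (p u - m) * (P.D u)\<^sup>2"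
    using dir_deriv_cong[OF open_W u gauss_codazzi(3), where X = X] B0
    by (simp add: sm' dr P.deriv_B[OF u] power2_eq_square algebra_simps)
  moreover have "dir_deriv Y (dir_deriv Y p) u = dir_deriv Y (dir_deriv X q) u - 4 * (2 * m - p u) * (P.D u)\<^sup>2"
    using dir_deriv_cong[OF open_W u gauss_codazzi(2), where X = Y] c0
    by (simp add: sm' dr P.deriv_E[OF u] power2_eq_square algebra_simps)
  moreover have "dir_deriv X (dir_deriv Y g) u = dir_deriv Y (dir_deriv X g) u" if "smooth_on W g" for g :: "real^2 \<Rightarrow> real"
    using dir_deriv_commute[OF that smooth_X smooth_Y u frame_commute(1)[OF u]] .
  note comm = this[OF smooth_p] this[OF smooth_q]
  ultimately have lap_p: "dir_deriv X (dir_deriv X p) u + dir_deriv Y (dir_deriv Y p) u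
      = 8 * (p u - 3 / 2 * m) * (P.D u)\<^sup>2"
    by (simp add: algebra_simps)
  have qX: "dir_deriv X q x = dir_deriv Y p x - (2 * P.E x - 1) * P.D x" if "x \<in> W" for x
    using gauss_codazzi(2)[OF that] by simp
  have qY: "dir_deriv Y q x = 2 * P.B x * P.D x - dir_deriv X p x" if "x \<in> W" for x
    using gauss_codazzi(3)[OF that] by simp
  have "dir_deriv X (dir_deriv X q) u = dir_deriv X (dir_deriv Y p) u + 4 * q u * (P.D u)\<^sup>2"
    using dir_deriv_cong[OF open_W u qX, where X = X] c0
    by (simp add: sm' dr P.deriv_E[OF u] power2_eq_square algebra_simps)
  moreover have "dir_deriv Y (dir_deriv Y q) u = 4 * q u * (P.D u)\<^sup>2 - dir_deriv Y (dir_deriv X p) u"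
    using dir_deriv_cong[OF open_W u qY, where X = Y] B0
    by (simp add: sm' dr P.deriv_B[OF u] power2_eq_square algebra_simps)
  ultimately have lap_q: "dir_deriv X (dir_deriv X q) u + dir_deriv Y (dir_deriv Y q) u = 8 * q u * (P.D u)\<^sup>2"
    using comm by simp
  have g: "(p x - 3 / 2 * m) * (p x - 3 / 2 * m) + q x * q x = m\<^sup>2 / 4 + P.D x * P.D x" if "x \<in> W" for x
    using gauss_codazzi(1)[OF that] by (simp add: power2_eq_square)
  have first: "(p x - 3 / 2 * m) * dir_deriv Z p x + q x * dir_deriv Z q x = P.D x * dir_deriv Z P.D x"
    if x: "x \<in> W" for x Z
    using dir_deriv_cong[OF open_W x, of "\<lambda>x. (p x - 3 / 2 * m) * (p x - 3 / 2 * m) + q x * q x"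
        "\<lambda>x. m\<^sup>2 / 4 + P.D x * P.D x" Z] g
    by (simp add: sm' dir_deriv_mult[where W = W, OF _ _ x] dir_deriv_add[where W = W, OF _ _ x]
        dir_deriv_diff[where W = W, OF _ _ x])
      (linarith | (simp add: mult.commute, linarith) | (simp add: algebra_simps))
  have second: "(dir_deriv Z p u)\<^sup>2 + (dir_deriv Z q u)\<^sup>2 + (p u - 3 / 2 * m) * dir_deriv Z (dir_deriv Z p) u
      + q u * dir_deriv Z (dir_deriv Z q) u = P.D u * dir_deriv Z (dir_deriv Z P.D) u"
    if Z: "Z \<in> {X, Y}" for Z
  proof -
    have s: "smooth_on W (dir_deriv Z p)" "smooth_on W (dir_deriv Z q)" "smooth_on W (dir_deriv Z P.D)"
      using Z by (auto intro: sm')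
    have "dir_deriv Z (\<lambda>x. (p x - 3 / 2 * m) * dir_deriv Z p x + q x * dir_deriv Z q x) u
        = dir_deriv Z (\<lambda>x. P.D x * dir_deriv Z P.D x) u"
      by (rule dir_deriv_cong[OF open_W u]) (rule first)
    moreover have "dir_deriv Z P.D u = 0" using Z crit by auto
    ultimately show ?thesis
      by (simp add: sm' s dr) (simp add: power2_eq_square algebra_simps)
  qed
  let ?grad = "(dir_deriv X p u)\<^sup>2 + (dir_deriv X q u)\<^sup>2 + (dir_deriv Y p u)\<^sup>2 + (dir_deriv Y q u)\<^sup>2"
  have "?grad + ((p u - 3 / 2 * m) * (dir_deriv X (dir_deriv X p) u + dir_deriv Y (dir_deriv Y p) u)
      + q u * (dir_deriv X (dir_deriv X q) u + dir_deriv Y (dir_deriv Y q) u))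
      = P.D u * (dir_deriv X (dir_deriv X P.D) u + dir_deriv Y (dir_deriv Y P.D) u)"
    using second[of X] second[of Y] by (simp add: algebra_simps)
  \<comment> \<open>The left side is half the Laplacian of |\<theta>|^2, the right side half that of
    D^2 at a critical point of \<open>D\<close>; these functions differ by a constant.\<close>
  then have "?grad + 8 * (P.D u)\<^sup>2 * ?S =
      - (4 * (P.D u)\<^sup>2 * (2 * (q u)\<^sup>2 + (m - p u)\<^sup>2 + (2 * m - p u)\<^sup>2))"
    unfolding lap_p lap_q DXX DYY by (simp add: power2_eq_square algebra_simps)
  then have "8 * (P.D u)\<^sup>2 * ?S \<le> 0"
    by (smt (verit) mult_nonneg_nonneg zero_le_power2)
  moreover have "?S > 0" using gauss_codazzi(1)[OF u] m_pos by (simp add: add_pos_nonneg)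
  ultimately show False using D0 by (simp add: mult_le_0_iff)
qed

lemma frame_spans:
  assumes u: "u \<in> W"
  obtains a b where "v = a *\<^sub>R X u + b *\<^sub>R Y u"
proof -
  interpret dF: linear "dd F u" by (rule linear_dd[OF u])
  let ?a = "dd F u v \<bullet> dd F u (X u)" and ?b = "dd F u v \<bullet> dd F u (Y u)"
  have "dd F u v = dd F u (?a *\<^sub>R X u + ?b *\<^sub>R Y u)"
    using dd_expand[OF u on[OF u], of v] by (simp add: dF.add dF.scale)
  then have "v = ?a *\<^sub>R X u + ?b *\<^sub>R Y u" using immersed[OF u] injD by metis
  then show thesis by (rule that)
qed

text \<open>When \<open>D\<close> vanishes identically, (c, s) = (2E - 1, 2B) lies on the unit
  circle, and the vanishing derivatives of \<open>D\<close> are linear equations for \<theta>. Their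
  solution is \<theta> = (m/2)(c + is)^2.\<close>

lemma flat_coefficients:
  assumes D0: "\<And>u. u \<in> W \<Longrightarrow> P.D u = 0" and u: "u \<in> W"
  shows "p u = m * (1 + (2 * P.E u - 1)\<^sup>2)" "q u = m * (2 * P.E u - 1) * (2 * P.B u)"
proof -
  define c s t where "c = 2 * P.E u - 1" and "s = 2 * P.B u" and "t = p u - 3 / 2 * m"
  have "dir_deriv Z P.D u = 0" for Z
    using dir_deriv_cong[OF open_W u D0, where X = Z] by simp
  then have 1: "q u * c = (t + m / 2) * s" and 2: "(m / 2 - t) * c = q u * s"
    using P.deriv_D[OF u] factor_relations(2)[OF u] by (simp_all add: c_def s_def t_def field_simps)
  have cs: "c\<^sup>2 + s\<^sup>2 = 1"
    using P.D_sq[OF u] D0[OF u] factor_relations(2)[OF u]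
    by (simp add: c_def s_def power2_eq_square algebra_simps)
  have "t = t * (c\<^sup>2 + s\<^sup>2)" using cs by simp
  also have "\<dots> = m / 2 * (c\<^sup>2 - s\<^sup>2) - c * ((m / 2 - t) * c) + s * ((t + m / 2) * s)"
    by (simp add: power2_eq_square algebra_simps)
  also have "\<dots> = m / 2 * (c\<^sup>2 - s\<^sup>2)" unfolding 2 1[symmetric] by simp
  also have "\<dots> = m * c\<^sup>2 - m / 2" using cs by (simp add: field_simps) (metis distrib_left mult.right_neutral)
  finally show "p u = m * (1 + (2 * P.E u - 1)\<^sup>2)"
    by (simp add: t_def c_def algebra_simps)
  have "q u = q u * (c\<^sup>2 + s\<^sup>2)" using cs by simp
  also have "\<dots> = c * (q u * c) + s * (q u * s)" by (simp add: power2_eq_square algebra_simps)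
  also have "\<dots> = m * c * s" unfolding 1 2[symmetric] by (simp add: algebra_simps)
  finally show "q u = m * (2 * P.E u - 1) * (2 * P.B u)" by (simp add: c_def s_def)
qed

end

subsection \<open>Factors with vanishing Jacobian lie in circles\<close>

lemma perp_expand:
  fixes f a n :: "real^3"
  assumes "f \<bullet> f = 1" "f \<bullet> a = 0" "a \<bullet> a \<noteq> 0" "n \<bullet> a = 0"
  shows "n = (n \<bullet> f) *\<^sub>R f + (n \<bullet> (f \<times>\<^sub>3 a) / (a \<bullet> a)) *\<^sub>R (f \<times>\<^sub>3 a)"
proof -
  let ?b = "f \<times>\<^sub>3 a" and ?l = "sqrt (a \<bullet> a)"
  have pos: "a \<bullet> a > 0" using assms(3) inner_ge_zero[of a] by linarith
  have bb: "?b \<bullet> ?b = a \<bullet> a" using assms by (simp add: inner_cross_unit)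
  have ss: "?l * ?l = a \<bullet> a" using pos by simp
  let ?v = "\<lambda>i::nat. [f, (1 / ?l) *\<^sub>R a, (1 / ?l) *\<^sub>R ?b] ! i"
  have I: "{0..<3::nat} = {0,1,2}" by auto
  have "n = (\<Sum>i\<in>{0..<3::nat}. (n \<bullet> ?v i) *\<^sub>R ?v i)"
  proof (rule orthonormal_family_expand)
    fix i j :: nat
    assume "i \<in> {0..<3}" "j \<in> {0..<3}"
    then show "?v i \<bullet> ?v j = (if i = j then 1 else 0)"
      unfolding I using pos
      by (elim insertE emptyE; simp add: assms dot_cross_self bb inner_commute[of a f] ss field_simps)
  qed simp_all
  also have "\<dots> = (n \<bullet> f) *\<^sub>R f + (n \<bullet> ?b / (?l * ?l)) *\<^sub>R ?b"
    unfolding I using assms(4) by simp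
  finally show ?thesis unfolding ss .
qed

context sphere_factor
begin

lemma frame_constant:
  assumes span: "\<And>u v. u \<in> W \<Longrightarrow> \<exists>a b. v = a *\<^sub>R X u + b *\<^sub>R Y u"
    and W: "convex W" "u0 \<in> W"
  assumes g: "smooth_on W g" "\<And>u. u \<in> W \<Longrightarrow> dir_deriv X g u = 0"
      "\<And>u. u \<in> W \<Longrightarrow> dir_deriv Y g u = 0" and u: "u \<in> W"
  shows "g u = g u0"
proof (rule dir_deriv_zero_imp_constant[OF g(1) W(1) _ u W(2)])
  fix u v assume u: "u \<in> W"
  interpret linear "frechet_derivative g (at u)" using linear_frechet_derivative smooth_onD(4)[OF g(1) u] .
  obtain a b where "v = a *\<^sub>R X u + b *\<^sub>R Y u" using span[OF u] by blast
  then show "frechet_derivative g (at u) v = 0" using g(2,3)[OF u] by (simp add: add scale dir_deriv_def)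
qed

text \<open>The axis of the circle is \<open>2mE f + f \<times> x\<close>, or \<open>f \<times> y\<close> if \<open>E = 0\<close>: the structure equations make
  these vectors constant when \<open>D = 0\<close>.\<close>

lemma factor_in_circle:
  assumes D0: "\<And>u. u \<in> W \<Longrightarrow> D u = 0" and EG: "\<And>u. u \<in> W \<Longrightarrow> G u = 1 - E u"
    and p: "\<And>u. u \<in> W \<Longrightarrow> p u = m * (1 + (2 * E u - 1)\<^sup>2)"
    and q: "\<And>u. u \<in> W \<Longrightarrow> q u = m * (2 * E u - 1) * (2 * B u)"
    and span: "\<And>u v. u \<in> W \<Longrightarrow> \<exists>a b. v = a *\<^sub>R X u + b *\<^sub>R Y u"
    and W: "convex W" "u0 \<in> W" and m: "m > 0"
  shows "\<exists>N k. norm N = 1 \<and> (\<forall>u\<in>W. f u \<bullet> N = k) \<and> \<bar>k\<bar> < 1 \<and> (k = 0 \<longleftrightarrow> E u0 = 0) \<and>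
    (\<forall>V N' k'. open V \<and> V \<subseteq> W \<and> V \<noteq> {} \<and> norm N' = 1 \<and> (\<forall>u\<in>V. f u \<bullet> N' = k') \<longrightarrow> N' = N \<or> N' = - N)"
proof -
  note const = frame_constant[OF _ W, rotated, OF _ _ _ _ span]
  have E: "E u = E u0" and B: "B u = B u0" if "u \<in> W" for u
    using const[OF sE _ _ that] const[OF sB _ _ that] by (simp_all add: deriv_E deriv_B D0)
  have BB: "B u * B u = E u * (1 - E u)" if "u \<in> W" for u
    using D_sq[OF that] D0[OF that] EG[OF that] by (simp add: power2_eq_square)
  \<comment> \<open>D = 0 is the equality case of the Cauchy-Schwarz inequality. The proportionality
    of x and y is written without division because either vector may be zero.\<close>
  have Ey: "E u *\<^sub>R y u = B u *\<^sub>R x u" and Gx: "G u *\<^sub>R x u = B u *\<^sub>R y u" if u: "u \<in> W" for u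
  proof -
    have "(E u *\<^sub>R y u - B u *\<^sub>R x u) \<bullet> (E u *\<^sub>R y u - B u *\<^sub>R x u) = E u * (E u * G u - B u * B u)"
      unfolding E_def B_def G_def by (simp add: inner_diff_left inner_diff_right inner_commute algebra_simps)
    then show "E u *\<^sub>R y u = B u *\<^sub>R x u" using BB[OF u] EG[OF u] by simp
    have "(G u *\<^sub>R x u - B u *\<^sub>R y u) \<bullet> (G u *\<^sub>R x u - B u *\<^sub>R y u) = G u * (E u * G u - B u * B u)"
      unfolding E_def B_def G_def by (simp add: inner_diff_left inner_diff_right inner_commute algebra_simps)
    then show "G u *\<^sub>R x u = B u *\<^sub>R y u" using BB[OF u] EG[OF u] by simp
  qed
  \<comment> \<open>Because x and y are proportional, the special values of \<open>p\<close> and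
    \<open>q\<close> collapse the rotated parts of the structure equations to multiples of x or y
    with constant coefficients, those of \<open>f\<close> in the axis vectors.\<close>
  have pq: "p u *\<^sub>R x u + q u *\<^sub>R y u = (2 * m * E u) *\<^sub>R x u"
    "q u *\<^sub>R x u + (2 * m - p u) *\<^sub>R y u = (2 * m * B u) *\<^sub>R x u"
    "q u *\<^sub>R x u + (2 * m - p u) *\<^sub>R y u = (2 * m * E u) *\<^sub>R y u"
    "(2 * m - p u) *\<^sub>R x u + (- q u) *\<^sub>R y u = (2 * m * B u) *\<^sub>R y u" if u: "u \<in> W" for u
  proof -
    have By: "B u *\<^sub>R y u = (1 - E u) *\<^sub>R x u" using Gx[OF u] EG[OF u] by simp
    have Bx: "B u *\<^sub>R x u = E u *\<^sub>R y u" using Ey[OF u] by simp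
    have r: "2 * m - p u = 4 * m * (B u * B u)"
      unfolding p[OF u] BB[OF u] by (simp add: power2_eq_square algebra_simps)
    have "q u *\<^sub>R y u = (2 * m * (2 * E u - 1)) *\<^sub>R (B u *\<^sub>R y u)" by (simp add: q[OF u])
    then have "p u *\<^sub>R x u + q u *\<^sub>R y u = (p u + 2 * m * (2 * E u - 1) * (1 - E u)) *\<^sub>R x u"
      by (simp add: By scaleR_add_left)
    also have "p u + 2 * m * (2 * E u - 1) * (1 - E u) = 2 * m * E u"
      by (simp add: p[OF u] power2_eq_square algebra_simps)
    finally show "p u *\<^sub>R x u + q u *\<^sub>R y u = (2 * m * E u) *\<^sub>R x u" .
    have "(2 * m - p u) *\<^sub>R y u = (4 * m * B u) *\<^sub>R (B u *\<^sub>R y u)" by (simp add: r)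
    then have "q u *\<^sub>R x u + (2 * m - p u) *\<^sub>R y u = (q u + 4 * m * B u * (1 - E u)) *\<^sub>R x u"
      by (simp add: By scaleR_add_left)
    also have "q u + 4 * m * B u * (1 - E u) = 2 * m * B u" by (simp add: q[OF u] algebra_simps)
    finally show *: "q u *\<^sub>R x u + (2 * m - p u) *\<^sub>R y u = (2 * m * B u) *\<^sub>R x u" .
    have "(2 * m * B u) *\<^sub>R x u = (2 * m) *\<^sub>R (B u *\<^sub>R x u)" by simp
    also have "\<dots> = (2 * m * E u) *\<^sub>R y u" unfolding Bx by simp
    finally show "q u *\<^sub>R x u + (2 * m - p u) *\<^sub>R y u = (2 * m * E u) *\<^sub>R y u" using * by simp
    have "(2 * m - p u) *\<^sub>R x u = (4 * m * B u) *\<^sub>R (B u *\<^sub>R x u)" by (simp add: r)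
    then have "(2 * m - p u) *\<^sub>R x u + (- q u) *\<^sub>R y u = (4 * m * B u * E u - q u) *\<^sub>R y u"
      by (simp add: Bx scaleR_diff_left)
    also have "4 * m * B u * E u - q u = 2 * m * B u" by (simp add: q[OF u] algebra_simps)
    finally show "(2 * m - p u) *\<^sub>R x u + (- q u) *\<^sub>R y u = (2 * m * B u) *\<^sub>R y u" .
  qed
  have cross_comb: "f u \<times>\<^sub>3 (a *\<^sub>R (f u \<times>\<^sub>3 x u) + b *\<^sub>R (f u \<times>\<^sub>3 y u) - c *\<^sub>R f u) = - (a *\<^sub>R x u + b *\<^sub>R y u)"
    if "u \<in> W" for u a b c
    by (simp add: cross_add_right Cross3.right_diff_distrib cross_mult_right products[OF that])
  have dA: "dir_deriv Z (\<lambda>u. k *\<^sub>R f u + f u \<times>\<^sub>3 g u) u =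
      k *\<^sub>R dir_deriv Z f u + (dir_deriv Z f u \<times>\<^sub>3 g u + f u \<times>\<^sub>3 dir_deriv Z g u)"
    if "u \<in> W" "smooth_on W g" for u g Z k
    by (simp add: dir_deriv_add[OF _ _ that(1)] smooth_on_scaleR smooth_on_const[OF open_W] smooth_on_cross3
        that sf dir_deriv_cross3[OF sf that(2,1)]
        dir_deriv_bounded_linear[OF sf that(1) bounded_linear_scaleR_right] add.commute)
  have yx: "y u \<times>\<^sub>3 x u = 0" "x u \<times>\<^sub>3 y u = 0" if "u \<in> W" for u
    using cross_tangent[OF that] D0[OF that] cross_skew[of "y u" "x u"] by auto
  have A: "(2 * m * E u0) *\<^sub>R f u + f u \<times>\<^sub>3 x u = (2 * m * E u0) *\<^sub>R f u0 + f u0 \<times>\<^sub>3 x u0" if u: "u \<in> W" for u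
  proof (rule const[where g = "\<lambda>u. (2 * m * E u0) *\<^sub>R f u + f u \<times>\<^sub>3 x u", OF _ _ _ u])
    show "smooth_on W (\<lambda>u. (2 * m * E u0) *\<^sub>R f u + f u \<times>\<^sub>3 x u)"
      by (intro smooth_on_add smooth_on_scaleR smooth_on_const open_W sf smooth_on_cross3 sx)
    fix u assume u: "u \<in> W"
    show "dir_deriv X (\<lambda>u. (2 * m * E u0) *\<^sub>R f u + f u \<times>\<^sub>3 x u) u = 0"
      unfolding dA[OF u sx] XX[OF u] cross_comb[OF u] pq[OF u] by (simp add: E[OF u])
    show "dir_deriv Y (\<lambda>u. (2 * m * E u0) *\<^sub>R f u + f u \<times>\<^sub>3 x u) u = 0"
      unfolding dA[OF u sx] YX[OF u] cross_comb[OF u] pq(3)[OF u] by (simp add: E[OF u] yx[OF u])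
  qed
  have A': "(2 * m * B u0) *\<^sub>R f u + f u \<times>\<^sub>3 y u = (2 * m * B u0) *\<^sub>R f u0 + f u0 \<times>\<^sub>3 y u0" if u: "u \<in> W" for u
  proof (rule const[where g = "\<lambda>u. (2 * m * B u0) *\<^sub>R f u + f u \<times>\<^sub>3 y u", OF _ _ _ u])
    show "smooth_on W (\<lambda>u. (2 * m * B u0) *\<^sub>R f u + f u \<times>\<^sub>3 y u)"
      by (intro smooth_on_add smooth_on_scaleR smooth_on_const open_W sf smooth_on_cross3 sy)
    fix u assume u: "u \<in> W"
    show "dir_deriv X (\<lambda>u. (2 * m * B u0) *\<^sub>R f u + f u \<times>\<^sub>3 y u) u = 0"
      unfolding dA[OF u sy] XY[OF u] cross_comb[OF u] pq(2)[OF u] by (simp add: B[OF u] yx[OF u])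
    show "dir_deriv Y (\<lambda>u. (2 * m * B u0) *\<^sub>R f u + f u \<times>\<^sub>3 y u) u = 0"
      unfolding dA[OF u sy] YY[OF u] cross_comb[OF u] pq(4)[OF u] by (simp add: B[OF u])
  qed
  \<comment> \<open>A plane containing the image of an open set has its normal orthogonal to all
    first and second derivatives there; this is the source of uniqueness.\<close>
  have orth: "x u \<bullet> N' = 0" "y u \<bullet> N' = 0" "dir_deriv X x u \<bullet> N' = 0" "dir_deriv Y y u \<bullet> N' = 0"
    if V: "open V" "V \<subseteq> W" "u \<in> V" "\<forall>u\<in>V. f u \<bullet> N' = k'" for V N' k' u
  proof -
    have d: "dir_deriv Z g v \<bullet> N' = 0"
      if "\<And>w. w \<in> V \<Longrightarrow> g w \<bullet> N' = k" "v \<in> V" "smooth_on W g" for Z g k v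
    proof -
      have "dir_deriv Z (\<lambda>w. g w \<bullet> N') v = 0" using dir_deriv_cong[OF V(1) that(2,1), where X = Z] by simp
      then show ?thesis
        using dir_deriv_bounded_linear[OF that(3) _ bounded_linear_inner_left, of v Z N'] that(2) V(2) by auto
    qed
    have 1: "x v \<bullet> N' = 0" "y v \<bullet> N' = 0" if "v \<in> V" for v
      using d[of f k' v X] d[of f k' v Y] V(4) that sf by auto
    show "x u \<bullet> N' = 0" "y u \<bullet> N' = 0" using 1 V(3) by auto
    show "dir_deriv X x u \<bullet> N' = 0" "dir_deriv Y y u \<bullet> N' = 0"
      using d[OF 1(1) V(3) sx] d[OF 1(2) V(3) sy] by auto
  qed
  have fin: "N' = (1 / norm A) *\<^sub>R A \<or> N' = - ((1 / norm A) *\<^sub>R A)"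
    if "norm N' = 1" "N' = g *\<^sub>R A" for N' A :: "real^3" and g
  proof -
    have gA: "\<bar>g\<bar> * norm A = 1" using that by simp
    then have "\<bar>g\<bar> = 1 / norm A" by (metis mult_zero_right nonzero_eq_divide_eq zero_neq_one)
    then have "g = 1 / norm A \<or> g = - (1 / norm A)" by (auto simp: abs_if split: if_splits)
    then show ?thesis using that(2) by auto
  qed
  show ?thesis
  proof (cases "E u0 = 0")
    case False
    define A where "A = (2 * m * E u0) *\<^sub>R f u0 + f u0 \<times>\<^sub>3 x u0"
    have Epos: "E u0 > 0" using False by (simp add: E_def order_less_le)
    have fA: "f u \<bullet> A = 2 * m * E u0" if "u \<in> W" for u
      unfolding A_def A[OF that, symmetric] by (simp add: inner_right_distrib unit[OF that] products[OF that])
    have AA: "A \<bullet> A = (2 * m * E u0)\<^sup>2 + E u0"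
      unfolding A_def by (simp add: inner_right_distrib inner_left_distrib unit[OF W(2)] products[OF W(2)]
          power2_eq_square)
    \<comment> \<open>The excess \<open>E u0\<close> in |A|^2 keeps the height 2mE/|A| strictly
      below 1, so the circle does not shrink to a point.\<close>
    have nA: "norm A > 2 * m * E u0" unfolding norm_eq_sqrt_inner
      using AA Epos by (intro real_less_rsqrt) simp
    have pos: "2 * m * E u0 > 0" using Epos m by simp
    show ?thesis
    proof (intro exI[of _ "(1 / norm A) *\<^sub>R A"] exI[of _ "2 * m * E u0 / norm A"] conjI ballI allI impI)
      show "norm ((1 / norm A) *\<^sub>R A) = 1" using nA pos by auto
      show "f u \<bullet> (1 / norm A) *\<^sub>R A = 2 * m * E u0 / norm A" if "u \<in> W" for u using fA[OF that] by simp
      have "norm A > 0" using nA pos by linarith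
      then show "\<bar>2 * m * E u0 / norm A\<bar> < 1" using nA pos by (simp add: divide_less_eq)
      show "(2 * m * E u0 / norm A = 0) = (E u0 = 0)" using nA pos by auto
      fix V N' k' assume "open V \<and> V \<subseteq> W \<and> V \<noteq> {} \<and> norm N' = 1 \<and> (\<forall>u\<in>V. f u \<bullet> N' = k')"
      then obtain u where V: "open V" "V \<subseteq> W" "u \<in> V" "\<forall>u\<in>V. f u \<bullet> N' = k'" and N': "norm N' = 1" by auto
      have u: "u \<in> W" using V by auto
      have Eu: "x u \<bullet> x u = E u0" using E[OF u] by (simp add: E_def)
      have "dir_deriv X x u = f u \<times>\<^sub>3 (p u *\<^sub>R x u + q u *\<^sub>R y u) - E u0 *\<^sub>R f u"
        unfolding XX[OF u] Eu by (simp add: cross_add_right cross_mult_right)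
      then have "2 * m * E u0 * (N' \<bullet> (f u \<times>\<^sub>3 x u)) = E u0 * (N' \<bullet> f u)"
        using orth(3)[OF V] by (simp add: pq[OF u] cross_mult_right E[OF u] inner_diff_right inner_commute[of _ N'])
      \<comment> \<open>Together with N' \<perp> x this fixes the ratio of the components of
        \<open>N'\<close> along f and f \<times> x, namely the ratio found in
        \<open>A\<close>.\<close>
      then have Nf: "N' \<bullet> f u = 2 * m * (N' \<bullet> (f u \<times>\<^sub>3 x u))" using False by simp
      have "N' = (N' \<bullet> f u) *\<^sub>R f u + (N' \<bullet> (f u \<times>\<^sub>3 x u) / E u0) *\<^sub>R (f u \<times>\<^sub>3 x u)"
        using perp_expand[of "f u" "x u" N', unfolded Eu] unit[OF u] perp[OF u] False orth(1)[OF V]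
        by (simp add: inner_commute)
      also have "\<dots> = (N' \<bullet> (f u \<times>\<^sub>3 x u) / E u0) *\<^sub>R A"
        unfolding A_def A[OF u, symmetric] Nf using False by (simp add: scaleR_add_right)
      finally show "N' = (1 / norm A) *\<^sub>R A \<or> N' = - ((1 / norm A) *\<^sub>R A)" by (rule fin[OF N'])
    qed
  next
    case True
    define A where "A = f u0 \<times>\<^sub>3 y u0"
    \<comment> \<open>Here x vanishes and y is a unit vector: \<open>f\<close> runs along a great
      circle whose constant normal is f \<times> y.\<close>
    have B0: "B u = 0" and E0: "E u = 0" if "u \<in> W" for u using BB[OF that] True E[OF that] by auto
    have yy: "y u \<bullet> y u = 1" if "u \<in> W" for u using EG[OF that] E0[OF that] by (simp add: G_def)
    have Au: "A = f u \<times>\<^sub>3 y u" if "u \<in> W" for u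
      using A'[OF that] B0[OF W(2)] by (simp add: A_def)
    have AA: "norm A = 1" using products[OF W(2)] yy[OF W(2)] by (simp add: A_def norm_eq_1 G_def)
    show ?thesis
    proof (intro exI[of _ A] exI[of _ 0] conjI ballI allI impI)
      show "f u \<bullet> A = 0" if "u \<in> W" for u using Au[OF that] by (simp add: dot_cross_self)
      fix V N' k' assume "open V \<and> V \<subseteq> W \<and> V \<noteq> {} \<and> norm N' = 1 \<and> (\<forall>u\<in>V. f u \<bullet> N' = k')"
      then obtain u where V: "open V" "V \<subseteq> W" "u \<in> V" "\<forall>u\<in>V. f u \<bullet> N' = k'" and N': "norm N' = 1" by auto
      have u: "u \<in> W" using V by auto
      have "dir_deriv Y y u = f u \<times>\<^sub>3 ((2 * m - p u) *\<^sub>R x u + (- q u) *\<^sub>R y u) - f u"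
        unfolding YY[OF u] yy[OF u] by (simp add: Cross3.right_diff_distrib cross_mult_right)
      then have "N' \<bullet> f u = 0" using orth(4)[OF V] pq(4)[OF u] B0[OF u] by (simp add: inner_commute)
      then have "N' = (N' \<bullet> A) *\<^sub>R A"
        using perp_expand[of "f u" "y u" N'] unit[OF u] perp[OF u] orth(2)[OF V] yy[OF u] Au[OF u]
        by (simp add: inner_commute)
      then show "N' = A \<or> N' = - A" using fin[OF N', of "N' \<bullet> A" A] AA by simp
    qed (use AA True in auto)
  qed
qed

end

section \<open>Coverings and tori\<close>

text \<open>Separating sets are chosen for ordered pairs. The neighbourhood of a point intersects
  those in which it plays either role, so that for two points one chosen disjoint pair appears in
  the two neighbourhoods.\<close>

lemma finite_separation:
  assumes "finite (K :: 'a::t2_space set)"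
  shows "\<exists>U. (\<forall>x\<in>K. open (U x) \<and> x \<in> U x) \<and> (\<forall>x\<in>K. \<forall>y\<in>K. x \<noteq> y \<longrightarrow> U x \<inter> U y = {})"
proof -
  have "\<forall>x y :: 'a. \<exists>A B. x \<noteq> y \<longrightarrow> open A \<and> open B \<and> x \<in> A \<and> y \<in> B \<and> A \<inter> B = {}"
  proof (intro allI)
    fix x y :: 'a
    show "\<exists>A B. x \<noteq> y \<longrightarrow> open A \<and> open B \<and> x \<in> A \<and> y \<in> B \<and> A \<inter> B = {}"
      using hausdorff[of x y] by (cases "x = y") auto
  qed
  then obtain A B where AB: "\<And>x y :: 'a. x \<noteq> y \<Longrightarrow>
      open (A x y) \<and> open (B x y) \<and> x \<in> A x y \<and> y \<in> B x y \<and> A x y \<inter> B x y = {}"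
    by metis
  show ?thesis
  proof (intro exI[of _ "\<lambda>x. \<Inter>z\<in>K - {x}. A x z \<inter> B z x"] conjI ballI impI)
    show "open (\<Inter>z\<in>K - {x}. A x z \<inter> B z x)" "x \<in> (\<Inter>z\<in>K - {x}. A x z \<inter> B z x)" if "x \<in> K" for x
    proof -
      have *: "open (A x z \<inter> B z x) \<and> x \<in> A x z \<inter> B z x" if "z \<in> K - {x}" for z
        using AB[of x z] AB[of z x] that by (auto intro: open_Int)
      show "open (\<Inter>z\<in>K - {x}. A x z \<inter> B z x)" using * assms by (intro open_INT) auto
      show "x \<in> (\<Inter>z\<in>K - {x}. A x z \<inter> B z x)" using * by auto
    qed
    show "(\<Inter>z\<in>K - {x}. A x z \<inter> B z x) \<inter> (\<Inter>z\<in>K - {y}. A y z \<inter> B z y) = {}"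
      if "x \<in> K" "y \<in> K" "x \<noteq> y" for x y
      using AB[OF that(3)] that by blast
  qed
qed

text \<open>Fibres of a local homeomorphism are discrete, hence finite on a compact space; removing
  from the common image of disjoint sheets the compact image of their complement leaves an
  evenly covered neighbourhood.\<close>

lemma compact_local_homeomorphism_finite_covering:
  fixes S :: "'a::t2_space set" and f :: "'a \<Rightarrow> 'b::t2_space"
  assumes S: "compact S" "S \<noteq> {}" and f: "continuous_on S f" "f ` S \<subseteq> T" and T: "connected T"
    and loc: "\<And>x. x \<in> S \<Longrightarrow> \<exists>V. openin (top_of_set S) V \<and> x \<in> V \<and> inj_on f V \<and>
      (\<forall>U. openin (top_of_set S) U \<and> U \<subseteq> V \<longrightarrow> openin (top_of_set T) (f ` U))"
  shows "finite_covering S f T"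
proof -
  obtain V where V: "\<And>x. x \<in> S \<Longrightarrow> openin (top_of_set S) (V x) \<and> x \<in> V x \<and> inj_on f (V x) \<and>
      (\<forall>U. openin (top_of_set S) U \<and> U \<subseteq> V x \<longrightarrow> openin (top_of_set T) (f ` U))"
    using loc by metis
  have f_open: "openin (top_of_set T) (f ` U)" if U: "openin (top_of_set S) U" for U
  proof -
    have "U \<subseteq> S" using U openin_imp_subset by blast
    have "openin (top_of_set T) (f ` (U \<inter> V x))" if "x \<in> U" for x
      using V[of x] U \<open>U \<subseteq> S\<close> that by (meson Int_lower2 openin_Int subsetD)
    then have "openin (top_of_set T) (\<Union>x\<in>U. f ` (U \<inter> V x))" by blast
    moreover have "(\<Union>x\<in>U. f ` (U \<inter> V x)) = f ` U" using V \<open>U \<subseteq> S\<close> by blast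
    ultimately show ?thesis by simp
  qed
  have "openin (top_of_set T) (f ` S)" using f_open by simp
  moreover have "closedin (top_of_set T) (f ` S)"
    using compact_continuous_image[OF f(1) S(1)] f(2) by (simp add: closed_subset compact_imp_closed)
  \<comment> \<open>The image is nonempty, open because \<open>f\<close> is an open map, and closed
    because it is compact.\<close>
  ultimately have surj: "f ` S = T" using T S(2) by (metis connected_clopen image_is_empty)
  have fin: "finite {x \<in> S. f x = y}" for y
  proof -
    let ?K = "{x \<in> S. f x = y}"
    have "closedin (top_of_set S) ?K"
      using continuous_closedin_preimage_constant[OF f(1)] by simp
    then have K: "compact ?K" using S(1) closedin_compact by blast
    have "\<forall>x\<in>S. \<exists>O'. open O' \<and> V x = S \<inter> O'" using V openin_open by metis
    then obtain O' where O': "\<And>x. x \<in> S \<Longrightarrow> open (O' x) \<and> V x = S \<inter> O' x" by metis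
    obtain C where C: "C \<subseteq> ?K" "finite C" "?K \<subseteq> (\<Union>c\<in>C. O' c)"
    proof (rule compactE_image[OF K, of ?K O'])
      show "?K \<subseteq> (\<Union>c\<in>?K. O' c)" using V O' by blast
    qed (use O' in auto)
    have "?K \<subseteq> C"
    proof
      fix z assume z: "z \<in> ?K"
      then obtain c where c: "c \<in> C" "z \<in> O' c" using C(3) by auto
      then have "c \<in> V c" "z \<in> V c" "inj_on f (V c)" "f z = f c" using C(1) V[of c] O'[of c] z by auto
      then show "z \<in> C" using c(1) by (metis inj_onD)
    qed
    then show ?thesis using C(2) finite_subset by blast
  qed
  have "covering_space S f T"
  proof (rule covering_spaceI[OF f(1) surj])
    fix y assume y: "y \<in> T"
    let ?K = "{x \<in> S. f x = y}"
    from finite_separation[OF fin[of y]]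
    obtain U where U': "\<forall>x\<in>?K. open (U x) \<and> x \<in> U x" "\<forall>x\<in>?K. \<forall>z\<in>?K. x \<noteq> z \<longrightarrow> U x \<inter> U z = {}"
      by (elim exE conjE)
    have U: "\<And>x. x \<in> ?K \<Longrightarrow> open (U x) \<and> x \<in> U x"
      "\<And>x z. x \<in> ?K \<Longrightarrow> z \<in> ?K \<Longrightarrow> x \<noteq> z \<Longrightarrow> U x \<inter> U z = {}"
      using U' by simp_all
    define V' where "V' x = V x \<inter> U x" for x
    have V': "openin (top_of_set S) (V' x)" "x \<in> V' x" "inj_on f (V' x)" if "x \<in> ?K" for x
    proof -
      show "openin (top_of_set S) (V' x)"
        using V[of x] U(1)[OF that] that by (simp add: V'_def openin_Int_open)
      show "x \<in> V' x" "inj_on f (V' x)"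
        using V[of x] U(1)[OF that] that by (auto simp: V'_def intro: inj_on_subset)
    qed
    let ?R = "S - (\<Union>x\<in>?K. V' x)"
    define N where "N = T \<inter> (\<Inter>x\<in>?K. f ` V' x) - f ` ?R"
    have "openin (top_of_set S) (\<Union>x\<in>?K. V' x)" using V'(1) by blast
    then have "closedin (top_of_set S) ?R" by (simp add: openin_closedin_eq)
    then have "compact ?R" using S(1) closedin_compact by blast
    then have "closed (f ` ?R)"
      using f(1) by (meson Diff_subset compact_continuous_image compact_imp_closed continuous_on_subset)
    moreover have "openin (top_of_set T) (T \<inter> (\<Inter>x\<in>?K. f ` V' x))"
    proof (cases "?K = {}")
      case False
      then have "openin (top_of_set T) (\<Inter>x\<in>?K. f ` V' x)"
        by (intro openin_INT2 fin f_open V'(1)) auto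
      then show ?thesis by (simp add: openin_Int)
    next
      case True
      show ?thesis unfolding True by simp
    qed
    ultimately have N: "openin (top_of_set T) N"
      unfolding N_def Diff_eq by (intro openin_Int_open[OF _ open_Compl])
    have yN: "y \<in> N" using y V'(2) by (auto simp: N_def)
    show "\<exists>N. y \<in> N \<and> openin (top_of_set T) N \<and> (\<exists>v. \<Union>v = S \<inter> f -` N \<and>
        (\<forall>u\<in>v. openin (top_of_set S) u) \<and> pairwise disjnt v \<and> (\<forall>u\<in>v. \<exists>q. homeomorphism u N f q))"
    proof (intro exI[of _ N] conjI yN N exI[of _ "(\<lambda>x. V' x \<inter> f -` N) ` ?K"])
      have VS: "V' x \<subseteq> S" if "x \<in> ?K" for x using V'(1)[OF that] openin_imp_subset by blast
      show "\<Union> ((\<lambda>x. V' x \<inter> f -` N) ` ?K) = S \<inter> f -` N"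
        using VS by (force simp: N_def)
      have oN: "openin (top_of_set S) (V' x \<inter> f -` N)" if x: "x \<in> ?K" for x
      proof -
        have "openin (top_of_set S) (S \<inter> f -` N)"
          using continuous_openin_preimage[OF f(1) _ N] f(2) by auto
        then have "openin (top_of_set S) (V' x \<inter> (S \<inter> f -` N))" using V'(1)[OF x] by blast
        moreover have "V' x \<inter> (S \<inter> f -` N) = V' x \<inter> f -` N" using VS[OF x] by auto
        ultimately show ?thesis by simp
      qed
      then show "\<forall>u\<in>(\<lambda>x. V' x \<inter> f -` N) ` ?K. openin (top_of_set S) u" by auto
      show "pairwise disjnt ((\<lambda>x. V' x \<inter> f -` N) ` ?K)"
      proof (clarsimp simp: pairwise_def)
        fix x z assume "x \<in> S" "z \<in> S" "y = f x" "f z = f x" "V' x \<inter> f -` N \<noteq> V' z \<inter> f -` N"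
        then have "U x \<inter> U z = {}" by (intro U(2)) auto
        then show "disjnt (V' x \<inter> f -` N) (V' z \<inter> f -` N)" by (auto simp: disjnt_def V'_def)
      qed
      show "\<forall>u\<in>(\<lambda>x. V' x \<inter> f -` N) ` ?K. \<exists>q. homeomorphism u N f q"
      proof safe
        fix x assume x: "x \<in> S" "y = f x"
        then have xK: "x \<in> ?K" by simp
        show "\<exists>q. homeomorphism (V' x \<inter> f -` N) N f q"
        proof (rule homeomorphism_injective_open_map)
          show "continuous_on (V' x \<inter> f -` N) f"
            using f(1) VS[OF xK] by (meson Int_lower1 continuous_on_subset)
          have "N \<subseteq> (\<Inter>x\<in>?K. f ` V' x)" by (auto simp only: N_def)
          also have "\<dots> \<subseteq> f ` V' x" by (rule INT_lower[OF xK])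
          finally show "f ` (V' x \<inter> f -` N) = N" by auto
          show "inj_on f (V' x \<inter> f -` N)" by (rule inj_on_subset[OF V'(3)[OF xK]]) simp
          fix U assume U: "openin (top_of_set (V' x \<inter> f -` N)) U"
          then have "openin (top_of_set S) U" using oN[OF xK] openin_trans by blast
          then have "openin (top_of_set T) (f ` U)" by (rule f_open)
          moreover have "f ` U \<subseteq> N" using U openin_imp_subset by fastforce
          ultimately show "openin (top_of_set N) (f ` U)"
            by (rule openin_subset_trans) (rule openin_imp_subset[OF N])
        qed auto
      qed
    qed
  qed
  then show ?thesis using fin by (simp add: finite_covering_def)
qed

text \<open>The criterion for local injectivity asks for continuity of the derivative in operator
  norm. Smoothness gives continuity on each fixed vector, and the sum of the differences over the
  finite basis dominates the operator norm.\<close>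

lemma smooth_locally_injective:
  fixes f :: "'a::euclidean_space \<Rightarrow> 'b::euclidean_space"
  assumes sm: "smooth_on W f" and a: "a \<in> W" and inj: "inj (frechet_derivative f (at a))"
  obtains r where "r > 0" "ball a r \<subseteq> W" "inj_on f (ball a r)"
proof -
  let ?f' = "\<lambda>x. frechet_derivative f (at x)"
  have lin: "linear (?f' x)" if "x \<in> W" for x
    using linear_frechet_derivative smooth_onD(4)[OF sm that] by blast
  obtain g where g: "linear g" "g \<circ> ?f' a = id"
    using linear_injective_left_inverse[OF lin[OF a] inj] by blast
  have W: "open W" by (rule smooth_onD(1)[OF sm])
  show thesis
  proof (rule has_derivative_locally_injective[of a W g ?f' f])
    show "a \<in> W" "open W" "g \<circ> ?f' a = id" by (fact a W g(2))+
    show "bounded_linear g" using g(1) linear_conv_bounded_linear by blast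
    show "(f has_derivative ?f' x) (at x)" if "x \<in> W" for x by (rule smooth_onD(5)[OF sm that])
    fix e :: real assume e: "e > 0"
    let ?h = "\<lambda>x. \<Sum>i\<in>Basis. norm (?f' x i - ?f' a i)"
    have "continuous_on W ?h"
      by (intro continuous_intros smooth_onD(3)[OF smooth_on_frechet_const[OF sm]])
    then have "isCont ?h a" using W a continuous_on_eq_continuous_at by blast
    then obtain d where d: "d > 0" "\<And>x. dist x a < d \<Longrightarrow> dist (?h x) (?h a) < e"
      using isCont_real_dist[of a ?h, OF _ e] by blast
    obtain d' where d': "d' > 0" "ball a d' \<subseteq> W" using W a open_contains_ball by blast
    have "onorm (\<lambda>v. ?f' x v - ?f' a v) < e" if x: "dist a x < min d d'" for x
    proof -
      have xW: "x \<in> W" using x d'(2) by auto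
      interpret L: linear "\<lambda>v. ?f' x v - ?f' a v"
        using lin[OF xW] lin[OF a] by (rule linear_compose_sub)
      have "onorm (\<lambda>v. ?f' x v - ?f' a v) \<le> ?h x"
      proof (rule onorm_le)
        fix v :: 'a
        have "?f' x v - ?f' a v = ?f' x (\<Sum>i\<in>Basis. (v \<bullet> i) *\<^sub>R i) - ?f' a (\<Sum>i\<in>Basis. (v \<bullet> i) *\<^sub>R i)"
          by (simp only: euclidean_representation)
        also have "\<dots> = (\<Sum>i\<in>Basis. (v \<bullet> i) *\<^sub>R (?f' x i - ?f' a i))"
          by (simp only: L.sum L.scale)
        also have "norm \<dots> \<le> (\<Sum>i\<in>Basis. \<bar>v \<bullet> i\<bar> * norm (?f' x i - ?f' a i))"
          by (rule order_trans[OF norm_sum]) simp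
        also have "\<dots> \<le> (\<Sum>i\<in>Basis. norm v * norm (?f' x i - ?f' a i))"
          by (intro sum_mono mult_right_mono Basis_le_norm) auto
        finally show "norm (?f' x v - ?f' a v) \<le> ?h x * norm v"
          by (simp add: sum_distrib_left[symmetric] mult.commute)
      qed
      also have "\<dots> < e" using d(2)[of x] x by (simp add: dist_commute dist_real_def)
      finally show ?thesis .
    qed
    then show "\<exists>d>0. \<forall>x. dist a x < d \<longrightarrow> onorm (\<lambda>v. ?f' x v - ?f' a v) < e"
      using d(1) d'(1) by (intro exI[of _ "min d d'"]) auto
  qed (rule that)
qed

text \<open>Each circle is a continuous image of the real line, possibly a single point when the
  height is 1 or -1; beyond that range the set is empty.\<close>

lemma connected_T_torus: "connected (T_torus a b)"
proof (cases "\<bar>a\<bar> \<le> 1 \<and> \<bar>b\<bar> \<le> 1")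
  case True
  define h :: "real \<Rightarrow> real \<Rightarrow> real^3" where
    "h c t = c *\<^sub>R axis 1 1 + (sqrt (1 - c\<^sup>2) * cos t) *\<^sub>R axis 2 1 + (sqrt (1 - c\<^sup>2) * sin t) *\<^sub>R axis 3 1" for c t
  have comp: "h c t $ 1 = c" "h c t $ 2 = sqrt (1 - c\<^sup>2) * cos t" "h c t $ 3 = sqrt (1 - c\<^sup>2) * sin t" for c t
    by (simp_all add: h_def axis_def)
  have circle: "{x :: real^3. x \<bullet> x = 1 \<and> x $ 1 = c} = range (h c)" if "\<bar>c\<bar> \<le> 1" for c
  proof (intro set_eqI iffI)
    have c2: "0 \<le> 1 - c\<^sup>2" using that abs_square_le_1[of c] by simp
    then have s: "sqrt (1 - c\<^sup>2) * sqrt (1 - c\<^sup>2) = 1 - c\<^sup>2" by simp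
    have "h c t \<bullet> h c t = 1" for t
    proof -
      define r where "r = sqrt (1 - c\<^sup>2)"
      have "h c t \<bullet> h c t = c\<^sup>2 + ((r * r) * (cos t)\<^sup>2 + (r * r) * (sin t)\<^sup>2)"
        using comp[of c t, folded r_def] by (simp add: inner_vec_def sum_3 power2_eq_square ac_simps)
      also have "(r * r) * (cos t)\<^sup>2 + (r * r) * (sin t)\<^sup>2 = (r * r) * ((cos t)\<^sup>2 + (sin t)\<^sup>2)"
        by (simp only: distrib_left)
      finally show ?thesis using s[folded r_def] by simp
    qed
    then show "x \<in> {x. x \<bullet> x = 1 \<and> x $ 1 = c}" if "x \<in> range (h c)" for x using that comp by auto
    fix x :: "real^3" assume "x \<in> {x. x \<bullet> x = 1 \<and> x $ 1 = c}"
    then have x: "x \<bullet> x = 1" "c = x $ 1" by auto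
    then have xx: "(x $ 2)\<^sup>2 + (x $ 3)\<^sup>2 = 1 - c\<^sup>2"
      by (simp add: inner_vec_def sum_3 power2_eq_square)
    let ?r = "sqrt (1 - c\<^sup>2)"
    have "\<exists>t. x $ 2 = ?r * cos t \<and> x $ 3 = ?r * sin t"
    proof (cases "?r = 0")
      case True
      then show ?thesis using xx by (simp add: sum_power2_eq_zero_iff)
    next
      case False
      then have "(x $ 2 / ?r)\<^sup>2 + (x $ 3 / ?r)\<^sup>2 = 1"
        using xx c2 by (simp add: power_divide add_divide_distrib[symmetric])
      then obtain t where "x $ 2 / ?r = cos t" "x $ 3 / ?r = sin t" using sincos_total_2pi by metis
      then show ?thesis using False by (metis nonzero_mult_div_cancel_left times_divide_eq_right)
    qed
    then obtain t where "x $ 2 = ?r * cos t" "x $ 3 = ?r * sin t" by blast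
    then have "x = h c t" using x(2) comp[of c t] by (simp add: vec_eq_iff forall_3)
    then show "x \<in> range (h c)" by simp
  qed
  have "T_torus a b = {x. x \<bullet> x = 1 \<and> x $ 1 = a} \<times> {x. x \<bullet> x = 1 \<and> x $ 1 = b}"
    by (auto simp: T_torus_def mem_S2xS2)
  moreover have "connected (range (h c))" for c
    unfolding h_def by (intro connected_continuous_image continuous_intros) auto
  ultimately show ?thesis using True circle by (simp add: connected_Times)
next
  case False
  have "\<bar>x $ 1\<bar> \<le> 1" if "x \<bullet> x = 1" for x :: "real^3"
    using component_le_norm_cart[of x 1] that by (simp add: norm_eq_1[symmetric])
  then have "T_torus a b = {}" using False by (auto simp: T_torus_def mem_S2xS2)
  then show ?thesis by simp
qed

text \<open>Up to the factor 1 - a^2 the two expressions are the cosine and the sine of the angle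
  from \<open>p\<close>. On the half circle with positive cosine the sine determines the
  point.\<close>

lemma circle_chart_inj:
  fixes x y p :: "real^3"
  assumes "\<bar>a\<bar> < 1" "p \<bullet> p = 1" "p $ 1 = a"
    and x: "x \<bullet> x = 1" "x $ 1 = a" "p $ 2 * x $ 2 + p $ 3 * x $ 3 > 0"
    and y: "y \<bullet> y = 1" "y $ 1 = a" "p $ 2 * y $ 2 + p $ 3 * y $ 3 > 0"
    and eq: "p $ 2 * x $ 3 - p $ 3 * x $ 2 = p $ 2 * y $ 3 - p $ 3 * y $ 2"
  shows "x = y"
proof -
  let ?p = "p $ 2" and ?q = "p $ 3"
  have n: "z $ 2 * z $ 2 + z $ 3 * z $ 3 = 1 - a\<^sup>2" if "z \<bullet> z = 1" "z $ 1 = a" for z :: "real^3"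
    using that by (simp add: inner_vec_def sum_3 power2_eq_square)
  note np = n[OF assms(2,3)] and nx = n[OF x(1,2)] and ny = n[OF y(1,2)]
  have pos: "1 - a\<^sup>2 > 0" using assms(1) abs_square_less_1[of a] by simp
  have "(?p * x $ 2 + ?q * x $ 3)\<^sup>2 = (?p * ?p + ?q * ?q) * (x $ 2 * x $ 2 + x $ 3 * x $ 3) - (?p * x $ 3 - ?q * x $ 2)\<^sup>2"
    by (simp add: power2_eq_square algebra_simps)
  also have "\<dots> = (?p * ?p + ?q * ?q) * (y $ 2 * y $ 2 + y $ 3 * y $ 3) - (?p * y $ 3 - ?q * y $ 2)\<^sup>2"
    unfolding nx ny eq ..
  also have "\<dots> = (?p * y $ 2 + ?q * y $ 3)\<^sup>2"
    by (simp add: power2_eq_square algebra_simps)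
  finally have d: "?p * x $ 2 + ?q * x $ 3 = ?p * y $ 2 + ?q * y $ 3" using x(3) y(3) by simp
  have "(?p * ?p + ?q * ?q) * z $ 2 = ?p * (?p * z $ 2 + ?q * z $ 3) - ?q * (?p * z $ 3 - ?q * z $ 2)"
    "(?p * ?p + ?q * ?q) * z $ 3 = ?q * (?p * z $ 2 + ?q * z $ 3) + ?p * (?p * z $ 3 - ?q * z $ 2)" for z :: "real^3"
    by (simp_all add: algebra_simps)
  then have "(1 - a\<^sup>2) * x $ 2 = (1 - a\<^sup>2) * y $ 2" "(1 - a\<^sup>2) * x $ 3 = (1 - a\<^sup>2) * y $ 3"
    unfolding np[symmetric] using d eq by simp_all
  then have "x $ 2 = y $ 2" "x $ 3 = y $ 3" using pos by simp_all
  then show ?thesis using x(2) y(2) by (simp add: vec_eq_iff forall_3)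
qed

text \<open>The linear map \<open>L\<close> below is a chart of the torus near \<open>F u\<close>, so that invariance of
  domain applies to \<open>L \<circ> F\<close>.\<close>

lemma torus_patch_local_homeomorphism:
  assumes sm: "smooth_on W F" and im: "\<And>u. u \<in> W \<Longrightarrow> F u \<in> T_torus a b"
    and ab: "\<bar>a\<bar> < 1" "\<bar>b\<bar> < 1" and inj: "inj (dd F u)" and u: "u \<in> W"
  shows "\<exists>V. open V \<and> u \<in> V \<and> V \<subseteq> W \<and> inj_on F V \<and>
    (\<forall>U. open U \<and> U \<subseteq> V \<longrightarrow> openin (top_of_set (T_torus a b)) (F ` U))"
proof -
  define P Q where "P = fst (F u)" and "Q = snd (F u)"
  have PQ: "P \<bullet> P = 1" "Q \<bullet> Q = 1" "P $ 1 = a" "Q $ 1 = b"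
    using im[OF u] by (auto simp: P_def Q_def T_torus_def mem_S2xS2)
  define L :: "R33 \<Rightarrow> real \<times> real" where
    "L z = (P $ 2 * fst z $ 3 - P $ 3 * fst z $ 2, Q $ 2 * snd z $ 3 - Q $ 3 * snd z $ 2)" for z
  have linL: "linear L" by (rule linearI) (simp_all add: L_def algebra_simps)
  then have bL: "bounded_linear L" using linear_conv_bounded_linear by blast
  \<comment> \<open>The open half circles centred at the components of \<open>F u\<close>, where the
    two sines recorded by \<open>L\<close> determine the point.\<close>
  define U where "U = {z :: R33. P $ 2 * fst z $ 2 + P $ 3 * fst z $ 3 > 0 \<and> Q $ 2 * snd z $ 2 + Q $ 3 * snd z $ 3 > 0}"
  have oU: "open U" unfolding U_def
    by (intro open_Collect_conj open_Collect_less continuous_intros)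
  have n: "z $ 2 * z $ 2 + z $ 3 * z $ 3 = 1 - (z $ 1)\<^sup>2" if "z \<bullet> z = 1" for z :: "real^3"
    using that by (simp add: inner_vec_def sum_3 power2_eq_square)
  have pos: "1 - a\<^sup>2 > 0" "1 - b\<^sup>2 > 0" using ab abs_square_less_1[of a] abs_square_less_1[of b] by simp_all
  have uU: "F u \<in> U" using n[OF PQ(1)] n[OF PQ(2)] pos by (simp add: U_def P_def[symmetric] Q_def[symmetric] PQ)
  have injL: "z = z'" if "z \<in> T_torus a b \<inter> U" "z' \<in> T_torus a b \<inter> U" "L z = L z'" for z z'
  proof (rule prod_eqI)
    show "fst z = fst z'"
      by (rule circle_chart_inj[OF ab(1) PQ(1,3)]) (use that in \<open>auto simp: T_torus_def mem_S2xS2 U_def L_def\<close>)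
    show "snd z = snd z'"
      by (rule circle_chart_inj[OF ab(2) PQ(2,4)]) (use that in \<open>auto simp: T_torus_def mem_S2xS2 U_def L_def\<close>)
  qed
  have sLF: "smooth_on W (\<lambda>u. L (F u))" by (rule smooth_on_bounded_linear[OF bL sm])
  have dLF: "frechet_derivative (\<lambda>u. L (F u)) (at u) v = L (dd F u v)" for v
    using dir_deriv_bounded_linear[OF sm u bL, of "\<lambda>_. v"] by (simp add: dir_deriv_def)
  interpret dF: linear "dd F u" using linear_frechet_derivative smooth_onD(4)[OF sm u] .
  have tangent: "M (dd F u v) = 0" if "bounded_linear M" "\<And>x. x \<in> W \<Longrightarrow> M (F x) = c" for M :: "R33 \<Rightarrow> real" and c v
    using dir_deriv_bounded_linear[OF sm u that(1), of "\<lambda>_. v"]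
      dir_deriv_cong[OF smooth_onD(1)[OF sm] u, of "\<lambda>x. M (F x)" "\<lambda>_. c" "\<lambda>_. v"] that(2)
    by (simp add: dir_deriv_def)
  have t1: "fst (dd F u v) $ 1 = 0" "snd (dd F u v) $ 1 = 0" for v
    by (rule tangent[where c = a], auto simp: T_torus_def dest!: im intro!: bounded_linear_intros
        bounded_linear_compose[OF bounded_linear_vec_nth bounded_linear_fst])
      (rule tangent[where c = b], auto simp: T_torus_def dest!: im intro!: bounded_linear_intros
        bounded_linear_compose[OF bounded_linear_vec_nth bounded_linear_snd])
  have t2: "P \<bullet> fst (dd F u v) = 0" "Q \<bullet> snd (dd F u v) = 0" for v
  proof -
    have W: "open W" by (rule smooth_onD(1)[OF sm])
    have "dir_deriv (\<lambda>_. v) (\<lambda>x. fst (F x) \<bullet> fst (F x)) u = 0" "dir_deriv (\<lambda>_. v) (\<lambda>x. snd (F x) \<bullet> snd (F x)) u = 0"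
      using dir_deriv_cong[OF W u, of "\<lambda>x. fst (F x) \<bullet> fst (F x)" "\<lambda>x. 1"]
        dir_deriv_cong[OF W u, of "\<lambda>x. snd (F x) \<bullet> snd (F x)" "\<lambda>x. 1"] im
      by (simp_all add: T_torus_def mem_S2xS2 case_prod_beta)
    moreover have "dir_deriv (\<lambda>_. v) (\<lambda>x. fst (F x)) u = fst (dd F u v)" "dir_deriv (\<lambda>_. v) (\<lambda>x. snd (F x)) u = snd (dd F u v)"
      using dir_deriv_fst[OF sm u] dir_deriv_snd[OF sm u] by (simp_all add: dir_deriv_def[of _ F])
    ultimately show "P \<bullet> fst (dd F u v) = 0" "Q \<bullet> snd (dd F u v) = 0"
      using dir_deriv_inner[OF smooth_on_fst[OF sm] smooth_on_fst[OF sm] u, of "\<lambda>_. v"]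
        dir_deriv_inner[OF smooth_on_snd[OF sm] smooth_on_snd[OF sm] u, of "\<lambda>_. v"]
      by (simp_all add: P_def Q_def inner_commute)
  qed
  \<comment> \<open>A tangent vector of the circle that is killed by \<open>L\<close> is orthogonal
    both to the horizontal part of p and to its quarter turn. Hence \<open>L\<close> is injective on
    the tangent plane of the torus.\<close>
  have zero: "w = 0" if "p \<bullet> p = 1" "\<bar>p $ 1\<bar> < 1" "w $ 1 = 0" "p \<bullet> w = 0" "p $ 2 * w $ 3 - p $ 3 * w $ 2 = 0" for p w :: "real^3"
  proof -
    have 1: "p $ 2 * w $ 2 + p $ 3 * w $ 3 = 0" using that(3,4) by (simp add: inner_vec_def sum_3)
    have "(p $ 2 * p $ 2 + p $ 3 * p $ 3) * w $ 2 = p $ 2 * (p $ 2 * w $ 2 + p $ 3 * w $ 3) - p $ 3 * (p $ 2 * w $ 3 - p $ 3 * w $ 2)"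
      "(p $ 2 * p $ 2 + p $ 3 * p $ 3) * w $ 3 = p $ 3 * (p $ 2 * w $ 2 + p $ 3 * w $ 3) + p $ 2 * (p $ 2 * w $ 3 - p $ 3 * w $ 2)"
      by (simp_all add: algebra_simps)
    then have "(1 - (p $ 1)\<^sup>2) * w $ 2 = 0" "(1 - (p $ 1)\<^sup>2) * w $ 3 = 0" unfolding 1 that(5) n[OF that(1)] by simp_all
    moreover have "1 - (p $ 1)\<^sup>2 \<noteq> 0" using that(2) abs_square_less_1[of "p $ 1"] by simp
    ultimately show ?thesis using that(3) by (simp add: vec_eq_iff forall_3)
  qed
  have "inj (frechet_derivative (\<lambda>u. L (F u)) (at u))"
  proof -
    interpret LdF: linear "\<lambda>v. L (dd F u v)"
      using linear_compose[OF dF.linear_axioms linL] by (simp add: o_def)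
    have "v = 0" if "L (dd F u v) = 0" for v
    proof -
      have "fst (dd F u v) = 0" by (rule zero[of P]) (use that ab PQ t1 t2 in \<open>auto simp: L_def zero_prod_def\<close>)
      moreover have "snd (dd F u v) = 0" by (rule zero[of Q]) (use that ab PQ t1 t2 in \<open>auto simp: L_def zero_prod_def\<close>)
      ultimately have "dd F u v = dd F u 0" by (simp add: prod_eq_iff dF.zero)
      then show ?thesis using inj injD by metis
    qed
    then have "inj (\<lambda>v. L (dd F u v))" using LdF.inj_iff_eq_0 by blast
    moreover have "frechet_derivative (\<lambda>u. L (F u)) (at u) = (\<lambda>v. L (dd F u v))" using dLF by auto
    ultimately show ?thesis by simp
  qed
  then obtain r where r: "r > 0" "ball u r \<subseteq> W" "inj_on (\<lambda>u. L (F u)) (ball u r)"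
    using smooth_locally_injective[OF sLF u] by metis
  define V where "V = ball u r \<inter> F -` U"
  have cF: "continuous_on (ball u r) F" using smooth_onD(3)[OF sm] r(2) continuous_on_subset by blast
  have "open V" unfolding V_def
    using continuous_on_open_vimage[OF open_ball] cF oU by (metis Int_commute)
  moreover have "u \<in> V" using r(1) uU by (simp add: V_def)
  moreover have VW: "V \<subseteq> W" using r(2) by (auto simp: V_def)
  moreover have "inj_on F V"
    using r(3) unfolding V_def by (auto simp: inj_on_def)
  moreover have "openin (top_of_set (T_torus a b)) (F ` O')" if O': "open O'" "O' \<subseteq> V" for O'
  proof -
    have "open ((\<lambda>u. L (F u)) ` O')"
    proof (rule invariance_of_domain_gen[OF O'(1)])
      show "continuous_on O' (\<lambda>u. L (F u))"
        using smooth_onD(3)[OF sLF] O'(2) VW continuous_on_subset by blast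
      show "inj_on (\<lambda>u. L (F u)) O'" using r(3) O'(2) by (auto simp: V_def inj_on_def)
    qed simp
    then have "open (L -` (\<lambda>u. L (F u)) ` O')"
      using open_vimage linear_continuous_on[OF bL] by blast
    then have "openin (top_of_set (T_torus a b)) (T_torus a b \<inter> (U \<inter> L -` (\<lambda>u. L (F u)) ` O'))"
      using oU by (simp add: openin_open_Int open_Int)
    \<comment> \<open>Injectivity of \<open>L\<close> on the part of the torus in \<open>U\<close>
      identifies the preimage of an open set of the plane with the image under
      \<open>F\<close>.\<close>
    moreover have "T_torus a b \<inter> (U \<inter> L -` (\<lambda>u. L (F u)) ` O') = F ` O'"
    proof (intro set_eqI iffI)
      fix z assume "z \<in> T_torus a b \<inter> (U \<inter> L -` (\<lambda>u. L (F u)) ` O')"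
      then obtain x where z: "z \<in> T_torus a b" "z \<in> U" "x \<in> O'" "L z = L (F x)" by auto
      have "x \<in> V" using z(3) O'(2) by auto
      then have "F x \<in> T_torus a b \<inter> U" using VW im by (auto simp: V_def)
      then have "z = F x" using injL[of z "F x"] z by simp
      then show "z \<in> F ` O'" using z(3) by simp
    qed (use O'(2) VW im in \<open>auto simp: V_def\<close>)
    ultimately show ?thesis by simp
  qed
  ultimately show ?thesis by blast
qed

section \<open>Compact surfaces with parallel mean curvature\<close>

context lagrangian_patch
begin

lemma restrict: "open V \<Longrightarrow> V \<subseteq> W \<Longrightarrow> lagrangian_patch V F"
  using smooth_on_subset[OF smooth_F] F_S2xS2 immersed lagrange
  by (intro lagrangian_patch.intro) (auto simp: subset_iff)

text \<open>The derivative of <H, H> is 2<dH, H>. As H is normal, only the normal part of dH counts,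
  and this vanishes.\<close>

lemma norm_mean_curvature_constant:
  assumes par: "\<And>u v. u \<in> W \<Longrightarrow> normal_deriv F (mean_curvature_vector F) u v = 0"
    and V: "open V" "convex V" "V \<subseteq> W" "a \<in> V" "b \<in> V"
  shows "norm (mean_curvature_vector F a) = norm (mean_curvature_vector F b)"
proof -
  let ?H = "mean_curvature_vector F"
  have sH: "smooth_on V ?H" by (rule smooth_on_subset[OF smooth_mean_curvature V(1,3)])
  have "?H a \<bullet> ?H a = ?H b \<bullet> ?H b"
  proof (rule dir_deriv_zero_imp_constant[where f = "\<lambda>u. ?H u \<bullet> ?H u", OF smooth_on_inner[OF sH sH] V(2) _ V(4,5)])
    fix u v assume "u \<in> V"
    then have u: "u \<in> W" using V(3) by auto
    obtain x y where on: "on_pair F u x y" using exists_smooth_on_pair u by metis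
    let ?a = "JJ (F u) (dd F u x)" and ?b = "JJ (F u) (dd F u y)" and ?d = "frechet_derivative ?H (at u) v"
    have ab: "?a \<bullet> ?a = 1" "?a \<bullet> ?b = 0" "?b \<bullet> ?b = 1" "?b \<bullet> ?a = 0"
      using on JJ_inner[OF F_S2xS2[OF u] dd_tangent[OF u]] by (simp_all add: on_pair_def inner_commute)
    have 0: "(?d \<bullet> ?a) *\<^sub>R ?a + (?d \<bullet> ?b) *\<^sub>R ?b = 0"
      using par[OF u, of v] by (simp add: normal_deriv_def orth_proj_normal[OF u on])
    from arg_cong[OF 0, of "\<lambda>z. z \<bullet> ?a"] arg_cong[OF 0, of "\<lambda>z. z \<bullet> ?b"]
    have d: "?d \<bullet> ?a = 0" "?d \<bullet> ?b = 0" by (simp_all add: inner_left_distrib ab)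
    have "?d \<bullet> ?H u = 0"
      unfolding mean_curvature_on_pair[OF u on] orth_proj_normal[OF u on]
      by (simp add: inner_right_distrib d)
    then show "frechet_derivative (\<lambda>u. ?H u \<bullet> ?H u) (at u) v = 0"
      using dir_deriv_inner[OF sH sH \<open>u \<in> V\<close>, of "\<lambda>_. v"] by (simp add: dir_deriv_def inner_commute)
  qed
  then show ?thesis by (simp add: norm_eq_sqrt_inner)
qed

end

text \<open>The squared Jacobian of the first projection, with no frame field chosen. The square is
  independent of the orthonormal pair; the Jacobian itself changes sign with the orientation of the
  pair.\<close>

definition jac2 :: "(real^2 \<Rightarrow> R33) \<Rightarrow> real^2 \<Rightarrow> real^2 \<Rightarrow> real^2 \<Rightarrow> real" where
  "jac2 F u v w = (fst (F u) \<bullet> (fst (dd F u v) \<times>\<^sub>3 fst (dd F u w)))\<^sup>2"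

text \<open>Two orthonormal pairs differ by an orthogonal matrix, whose squared determinant is
  1.\<close>

lemma (in lagrangian_patch) on_pair_jac2:
  assumes u: "u \<in> W" and on: "on_pair F u v w" "on_pair F u v' w'"
  shows "jac2 F u v' w' = jac2 F u v w"
proof -
  define e f where "e = dd F u v" and "f = dd F u w"
  obtain a b where ab: "dd F u v' = a *\<^sub>R e + b *\<^sub>R f" using dd_expand[OF u on(1)] unfolding e_def f_def by blast
  obtain c d where cd: "dd F u w' = c *\<^sub>R e + d *\<^sub>R f" using dd_expand[OF u on(1)] unfolding e_def f_def by blast
  have ef: "e \<bullet> e = 1" "f \<bullet> f = 1" "e \<bullet> f = 0" "f \<bullet> e = 0"
    using on(1) by (auto simp: on_pair_def e_def f_def inner_commute)
  have r: "a * a + b * b = 1" "c * c + d * d = 1" "a * c + b * d = 0"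
    using on(2) unfolding on_pair_def ab cd by (simp_all add: inner_left_distrib inner_right_distrib ef mult.commute)
  have "(a * d - b * c)\<^sup>2 = (a * a + b * b) * (c * c + d * d) - (a * c + b * d)\<^sup>2"
    by (simp add: power2_eq_square algebra_simps)
  then have det: "(a * d - b * c)\<^sup>2 = 1" unfolding r by simp
  have "fst (a *\<^sub>R e + b *\<^sub>R f) \<times>\<^sub>3 fst (c *\<^sub>R e + d *\<^sub>R f) = (a * d - b * c) *\<^sub>R (fst e \<times>\<^sub>3 fst f)"
    using cross_skew[of "fst f" "fst e"]
    by (simp add: cross_add_left cross_add_right cross_mult_left cross_mult_right algebra_simps)
  then show ?thesis unfolding jac2_def ab cd by (simp add: power_mult_distrib det e_def f_def)
qed

lemma jac2_reparam:
  assumes "smooth_on V G" "smooth_on U t" "\<And>x. x \<in> U \<Longrightarrow> t x \<in> V"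
    "\<And>x. x \<in> U \<Longrightarrow> F x = G (t x)" "u \<in> U"
  shows "jac2 F u v w = jac2 G (t u) (frechet_derivative t (at u) v) (frechet_derivative t (at u) w)"
  by (simp add: jac2_def has_derivative_reparam[OF assms] assms(4,5))

lemma (in parallel_frame) D_jac2: "u \<in> W \<Longrightarrow> (P.D u)\<^sup>2 = jac2 F u (X u) (Y u)"
  using dir_deriv_fst[OF smooth_F] by (simp add: P.D_def jac2_def dir_deriv_def[of _ F])

section \<open>Gluing local information along a connected surface\<close>

lemma connected_locally_constant:
  assumes S: "connected S" "a \<in> S" "b \<in> S"
    and loc: "\<And>x. x \<in> S \<Longrightarrow> \<exists>V. openin (top_of_set S) V \<and> x \<in> V \<and> (\<forall>y\<in>V. f y = f x)"
  shows "f a = f b"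
  by (rule connected_equivalence_relation[OF S, where R = "\<lambda>x y. f x = f y"]) (use loc in \<open>auto simp: eq_commute\<close>)

lemma continuous_on_locally:
  fixes S :: "'a::t2_space set"
  assumes "\<And>x. x \<in> S \<Longrightarrow> \<exists>V. openin (top_of_set S) V \<and> x \<in> V \<and> continuous_on V f"
  shows "continuous_on S f"
  unfolding continuous_on_eq_continuous_within
proof
  fix x assume "x \<in> S"
  then obtain V where V: "openin (top_of_set S) V" "x \<in> V" "continuous_on V f" using assms by blast
  then obtain O' where O': "open O'" "V = S \<inter> O'" by (auto simp: openin_open)
  have "at x within V = at x within S"
    using O' V(2) by (intro at_within_nhd[of x O']) auto
  then show "continuous (at x within S) f"
    using V(2,3) unfolding continuous_on_eq_continuous_within by (metis continuous_within)
qed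

text \<open>The last clause quantifies over all nonempty open parts of \<open>V\<close>, so that
  planes found on different patches can be compared on an overlap of any size.\<close>

definition rigid_plane ::
    "'a::topological_space set \<Rightarrow> ('a \<Rightarrow> real^3) \<Rightarrow> 'a set \<Rightarrow> real^3 \<Rightarrow> real \<Rightarrow> bool" where
  "rigid_plane S g V N k \<longleftrightarrow> norm N = 1 \<and> (\<forall>t\<in>V. g t \<bullet> N = k) \<and>
    (\<forall>V' N' k'. openin (top_of_set S) V' \<and> V' \<subseteq> V \<and> V' \<noteq> {} \<and> norm N' = 1 \<and> (\<forall>t\<in>V'. g t \<bullet> N' = k')
        \<longrightarrow> N' = N \<or> N' = - N)"

lemma rigid_planeD:
  assumes "rigid_plane S g V N k"
  shows "norm N = 1" "t \<in> V \<Longrightarrow> g t \<bullet> N = k"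
    "openin (top_of_set S) V' \<Longrightarrow> V' \<subseteq> V \<Longrightarrow> V' \<noteq> {} \<Longrightarrow> norm N' = 1 \<Longrightarrow>
      (\<And>t. t \<in> V' \<Longrightarrow> g t \<bullet> N' = k') \<Longrightarrow> N' = N \<or> N' = - N"
  using assms unfolding rigid_plane_def by blast+

text \<open>Since a rigid plane is determined by any smaller open set, the local planes fit together along
  a connected surface.\<close>

lemma local_planes_global:
  fixes g :: "'a::topological_space \<Rightarrow> real^3"
  assumes S: "connected S" "s0 \<in> S"
    and loc: "\<And>s. s \<in> S \<Longrightarrow> \<exists>V N k. openin (top_of_set S) V \<and> s \<in> V \<and> rigid_plane S g V N k"
  shows "\<exists>N a. norm N = 1 \<and> 0 \<le> a \<and> (\<forall>t\<in>S. g t \<bullet> N = a)"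
proof -
  \<comment> \<open>\<open>Z N s\<close> says that near \<open>s\<close> the image lies in a plane
    with normal \<open>N\<close>. With \<open>N\<close> taken from one patch, its truth value turns
    out to be locally constant.\<close>
  define Z where "Z N s \<longleftrightarrow> (\<exists>V. openin (top_of_set S) V \<and> s \<in> V \<and> (\<exists>k. \<forall>t\<in>V. g t \<bullet> N = k))" for N s
  obtain V0 N k0 where V0: "openin (top_of_set S) V0" "s0 \<in> V0" "rigid_plane S g V0 N k0"
    using loc[OF S(2)] by blast
  note N = rigid_planeD(1)[OF V0(3)]
  have Z0: "Z N s0" using V0(1,2) rigid_planeD(2)[OF V0(3)] by (auto simp: Z_def)
  have ZZ: "Z N s" if "s \<in> S" for s
  proof -
    have "Z N s0 = Z N s"
    proof (rule connected_locally_constant[OF S that])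
      fix x assume "x \<in> S"
      then obtain V M k where V: "openin (top_of_set S) V" "x \<in> V" "rigid_plane S g V M k"
        using loc by blast
      \<comment> \<open>If \<open>N\<close> is a normal near one point of the patch, rigidity makes
        it the patch's own normal up to sign, hence a normal on the whole patch.\<close>
      have all: "Z N z" if y: "y \<in> V" "Z N y" and z: "z \<in> V" for y z
      proof -
        obtain V' k' where V': "openin (top_of_set S) V'" "y \<in> V'" "\<forall>t\<in>V'. g t \<bullet> N = k'"
          using y(2) by (auto simp: Z_def)
        have "N = M \<or> N = - M"
          by (rule rigid_planeD(3)[OF V(3), of "V' \<inter> V" N k']) (use V' V(1) y(1) N in auto)
        then have "\<exists>k. \<forall>t\<in>V. g t \<bullet> N = k" using rigid_planeD(2)[OF V(3)] by auto
        then show ?thesis using V(1) z by (auto simp: Z_def)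
      qed
      show "\<exists>V. openin (top_of_set S) V \<and> x \<in> V \<and> (\<forall>y\<in>V. Z N y = Z N x)"
        using V(1,2) all by blast
    qed
    then show ?thesis using Z0 by simp
  qed
  have const: "g s \<bullet> N = g s0 \<bullet> N" if "s \<in> S" for s
  proof (rule connected_locally_constant[OF S(1) that S(2)])
    fix x assume "x \<in> S"
    then show "\<exists>V. openin (top_of_set S) V \<and> x \<in> V \<and> (\<forall>y\<in>V. g y \<bullet> N = g x \<bullet> N)"
      using ZZ[of x] unfolding Z_def by metis
  qed
  \<comment> \<open>Reversing the normal if necessary makes the height nonnegative.\<close>
  show ?thesis
  proof (cases "g s0 \<bullet> N \<ge> 0")
    case True
    then show ?thesis using const N by blast
  next
    case False
    then show ?thesis using const N by (intro exI[of _ "- N"] exI[of _ "- (g s0 \<bullet> N)"]) auto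
  qed
qed

lemma isometry_product_orthogonal:
  assumes R: "orthogonal_transformation R" "orthogonal_transformation R'"
  shows "isometry_S2xS2 (\<lambda>z. (R (fst z), R' (snd z)))" (is "isometry_S2xS2 ?f")
proof -
  note inv = orthogonal_transformation_inv[OF R(1)] orthogonal_transformation_inv[OF R(2)]
  let ?g = "\<lambda>z. (inv R (fst z), inv R' (snd z))"
  have bl: "bounded_linear (\<lambda>z. (Q (fst z), Q' (snd z)))"
    if "orthogonal_transformation Q" "orthogonal_transformation Q'" for Q Q' :: "real^3 \<Rightarrow> real^3"
  proof -
    have "bounded_linear Q" "bounded_linear Q'"
      using that by (simp_all add: orthogonal_transformation_def linear_conv_bounded_linear)
    then show ?thesis
      by (intro bounded_linear_Pair bounded_linear_compose[OF _ bounded_linear_fst] bounded_linear_compose[OF _ bounded_linear_snd])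
  qed
  have sm: "smooth_map_on S h" if "bounded_linear L" "\<And>z. z \<in> S \<Longrightarrow> h z = L z" for S and L h :: "R33 \<Rightarrow> R33"
  proof -
    have "smooth_on UNIV L" by (rule smooth_on_bounded_linear[OF that(1) smooth_on_ident[OF open_UNIV]])
    then show ?thesis using that(2) unfolding smooth_map_on_def smooth_on_def by (metis IntD2 UNIV_I)
  qed
  have mem: "(Q (fst z), Q' (snd z)) \<in> S2xS2 \<longleftrightarrow> z \<in> S2xS2"
    if "orthogonal_transformation Q" "orthogonal_transformation Q'" for Q Q' z
    using that by (simp add: mem_S2xS2 orthogonal_transformation_def)
  have bij: "bij R" "bij R'" using R orthogonal_transformation_bij by auto
  have gf: "?g (?f z) = z" and fg: "?f (?g z) = z" for z
    using bij by (simp_all add: bij_is_inj bij_is_surj surj_f_inv_f)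
  have inj: "inj_on ?f S2xS2" by (metis (no_types, lifting) gf inj_onI)
  have im: "?f ` S2xS2 = S2xS2"
  proof (intro set_eqI iffI)
    fix z assume "z \<in> S2xS2"
    then have "?g z \<in> S2xS2" using mem[OF inv] by blast
    then show "z \<in> ?f ` S2xS2" using fg[of z] by (metis (no_types, lifting) image_eqI)
  qed (use mem[OF R] in auto)
  have invf: "inv_into S2xS2 ?f z = ?g z" if "z \<in> S2xS2" for z
    by (rule inv_into_f_eq[OF inj]) (use mem[OF inv] that fg[of z] in auto)
  show ?thesis
    unfolding isometry_S2xS2_def
  proof (intro conjI ballI)
    show "bij_betw ?f S2xS2 S2xS2" using inj im by (simp add: bij_betw_def)
    show "smooth_map_on S2xS2 ?f" by (rule sm[OF bl[OF R]]) simp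
    show "smooth_map_on S2xS2 (inv_into S2xS2 ?f)" by (rule sm[OF bl[OF inv]]) (rule invf)
    fix p assume "p \<in> S2xS2"
    show "\<exists>D. (?f has_derivative D) (at p within S2xS2) \<and>
        (\<forall>v\<in>tangent_S2xS2 p. \<forall>w\<in>tangent_S2xS2 p. D v \<bullet> D w = v \<bullet> w)"
      using R bounded_linear_imp_has_derivative[OF bl[OF R]]
      by (intro exI[of _ ?f]) (auto simp: inner_prod_def orthogonal_transformation_def)
  qed
qed

section \<open>Global argument on a compact surface given by charts\<close>

locale pmc_surface =
  fixes S :: "'a::t2_space set" and A :: "'a chart set" and \<Phi> :: "'a \<Rightarrow> R33"
  assumes surface: "smooth_surface S A" and conn: "connected S" and comp: "compact S"
    and imm: "immersion_S2xS2 S A \<Phi>" and lagr: "lagrangian A \<Phi>"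
    and pmc: "parallel_mean_curvature A \<Phi>" and nonnull: "mean_curvature_non_null A \<Phi>"
begin

abbreviation F where "F c \<equiv> \<Phi> \<circ> chart_inv c"

lemma chart:
  assumes "c \<in> A"
  shows "openin (top_of_set S) (fst c)" "open (chart_image c)"
    "homeomorphism (fst c) (chart_image c) (snd c) (chart_inv c)"
  using surface assms by (auto simp: smooth_surface_def)

lemma chart_points:
  assumes "c \<in> A"
  shows "s \<in> fst c \<Longrightarrow> snd c s \<in> chart_image c" "s \<in> fst c \<Longrightarrow> chart_inv c (snd c s) = s"
    "u \<in> chart_image c \<Longrightarrow> chart_inv c u \<in> fst c" "u \<in> chart_image c \<Longrightarrow> snd c (chart_inv c u) = u"
    "s \<in> fst c \<Longrightarrow> s \<in> S"
  using chart[OF assms] openin_imp_subset[OF chart(1)[OF assms]] by (auto simp: homeomorphism_def)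

lemma covered: "s \<in> S \<Longrightarrow> \<exists>c\<in>A. s \<in> fst c"
  using surface by (auto simp: smooth_surface_def)

lemma patch:
  assumes c: "c \<in> A"
  shows "lagrangian_patch (chart_image c) (F c)"
proof
  show "smooth_on (chart_image c) (F c)"
    using smooth_map_on_open[OF chart(2)[OF c], of "F c"] imm c by (simp add: immersion_S2xS2_def)
  show "F c u \<in> S2xS2" if "u \<in> chart_image c" for u
    using imm chart_points(3,5)[OF c] that by (auto simp: immersion_S2xS2_def)
  show "inj (dd (F c) u)" if "u \<in> chart_image c" for u
    using imm c that by (auto simp: immersion_S2xS2_def)
  show "kaehler_form (F c u) (dd (F c) u v) (dd (F c) u w) = 0" if "u \<in> chart_image c" for u v w
    using lagr c that unfolding lagrangian_def Let_def by blast
qed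

lemma chart_preimage:
  assumes c: "c \<in> A" and V: "open V"
  shows "openin (top_of_set S) (fst c \<inter> snd c -` V)"
proof -
  have "continuous_on (fst c) (snd c)" using chart(3)[OF c] by (simp add: homeomorphism_def)
  then have "openin (top_of_set (fst c)) (fst c \<inter> snd c -` V)"
    using V by (rule continuous_openin_preimage_gen)
  then show ?thesis using chart(1)[OF c] by (rule openin_trans)
qed

lemma chart_open_image:
  assumes c: "c \<in> A" and V: "openin (top_of_set S) V" "V \<subseteq> fst c"
  shows "open (snd c ` V)"
proof -
  have "openin (top_of_set (fst c)) V"
    by (rule openin_subset_trans[OF V openin_imp_subset[OF chart(1)[OF c]]])
  then have "openin (top_of_set (chart_image c)) (snd c ` V)"
    by (rule homeomorphism_imp_open_map[OF chart(3)[OF c]])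
  then show ?thesis using chart(2)[OF c] by (rule openin_open_trans)
qed

lemma transition:
  assumes c: "c \<in> A" "d \<in> A" and s: "s \<in> fst c" "s \<in> fst d"
  obtains U t where "smooth_on U t" "U \<subseteq> chart_image c" "\<And>x. x \<in> U \<Longrightarrow> t x \<in> chart_image d"
    "\<And>x. x \<in> U \<Longrightarrow> F c x = F d (t x)" "snd c s \<in> U" "t (snd c s) = snd d s"
proof (rule that[of "snd c ` (fst c \<inter> fst d)" "snd d \<circ> chart_inv c"])
  have "open (snd c ` (fst c \<inter> fst d))"
    by (rule chart_open_image[OF c(1)]) (use chart(1)[OF c(1)] chart(1)[OF c(2)] in auto)
  then show "smooth_on (snd c ` (fst c \<inter> fst d)) (snd d \<circ> chart_inv c)"
    using surface c by (intro smooth_map_on_open) (auto simp: smooth_surface_def)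
qed (use s chart_points[OF c(1)] chart_points[OF c(2)] in auto)

lemma mean_curvature_welldefined:
  assumes c: "c \<in> A" "d \<in> A" and s: "s \<in> fst c" "s \<in> fst d"
  shows "mean_curvature_vector (F c) (snd c s) = mean_curvature_vector (F d) (snd d s)"
proof -
  obtain U t where "smooth_on U t" "U \<subseteq> chart_image c" "\<And>x. x \<in> U \<Longrightarrow> t x \<in> chart_image d"
    "\<And>x. x \<in> U \<Longrightarrow> F c x = F d (t x)" "snd c s \<in> U" "t (snd c s) = snd d s"
    by (rule transition[OF c s]) (rule that)
  then show ?thesis
    using mean_curvature_reparam[OF patch[OF c(1)] patch[OF c(2)], of U t "snd c s"] by simp
qed

lemma jac2_welldefined:
  assumes c: "c \<in> A" "d \<in> A" and s: "s \<in> fst c" "s \<in> fst d"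
    and on: "on_pair (F c) (snd c s) v w" "on_pair (F d) (snd d s) v' w'"
  shows "jac2 (F c) (snd c s) v w = jac2 (F d) (snd d s) v' w'"
proof -
  interpret d: lagrangian_patch "chart_image d" "F d" by (rule patch[OF c(2)])
  obtain U t where U: "smooth_on U t" "U \<subseteq> chart_image c" "\<And>x. x \<in> U \<Longrightarrow> t x \<in> chart_image d"
    "\<And>x. x \<in> U \<Longrightarrow> F c x = F d (t x)" "snd c s \<in> U" "t (snd c s) = snd d s"
    by (rule transition[OF c s]) (rule that)
  let ?t' = "frechet_derivative t (at (snd c s))"
  have "on_pair (F d) (snd d s) (?t' v) (?t' w)"
    using on(1) on_pair_reparam[where F = "F c" and G = "F d", OF d.smooth_F U(1,3,4,5)] U(6) by metis
  then have "jac2 (F d) (snd d s) (?t' v) (?t' w) = jac2 (F d) (snd d s) v' w'"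
    by (rule d.on_pair_jac2[OF chart_points(1)[OF c(2) s(2)] on(2)])
  then show ?thesis
    using jac2_reparam[where F = "F c" and G = "F d", OF d.smooth_F U(1,3,4,5)] U(6) by metis
qed

lemma nonempty: "S \<noteq> {}"
  using nonnull chart_points(3,5) by (fastforce simp: mean_curvature_non_null_def)

lemma norm_mean_curvature:
  obtains m where "m > 0"
    "\<And>c u. c \<in> A \<Longrightarrow> u \<in> chart_image c \<Longrightarrow> norm (mean_curvature_vector (F c) u) = m"
proof -
  \<comment> \<open>The length of H as a function on the surface: any chart at the point may be
    chosen, since H does not depend on it.\<close>
  define h where "h s = (let c = SOME c. c \<in> A \<and> s \<in> fst c in norm (mean_curvature_vector (F c) (snd c s)))" for s
  have h: "h s = norm (mean_curvature_vector (F c) (snd c s))" if "c \<in> A" "s \<in> fst c" for c s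
  proof -
    have d: "(SOME c. c \<in> A \<and> s \<in> fst c) \<in> A \<and> s \<in> fst (SOME c. c \<in> A \<and> s \<in> fst c)"
      by (rule someI[of "\<lambda>c. c \<in> A \<and> s \<in> fst c" c]) (use that in blast)
    show ?thesis
      unfolding h_def Let_def
      by (subst mean_curvature_welldefined[OF conjunct1[OF d] that(1) conjunct2[OF d] that(2)]) (rule refl)
  qed
  have const: "h s = h t" if "s \<in> S" "t \<in> S" for s t
  proof (rule connected_locally_constant[OF conn that])
    fix x assume "x \<in> S"
    then obtain c where c: "c \<in> A" "x \<in> fst c" using covered by blast
    interpret c: lagrangian_patch "chart_image c" "F c" by (rule patch[OF c(1)])
    have u: "snd c x \<in> chart_image c" using chart_points(1)[OF c] .
    then obtain r where r: "r > 0" "ball (snd c x) r \<subseteq> chart_image c"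
      using chart(2)[OF c(1)] open_contains_ball by blast
    have par: "normal_deriv (F c) (mean_curvature_vector (F c)) u v = 0" if "u \<in> chart_image c" for u v
      using pmc c(1) that unfolding parallel_mean_curvature_def Let_def by blast
    have "h y = h x" if "y \<in> fst c \<inter> snd c -` ball (snd c x) r" for y
      using c.norm_mean_curvature_constant[OF par open_ball convex_ball r(2), of "snd c y" "snd c x"] that r(1) c
      by (simp add: h)
    moreover have "x \<in> fst c \<inter> snd c -` ball (snd c x) r" using c(2) r(1) by simp
    ultimately show "\<exists>V. openin (top_of_set S) V \<and> x \<in> V \<and> (\<forall>y\<in>V. h y = h x)"
      using chart_preimage[OF c(1) open_ball, of "snd c x" r] by blast
  qed
  obtain c u where cu: "c \<in> A" "u \<in> chart_image c" "mean_curvature_vector (F c) u \<noteq> 0"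
    using nonnull by (auto simp: mean_curvature_non_null_def)
  have hu: "norm (mean_curvature_vector (F d) v) = h (chart_inv d v)" if "d \<in> A" "v \<in> chart_image d" for d v
    using h[OF that(1) chart_points(3)[OF that]] chart_points(4)[OF that] by simp
  show thesis
  proof (rule that[of "norm (mean_curvature_vector (F c) u)"])
    show "norm (mean_curvature_vector (F d) v) = norm (mean_curvature_vector (F c) u)"
      if "d \<in> A" "v \<in> chart_image d" for d v
      unfolding hu[OF that] hu[OF cu(1,2)]
      by (rule const) (use chart_points(3,5) that cu(1,2) in blast)+
  qed (use cu(3) in simp)
qed

lemma parallel_frame_on:
  assumes m: "m > 0" "\<And>c u. c \<in> A \<Longrightarrow> u \<in> chart_image c \<Longrightarrow> norm (mean_curvature_vector (F c) u) = m"
    and c: "c \<in> A" and V: "open V" "V \<subseteq> chart_image c"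
  obtains X Y where "parallel_frame V (F c) X Y m"
proof -
  interpret c: lagrangian_patch "chart_image c" "F c" by (rule patch[OF c])
  interpret V: lagrangian_patch V "F c" by (rule c.restrict[OF V])
  show thesis
    by (rule V.exists_parallel_frame[OF m(1) _ _ that])
      (use m(2)[OF c] V(2) pmc c in \<open>auto simp: parallel_mean_curvature_def Let_def\<close>)
qed

text \<open>The squared Jacobian is a continuous function on the compact surface and so attains its
  maximum. It vanishes there, hence everywhere.\<close>

lemma jacobian_vanishes:
  assumes m: "m > 0" "\<And>c u. c \<in> A \<Longrightarrow> u \<in> chart_image c \<Longrightarrow> norm (mean_curvature_vector (F c) u) = m"
    and c: "c \<in> A" "u \<in> chart_image c" "on_pair (F c) u v w"
  shows "jac2 (F c) u v w = 0"
proof -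
  \<comment> \<open>The value is chosen over all charts and all orthonormal pairs at the point; any
    two choices give the same number.\<close>
  define j where "j s = (SOME r. \<exists>c v w. c \<in> A \<and> s \<in> fst c \<and> on_pair (F c) (snd c s) v w \<and>
    r = jac2 (F c) (snd c s) v w)" for s
  have j: "j s = jac2 (F c) (snd c s) v w" if "c \<in> A" "s \<in> fst c" "on_pair (F c) (snd c s) v w" for s c v w
  proof -
    have "\<exists>c v w. c \<in> A \<and> s \<in> fst c \<and> on_pair (F c) (snd c s) v w \<and> j s = jac2 (F c) (snd c s) v w"
      unfolding j_def by (rule someI_ex) (use that in blast)
    then show ?thesis using jac2_welldefined that by metis
  qed
  have frame: "\<exists>X Y. parallel_frame (chart_image c) (F c) X Y m" if "c \<in> A" for c
    using parallel_frame_on[OF m that chart(2)[OF that] order_refl] by metis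
  have cont: "continuous_on S j"
  proof (rule continuous_on_locally)
    fix s assume "s \<in> S"
    then obtain c where c: "c \<in> A" "s \<in> fst c" using covered by blast
    obtain X Y where "parallel_frame (chart_image c) (F c) X Y m" using frame[OF c(1)] by blast
    then interpret c: parallel_frame "chart_image c" "F c" X Y m .
    have "continuous_on (fst c) (\<lambda>t. (c.P.D (snd c t))\<^sup>2)"
    proof (rule continuous_on_power, rule continuous_on_compose2[OF smooth_onD(3)[OF c.P.sD]])
      show "continuous_on (fst c) (snd c)" using chart(3)[OF c(1)] by (simp add: homeomorphism_def)
      show "snd c ` fst c \<subseteq> chart_image c" by (simp add: chart_image_def)
    qed
    moreover have "(c.P.D (snd c t))\<^sup>2 = j t" if "t \<in> fst c" for t
      using c.D_jac2[OF chart_points(1)[OF c(1) that]] j[OF c(1) that c.on[OF chart_points(1)[OF c(1) that]]]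
      by simp
    ultimately have "continuous_on (fst c) j" using continuous_on_cong by fastforce
    then show "\<exists>V. openin (top_of_set S) V \<and> s \<in> V \<and> continuous_on V j"
      using chart(1)[OF c(1)] c(2) by blast
  qed
  obtain s where s: "s \<in> S" "\<And>t. t \<in> S \<Longrightarrow> j t \<le> j s"
    using continuous_attains_sup[OF comp nonempty cont] by blast
  obtain d where d: "d \<in> A" "s \<in> fst d" using covered[OF s(1)] by blast
  obtain X Y where "parallel_frame (chart_image d) (F d) X Y m" using frame[OF d(1)] by blast
  then interpret d: parallel_frame "chart_image d" "F d" X Y m .
  have jD: "j (chart_inv d x) = (d.P.D x)\<^sup>2" if x: "x \<in> chart_image d" for x
    using j[OF d(1) chart_points(3)[OF d(1) x]] d.on[OF x] d.D_jac2[OF x] chart_points(4)[OF d(1) x] by simp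
  let ?u = "snd d s"
  have u: "?u \<in> chart_image d" by (rule chart_points(1)[OF d])
  have max: "(d.P.D x)\<^sup>2 \<le> (d.P.D ?u)\<^sup>2" if x: "x \<in> chart_image d" for x
    using s(2)[of "chart_inv d x"] jD[OF x] jD[OF u] chart_points(2)[OF d] chart_points(3,5)[OF d(1)] x by auto
  have sD2: "smooth_on (chart_image d) (\<lambda>x. (d.P.D x)\<^sup>2)" by (rule smooth_on_power2[OF d.P.sD])
  have "frechet_derivative (\<lambda>x. (d.P.D x)\<^sup>2) (at ?u) = (\<lambda>v. 0)"
    by (rule differential_zero_maxmin[OF u chart(2)[OF d(1)] smooth_onD(5)[OF sD2 u]]) (use max in blast)
  then have "dir_deriv Z (\<lambda>x. d.P.D x * d.P.D x) ?u = 0" for Z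
    by (simp add: dir_deriv_def power2_eq_square)
  then have crit: "d.P.D ?u * dir_deriv Z d.P.D ?u = 0" for Z
    using dir_deriv_mult[OF d.P.sD d.P.sD u, of Z] by simp
  \<comment> \<open>At the maximum of D^2 each derivative of \<open>D\<close> times \<open>D\<close>
    is zero. Either \<open>D\<close> vanishes, or its derivatives do and the critical point lemma
    applies.\<close>
  have "d.P.D ?u = 0"
    using d.jacobian_critical_point[OF u] crit[of X] crit[of Y] by (metis mult_eq_0_iff)
  then have "j s = 0" using jD[OF u] chart_points(2)[OF d] by simp
  then have "j (chart_inv c u) \<le> 0" using s(2) chart_points(3,5)[OF c(1)] c(2) by metis
  moreover have "j (chart_inv c u) = jac2 (F c) u v w"
    using j[OF c(1) chart_points(3)[OF c(1,2)]] chart_points(4)[OF c(1,2)] c(3) by simp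
  ultimately show ?thesis by (simp add: jac2_def)
qed

text \<open>A factor lies on a great circle exactly when its \<open>E\<close> vanishes. The two
  values of \<open>E\<close> sum to 1, so the heights cannot both be zero.\<close>

lemma local_planes:
  assumes s: "s \<in> S"
  obtains V N1 N2 k1 k2 where "openin (top_of_set S) V" "s \<in> V"
    "rigid_plane S (\<lambda>t. fst (\<Phi> t)) V N1 k1" "rigid_plane S (\<lambda>t. snd (\<Phi> t)) V N2 k2"
    "\<bar>k1\<bar> < 1" "\<bar>k2\<bar> < 1" "k1 \<noteq> 0 \<or> k2 \<noteq> 0"
proof -
  obtain m where m: "m > 0" "\<And>c u. c \<in> A \<Longrightarrow> u \<in> chart_image c \<Longrightarrow> norm (mean_curvature_vector (F c) u) = m"
    by (rule norm_mean_curvature) (rule that)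
  obtain c where c: "c \<in> A" "s \<in> fst c" using covered[OF s] by blast
  let ?u = "snd c s"
  have u: "?u \<in> chart_image c" by (rule chart_points(1)[OF c])
  then obtain r where r: "r > 0" "ball ?u r \<subseteq> chart_image c"
    using chart(2)[OF c(1)] open_contains_ball by blast
  obtain X Y where "parallel_frame (ball ?u r) (F c) X Y m"
    by (rule parallel_frame_on[OF m c(1) open_ball r(2)])
  then interpret B: parallel_frame "ball ?u r" "F c" X Y m .
  have ub: "?u \<in> ball ?u r" using r(1) by simp
  have D0: "B.P.D x = 0" if "x \<in> ball ?u r" for x
    using B.D_jac2[OF that] jacobian_vanishes[OF m c(1) _ B.on[OF that]] that r(2) by auto
  have span: "\<exists>a b. v = a *\<^sub>R X x + b *\<^sub>R Y x" if "x \<in> ball ?u r" for x v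
    using B.frame_spans[OF that] by metis
  note rel = B.factor_relations
  have co: "B.p x = m * (1 + (2 * B.P.E x - 1)\<^sup>2)" "B.q x = m * (2 * B.P.E x - 1) * (2 * B.P.B x)"
    if "x \<in> ball ?u r" for x
    by (rule B.flat_coefficients[OF D0 that], assumption)+
  obtain N1 k1 where N1: "norm N1 = 1" "\<forall>x\<in>ball ?u r. fst (F c x) \<bullet> N1 = k1" "\<bar>k1\<bar> < 1"
    "k1 = 0 \<longleftrightarrow> B.P.E ?u = 0"
    "\<forall>V N' k'. open V \<and> V \<subseteq> ball ?u r \<and> V \<noteq> {} \<and> norm N' = 1 \<and> (\<forall>x\<in>V. fst (F c x) \<bullet> N' = k') \<longrightarrow> N' = N1 \<or> N' = - N1"
    using B.P.factor_in_circle[OF D0 rel(2) co span convex_ball ub m(1)] by blast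
  \<comment> \<open>Passing to the second factor replaces E by 1 - E and B by -B, so 2E - 1 and 2B
    both change sign while the formulas for \<open>p\<close> and \<open>q\<close> are even in this
    pair.\<close>
  have Q: "B.Q.D x = 0" "B.Q.G x = 1 - B.Q.E x" "B.p x = m * (1 + (2 * B.Q.E x - 1)\<^sup>2)"
    "B.q x = m * (2 * B.Q.E x - 1) * (2 * B.Q.B x)" if "x \<in> ball ?u r" for x
    unfolding rel[OF that] co[OF that] D0[OF that] by (simp_all add: power2_eq_square algebra_simps)
  obtain N2 k2 where N2: "norm N2 = 1" "\<forall>x\<in>ball ?u r. snd (F c x) \<bullet> N2 = k2" "\<bar>k2\<bar> < 1"
    "k2 = 0 \<longleftrightarrow> B.Q.E ?u = 0"
    "\<forall>V N' k'. open V \<and> V \<subseteq> ball ?u r \<and> V \<noteq> {} \<and> norm N' = 1 \<and> (\<forall>x\<in>V. snd (F c x) \<bullet> N' = k') \<longrightarrow> N' = N2 \<or> N' = - N2"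
    using B.Q.factor_in_circle[OF Q span convex_ball ub m(1)] by blast
  let ?V = "fst c \<inter> snd c -` ball ?u r"
  have V: "F c (snd c t) = \<Phi> t" "snd c t \<in> ball ?u r" if "t \<in> ?V" for t
    using that chart_points(2)[OF c(1)] by auto
  have image: "open (snd c ` V')" "snd c ` V' \<subseteq> ball ?u r" "\<forall>t\<in>V'. F c (snd c t) = \<Phi> t"
    if "openin (top_of_set S) V'" "V' \<subseteq> ?V" for V'
    subgoal using chart_open_image[OF c(1) that(1)] that(2) by auto
    subgoal using that(2) by auto
    subgoal using that(2) V(1) by blast
    done
  have rigid: "rigid_plane S (\<lambda>t. \<pi> (\<Phi> t)) ?V N k"
    if N: "norm N = 1" "\<forall>x\<in>ball ?u r. \<pi> (F c x) \<bullet> N = k"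
      "\<forall>V N' k'. open V \<and> V \<subseteq> ball ?u r \<and> V \<noteq> {} \<and> norm N' = 1 \<and> (\<forall>x\<in>V. \<pi> (F c x) \<bullet> N' = k') \<longrightarrow> N' = N \<or> N' = - N"
    for \<pi> :: "R33 \<Rightarrow> real^3" and N k
    unfolding rigid_plane_def
  proof (intro conjI ballI allI impI)
    fix t assume "t \<in> ?V"
    then show "\<pi> (\<Phi> t) \<bullet> N = k" using N(2) V[of t] by metis
  next
    fix V' N' k'
    assume "openin (top_of_set S) V' \<and> V' \<subseteq> ?V \<and> V' \<noteq> {} \<and> norm N' = 1 \<and> (\<forall>t\<in>V'. \<pi> (\<Phi> t) \<bullet> N' = k')"
    then show "N' = N \<or> N' = - N"
      using image[of V'] by (intro N(3)[rule_format, of "snd c ` V'" N' k']) auto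
  qed (rule N(1))
  show thesis
  proof (rule that[of ?V N1 k1 N2 k2])
    show "openin (top_of_set S) ?V" by (rule chart_preimage[OF c(1) open_ball])
    show "s \<in> ?V" using c(2) ub by simp
    show "k1 \<noteq> 0 \<or> k2 \<noteq> 0" using N1(4) N2(4) rel(1)[OF ub] by auto
  qed (fact N1(3) N2(3) rigid[OF N1(1,2,5)] rigid[OF N2(1,2,5)])+
qed

text \<open>The rotated immersion maps a surface into a two-dimensional torus and is therefore a
  local homeomorphism. The bounds on \<open>a\<close> and \<open>b\<close> keep both circles from
  degenerating.\<close>

lemma finite_covering_of_torus:
  assumes R: "orthogonal_transformation R" "orthogonal_transformation R'"
    and im: "\<And>s. s \<in> S \<Longrightarrow> (R (fst (\<Phi> s)), R' (snd (\<Phi> s))) \<in> T_torus a b"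
    and ab: "\<bar>a\<bar> < 1" "\<bar>b\<bar> < 1"
  shows "finite_covering S ((\<lambda>z. (R (fst z), R' (snd z))) \<circ> \<Phi>) (T_torus a b)"
proof (rule compact_local_homeomorphism_finite_covering[OF comp nonempty _ _ connected_T_torus])
  let ?f = "(\<lambda>z. (R (fst z), R' (snd z))) \<circ> \<Phi>" and ?R = "\<lambda>z::R33. (R (fst z), R' (snd z))"
  have bl: "bounded_linear ?R"
    using R by (intro bounded_linear_Pair bounded_linear_compose[OF _ bounded_linear_fst] bounded_linear_compose[OF _ bounded_linear_snd])
      (simp_all add: orthogonal_transformation_def linear_conv_bounded_linear)
  have injR: "inj ?R"
    using injD[OF orthogonal_transformation_inj[OF R(1)]] injD[OF orthogonal_transformation_inj[OF R(2)]]
    by (intro injI prod_eqI) (metis prod.inject)+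
  have \<Phi>: "?f t = ?R (F c (snd c t))" if "c \<in> A" "t \<in> fst c" for c t
    using chart_points(2)[OF that] by simp
  show "?f ` S \<subseteq> T_torus a b" using im by auto
  show "continuous_on S ?f"
  proof (rule continuous_on_locally)
    fix s assume "s \<in> S"
    then obtain c where c: "c \<in> A" "s \<in> fst c" using covered by blast
    interpret c: lagrangian_patch "chart_image c" "F c" by (rule patch[OF c(1)])
    have "continuous_on (fst c) (\<lambda>t. ?R (F c (snd c t)))"
    proof (rule continuous_on_compose2[OF smooth_onD(3)[OF smooth_on_bounded_linear[OF bl c.smooth_F]]])
      show "continuous_on (fst c) (snd c)" using chart(3)[OF c(1)] by (simp add: homeomorphism_def)
      show "snd c ` fst c \<subseteq> chart_image c" by (simp add: chart_image_def)
    qed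
    then have "continuous_on (fst c) ?f" by (rule continuous_on_eq) (rule \<Phi>[OF c(1), symmetric])
    then show "\<exists>V. openin (top_of_set S) V \<and> s \<in> V \<and> continuous_on V ?f"
      using chart(1)[OF c(1)] c(2) by blast
  qed
  fix s assume "s \<in> S"
  then obtain c where c: "c \<in> A" "s \<in> fst c" using covered by blast
  interpret c: lagrangian_patch "chart_image c" "F c" by (rule patch[OF c(1)])
  let ?u = "snd c s" and ?G = "\<lambda>u. ?R (F c u)"
  have u: "?u \<in> chart_image c" by (rule chart_points(1)[OF c])
  have sG: "smooth_on (chart_image c) ?G" by (rule smooth_on_bounded_linear[OF bl c.smooth_F])
  have "dd ?G ?u v = ?R (dd (F c) ?u v)" for v
    using dir_deriv_bounded_linear[OF c.smooth_F u bl, of "\<lambda>_. v"] by (simp only: dir_deriv_def)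
  then have "dd ?G ?u = ?R \<circ> dd (F c) ?u" by auto
  then have injG: "inj (dd ?G ?u)" by (simp only: inj_compose[OF injR c.immersed[OF u]])
  have imG: "?G u \<in> T_torus a b" if "u \<in> chart_image c" for u
    using im[of "chart_inv c u"] chart_points(3,5)[OF c(1)] that by simp
  obtain V where V: "open V" "?u \<in> V" "V \<subseteq> chart_image c" "inj_on ?G V"
    "\<forall>U. open U \<and> U \<subseteq> V \<longrightarrow> openin (top_of_set (T_torus a b)) (?G ` U)"
    using torus_patch_local_homeomorphism[OF sG imG ab injG u] by blast
  let ?V = "fst c \<inter> snd c -` V"
  show "\<exists>V. openin (top_of_set S) V \<and> s \<in> V \<and> inj_on ?f V \<and>
      (\<forall>U. openin (top_of_set S) U \<and> U \<subseteq> V \<longrightarrow> openin (top_of_set (T_torus a b)) (?f ` U))"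
  proof (intro exI[of _ ?V] conjI allI impI)
    show "openin (top_of_set S) ?V" by (rule chart_preimage[OF c(1) V(1)])
    show "s \<in> ?V" using c(2) V(2) by simp
    show "inj_on ?f ?V"
    proof (rule inj_onI)
      fix x y assume xy: "x \<in> ?V" "y \<in> ?V" "?f x = ?f y"
      then have "snd c x = snd c y" using \<Phi>[OF c(1)] V(4) by (intro inj_onD[OF V(4)]) auto
      then show "x = y" using xy chart_points(2)[OF c(1)] by (metis IntD1)
    qed
    fix U assume U: "openin (top_of_set S) U \<and> U \<subseteq> ?V"
    then have "open (snd c ` U)" "snd c ` U \<subseteq> V" using chart_open_image[OF c(1)] by auto
    then have "openin (top_of_set (T_torus a b)) (?G ` snd c ` U)" using V(5) by blast
    moreover have "?G ` snd c ` U = ?f ` U"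
    proof -
      have "?G (snd c t) = ?f t" if "t \<in> U" for t using \<Phi>[OF c(1), of t] U that by auto
      then show ?thesis unfolding image_image by (rule image_cong[OF refl])
    qed
    ultimately show "openin (top_of_set (T_torus a b)) (?f ` U)" by simp
  qed
qed

lemma congruent_to_torus:
  "\<exists>a b. a \<in> {0..<1} \<and> b \<in> {0..<1} \<and> a\<^sup>2 + b\<^sup>2 > 0 \<and> congruent_to_finite_covering S \<Phi> (T_torus a b)"
proof -
  obtain s0 where s0: "s0 \<in> S" using nonempty by blast
  have "\<exists>N a. norm N = 1 \<and> 0 \<le> a \<and> (\<forall>t\<in>S. fst (\<Phi> t) \<bullet> N = a)"
    by (rule local_planes_global[OF conn s0]) (erule local_planes, blast)
  then obtain M1 a where M1: "norm M1 = 1" "0 \<le> a" "\<forall>t\<in>S. fst (\<Phi> t) \<bullet> M1 = a" by blast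
  have "\<exists>N a. norm N = 1 \<and> 0 \<le> a \<and> (\<forall>t\<in>S. snd (\<Phi> t) \<bullet> N = a)"
    by (rule local_planes_global[OF conn s0]) (erule local_planes, blast)
  then obtain M2 b where M2: "norm M2 = 1" "0 \<le> b" "\<forall>t\<in>S. snd (\<Phi> t) \<bullet> M2 = b" by blast
  obtain V N1 N2 k1 k2 where V: "openin (top_of_set S) V" "s0 \<in> V"
    and pl: "rigid_plane S (\<lambda>t. fst (\<Phi> t)) V N1 k1" "rigid_plane S (\<lambda>t. snd (\<Phi> t)) V N2 k2"
    and k: "\<bar>k1\<bar> < 1" "\<bar>k2\<bar> < 1" "k1 \<noteq> 0 \<or> k2 \<noteq> 0"
    by (rule local_planes[OF s0]) (rule that)
  have VS: "V \<subseteq> S" using V(1) openin_imp_subset by blast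
  \<comment> \<open>Rigidity identifies the global normal with the local one up to sign, so the
    bounds and the nonvanishing known for the local heights pass to \<open>a\<close> and
    \<open>b\<close>.\<close>
  have "M1 = N1 \<or> M1 = - N1"
    by (rule rigid_planeD(3)[OF pl(1), of V M1 a]) (use V VS M1 in auto)
  then have a: "\<bar>a\<bar> = \<bar>k1\<bar>" using M1(3) rigid_planeD(2)[OF pl(1) V(2)] s0 by auto
  have "M2 = N2 \<or> M2 = - N2"
    by (rule rigid_planeD(3)[OF pl(2), of V M2 b]) (use V VS M2 in auto)
  then have b: "\<bar>b\<bar> = \<bar>k2\<bar>" using M2(3) rigid_planeD(2)[OF pl(2) V(2)] s0 by auto
  have n1: "norm (axis 1 1 :: real^3) = 1" by (simp add: norm_axis_1)
  \<comment> \<open>Rotating each axis to the first coordinate vector turns the two plane equations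
    into those of the torus.\<close>
  obtain R :: "real^3 \<Rightarrow> real^3" where R: "orthogonal_transformation R" "R M1 = axis 1 1"
    by (rule orthogonal_transformation_exists_1[OF M1(1) n1]) (rule that)
  obtain R' :: "real^3 \<Rightarrow> real^3" where R': "orthogonal_transformation R'" "R' M2 = axis 1 1"
    by (rule orthogonal_transformation_exists_1[OF M2(1) n1]) (rule that)
  have "(R (fst (\<Phi> s)), R' (snd (\<Phi> s))) \<in> T_torus a b" if s: "s \<in> S" for s
  proof -
    have "\<Phi> s \<in> S2xS2" using imm s by (auto simp: immersion_S2xS2_def)
    moreover have "R (fst (\<Phi> s)) \<bullet> R M1 = a" "R' (snd (\<Phi> s)) \<bullet> R' M2 = b"
      using R(1) R'(1) M1(3) M2(3) s by (auto simp: orthogonal_transformation_def)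
    ultimately show ?thesis
      using R(1) R'(1) unfolding R(2) R'(2)
      by (simp add: T_torus_def mem_S2xS2 orthogonal_transformation_def inner_axis)
  qed
  then have "finite_covering S ((\<lambda>z. (R (fst z), R' (snd z))) \<circ> \<Phi>) (T_torus a b)"
    using a b k by (intro finite_covering_of_torus R(1) R'(1)) auto
  then have "congruent_to_finite_covering S \<Phi> (T_torus a b)"
    using isometry_product_orthogonal[OF R(1) R'(1)] unfolding congruent_to_finite_covering_def by blast
  moreover have "a\<^sup>2 + b\<^sup>2 > 0" using a b k(3) by (auto simp: sum_power2_gt_zero_iff)
  ultimately show ?thesis using a b k M1(2) M2(2) by (intro exI[of _ a] exI[of _ b]) auto
qed

end

theorem theorem1:
  fixes \<Sigma> :: "'a::t2_space set"
    and A :: "'a chart set"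
    and \<Phi> :: "'a \<Rightarrow> (real^3) \<times> (real^3)"
  assumes "smooth_surface \<Sigma> A" and "connected \<Sigma>" and "compact \<Sigma>"
    and "immersion_S2xS2 \<Sigma> A \<Phi>"
    and "lagrangian A \<Phi>"
    and "parallel_mean_curvature A \<Phi>"
    and "mean_curvature_non_null A \<Phi>"
  shows "\<exists>a b. a \<in> {0..<1} \<and> b \<in> {0..<1} \<and> a\<^sup>2 + b\<^sup>2 > 0 \<and>
           congruent_to_finite_covering \<Sigma> \<Phi> (T_torus a b)"
  by (rule pmc_surface.congruent_to_torus[OF pmc_surface.intro[OF assms]])

end
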